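(* Let $p$ be a prime, let $I$ be a directed set, and let $\{G_i,\pi_{ij}\}_{i\in I}$ be a projective system of Bloch-Kato pro-$p$ groups with transition maps $\pi_{ij}\colon G_j\to G_i$ surjective for all $i\le j$, such that the inflation maps $$\inf\nolimits_{ij}^\bullet\colon H^\bullet(G_i,\mathbb{F}_p)\to H^\bullet(G_j,\mathbb{F}_p)$$ induced by $\pi_{ij}$ are injective for all $i\le j$. Then for $\hat G=\varprojlim_i G_i$ the cohomology ring $H^\bullet(\hat G,\mathbb{F}_p)$ is quadratic.
   Context: A graded $\mathbb{F}_p$-algebra $A_\bullet=\bigoplus_{n\ge0}A_n$ with $A_0=\mathbb{F}_p$ is quadratic if it is generated by $A_1$ and all its relations are generated in degree $2$, i.e. $A_\bullet\cong T(A_1)/(R)$ with $R\subseteq A_1\otimes A_1$, where $T(A_1)$ is the tensor algebra. A pro-$p$ group $G$ is a Bloch-Kato pro-$p$ group if for every closed subgroup $K$ of $G$ the continuous cohomology ring $H^\bullet(K,\mathbb{F}_p)$ (trivial coefficients, cup product) is a quadratic $\mathbb{F}_p$-algebra. *)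

theory Defs
  imports
    "HOL-Analysis.Product_Topology"
    "HOL-Analysis.T1_Spaces"
    "HOL-Algebra.Module"
    "HOL-Algebra.QuotRing"
    "HOL-Algebra.Product_Groups"
    "HOL-Number_Theory.Residues"
begin

section \<open>Graded algebras and quadratic algebras\<close>

text \<open>The library locale \<^locale>\<open>algebra\<close> demands a commutative multiplication, so
  associative algebras that need not be commutative are introduced here. The grading is internal:
  \<open>grade A n\<close> is the homogeneous component of degree \<open>n\<close> as a subset of \<open>carrier A\<close>.\<close>

record ('r, 'a) graded_algebra = "('r, 'a) module" +
  grade :: "nat \<Rightarrow> 'a set"

locale graded_algebra = module R A + ring A
  for R :: "('r, 'c) ring_scheme" (structure)
    and A :: "('r, 'a, 'd) graded_algebra_scheme" (structure) +
  assumes smult_mult_left: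
      "\<lbrakk>r \<in> carrier R; x \<in> carrier A; y \<in> carrier A\<rbrakk> \<Longrightarrow>
        (r \<odot>\<^bsub>A\<^esub> x) \<otimes>\<^bsub>A\<^esub> y = r \<odot>\<^bsub>A\<^esub> (x \<otimes>\<^bsub>A\<^esub> y)"
    and smult_mult_right:
      "\<lbrakk>r \<in> carrier R; x \<in> carrier A; y \<in> carrier A\<rbrakk> \<Longrightarrow>
        x \<otimes>\<^bsub>A\<^esub> (r \<odot>\<^bsub>A\<^esub> y) = r \<odot>\<^bsub>A\<^esub> (x \<otimes>\<^bsub>A\<^esub> y)"
    and grade_submodule: "submodule (grade A n) R A"
    and grade_direct_sum:
      "a \<in> carrier A \<Longrightarrow> \<exists>!h. (\<forall>n. h n \<in> grade A n) \<and> finite {n. h n \<noteq> \<zero>\<^bsub>A\<^esub>}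
          \<and> a = (\<Oplus>\<^bsub>A\<^esub>n\<in>{n. h n \<noteq> \<zero>\<^bsub>A\<^esub>}. h n)"
    and grade_one: "\<one>\<^bsub>A\<^esub> \<in> grade A 0"
    and grade_mult: "\<lbrakk>x \<in> grade A m; y \<in> grade A n\<rbrakk> \<Longrightarrow> x \<otimes>\<^bsub>A\<^esub> y \<in> grade A (m + n)"

definition connected_graded_algebra ::
    "('r, 'c) ring_scheme \<Rightarrow> ('r, 'a, 'd) graded_algebra_scheme \<Rightarrow> bool" where
  "connected_graded_algebra R A \<longleftrightarrow>
     graded_algebra R A \<and> bij_betw (\<lambda>r. r \<odot>\<^bsub>A\<^esub> \<one>\<^bsub>A\<^esub>) (carrier R) (grade A 0)"

text \<open>The ring structure is that of the library quotient \<^const>\<open>FactRing\<close>; the definition of the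
  scalar multiplication of cosets follows the pattern of \<^const>\<open>rcoset_mult\<close>. The result is a graded
  algebra only if \<open>I\<close> is a homogeneous two-sided ideal.\<close>

definition quotient_algebra ::
    "('r, 'a, 'd) graded_algebra_scheme \<Rightarrow> 'a set \<Rightarrow> ('r, 'a set) graded_algebra" where
  "quotient_algebra A I =
     \<lparr>carrier = carrier (A Quot I), monoid.mult = monoid.mult (A Quot I),
      one = one (A Quot I), zero = zero (A Quot I), add = add (A Quot I),
      smult = (\<lambda>r X. \<Union>x\<in>X. I +>\<^bsub>A\<^esub> (r \<odot>\<^bsub>A\<^esub> x)),
      grade = (\<lambda>n. (\<lambda>x. I +>\<^bsub>A\<^esub> x) ` grade A n)\<rparr>"

text \<open>The free associative algebra on a set \<open>V\<close>: finitely supported families of coefficients indexed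
  by the words over \<open>V\<close>.\<close>

definition free_algebra ::
    "('r, 'c) ring_scheme \<Rightarrow> 'v set \<Rightarrow> ('r, 'v list \<Rightarrow> 'r) graded_algebra" where
  "free_algebra R V =
    (let C = {f. (\<forall>w. f w \<in> carrier R) \<and> (\<forall>w. w \<notin> lists V \<longrightarrow> f w = \<zero>\<^bsub>R\<^esub>)
               \<and> finite {w. f w \<noteq> \<zero>\<^bsub>R\<^esub>}}
     in \<lparr>carrier = C,
         monoid.mult = (\<lambda>f g w. \<Oplus>\<^bsub>R\<^esub>k\<in>{..length w}. f (take k w) \<otimes>\<^bsub>R\<^esub> g (drop k w)),
         one = (\<lambda>w. if w = [] then \<one>\<^bsub>R\<^esub> else \<zero>\<^bsub>R\<^esub>),
         zero = (\<lambda>w. \<zero>\<^bsub>R\<^esub>),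
         add = (\<lambda>f g w. f w \<oplus>\<^bsub>R\<^esub> g w),
         smult = (\<lambda>r f w. r \<otimes>\<^bsub>R\<^esub> f w),
         grade = (\<lambda>n. {f \<in> C. \<forall>w. length w \<noteq> n \<longrightarrow> f w = \<zero>\<^bsub>R\<^esub>})\<rparr>)"

definition free_gen :: "('r, 'c) ring_scheme \<Rightarrow> 'v \<Rightarrow> 'v list \<Rightarrow> 'r" where
  "free_gen R v = (\<lambda>w. if w = [v] then \<one>\<^bsub>R\<^esub> else \<zero>\<^bsub>R\<^esub>)"

text \<open>The tensor algebra \<open>T(M)\<close> is the free algebra on the underlying set of \<open>M\<close> modulo the relations
  that make \<open>v \<mapsto> free_gen R v\<close> linear; its component of degree 2 is \<open>M \<otimes> M\<close>.\<close>

definition linearity_relations ::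
    "('r, 'c) ring_scheme \<Rightarrow> ('r, 'v, 'd) module_scheme \<Rightarrow> ('v list \<Rightarrow> 'r) set" where
  "linearity_relations R M =
    (let F = free_algebra R (carrier M) in
      {free_gen R (u \<oplus>\<^bsub>M\<^esub> v) \<ominus>\<^bsub>F\<^esub> (free_gen R u \<oplus>\<^bsub>F\<^esub> free_gen R v) | u v.
         u \<in> carrier M \<and> v \<in> carrier M} \<union>
      {free_gen R (r \<odot>\<^bsub>M\<^esub> v) \<ominus>\<^bsub>F\<^esub> (r \<odot>\<^bsub>F\<^esub> free_gen R v) | r v.
         r \<in> carrier R \<and> v \<in> carrier M})"

definition tensor_algebra ::
    "('r, 'c) ring_scheme \<Rightarrow> ('r, 'v, 'd) module_scheme \<Rightarrow> ('r, ('v list \<Rightarrow> 'r) set) graded_algebra" where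
  "tensor_algebra R M =
     quotient_algebra (free_algebra R (carrier M))
       (Idl\<^bsub>free_algebra R (carrier M)\<^esub> (linearity_relations R M))"

definition graded_algebra_iso ::
    "('r, 'c) ring_scheme \<Rightarrow> ('r, 'a, 'd) graded_algebra_scheme
      \<Rightarrow> ('r, 'b, 'e) graded_algebra_scheme \<Rightarrow> ('a \<Rightarrow> 'b) set" where
  "graded_algebra_iso R A B =
     {\<phi> \<in> ring_iso A B.
        (\<forall>r\<in>carrier R. \<forall>x\<in>carrier A. \<phi> (r \<odot>\<^bsub>A\<^esub> x) = r \<odot>\<^bsub>B\<^esub> \<phi> x) \<and>
        (\<forall>n. \<phi> ` grade A n = grade B n)}"

definition quadratic_algebra ::
    "('r, 'c) ring_scheme \<Rightarrow> ('r, 'a, 'd) graded_algebra_scheme \<Rightarrow> bool" where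
  "quadratic_algebra R A \<longleftrightarrow>
     connected_graded_algebra R A \<and>
     (let T = tensor_algebra R (A\<lparr>carrier := grade A 1\<rparr>)
      in \<exists>S \<subseteq> grade T 2. graded_algebra_iso R (quotient_algebra T (Idl\<^bsub>T\<^esub> S)) A \<noteq> {})"


section \<open>Continuous cohomology with trivial coefficients\<close>

text \<open>A topological group is a pair of a group \<open>G\<close> and a topology \<open>T\<close> on \<open>carrier G\<close>. Cochains are
  inhomogeneous; elements of \<open>G\<^sup>n\<close> are functions on \<open>{..<n}\<close>, the coefficient ring \<open>R\<close>
  is discrete, and cochains are \<^const>\<open>undefined\<close> outside \<open>G\<^sup>n\<close>.\<close>

abbreviation tuples :: "('a, 'b) monoid_scheme \<Rightarrow> nat \<Rightarrow> (nat \<Rightarrow> 'a) set" where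
  "tuples G n \<equiv> {..<n} \<rightarrow>\<^sub>E carrier G"

definition cochains ::
    "('r, 'c) ring_scheme \<Rightarrow> ('a, 'b) monoid_scheme \<Rightarrow> 'a topology \<Rightarrow> nat \<Rightarrow> ((nat \<Rightarrow> 'a) \<Rightarrow> 'r) set" where
  "cochains R G T n =
     {f \<in> extensional (tuples G n).
        continuous_map (product_topology (\<lambda>_. T) {..<n}) (discrete_topology (carrier R)) f}"

text \<open>\<open>(\<partial>f)(x\<^sub>0,\<dots>,x\<^sub>n) = f(x\<^sub>1,\<dots>,x\<^sub>n) + (\<Sum>k<n. (-1)\<^sup>k\<^sup>+\<^sup>1 f(\<dots>,x\<^sub>k x\<^sub>k\<^sub>+\<^sub>1,\<dots>)) + (-1)\<^sup>n\<^sup>+\<^sup>1 f(x\<^sub>0,\<dots>,x\<^sub>n\<^sub>-\<^sub>1)\<close>.\<close>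

definition coboundary ::
    "('r, 'c) ring_scheme \<Rightarrow> ('a, 'b) monoid_scheme \<Rightarrow> nat \<Rightarrow> ((nat \<Rightarrow> 'a) \<Rightarrow> 'r) \<Rightarrow> (nat \<Rightarrow> 'a) \<Rightarrow> 'r" where
  "coboundary R G n f =
     (\<lambda>x\<in>tuples G (Suc n).
        f (\<lambda>i\<in>{..<n}. x (Suc i))
        \<oplus>\<^bsub>R\<^esub> (\<Oplus>\<^bsub>R\<^esub>k\<in>{..<n}. ((\<ominus>\<^bsub>R\<^esub> \<one>\<^bsub>R\<^esub>) [^]\<^bsub>R\<^esub> Suc k) \<otimes>\<^bsub>R\<^esub>
              f (\<lambda>i\<in>{..<n}. if i < k then x i
                            else if i = k then x k \<otimes>\<^bsub>G\<^esub> x (Suc k)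
                            else x (Suc i)))
        \<oplus>\<^bsub>R\<^esub> ((\<ominus>\<^bsub>R\<^esub> \<one>\<^bsub>R\<^esub>) [^]\<^bsub>R\<^esub> Suc n) \<otimes>\<^bsub>R\<^esub> f (restrict x {..<n}))"

definition cup ::
    "('r, 'c) ring_scheme \<Rightarrow> ('a, 'b) monoid_scheme \<Rightarrow> nat \<Rightarrow> nat
      \<Rightarrow> ((nat \<Rightarrow> 'a) \<Rightarrow> 'r) \<Rightarrow> ((nat \<Rightarrow> 'a) \<Rightarrow> 'r) \<Rightarrow> (nat \<Rightarrow> 'a) \<Rightarrow> 'r" where
  "cup R G m n f g =
     (\<lambda>x\<in>tuples G (m + n). f (restrict x {..<m}) \<otimes>\<^bsub>R\<^esub> g (\<lambda>i\<in>{..<n}. x (m + i)))"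

definition zero_cochain ::
    "('r, 'c) ring_scheme \<Rightarrow> ('a, 'b) monoid_scheme \<Rightarrow> nat \<Rightarrow> (nat \<Rightarrow> 'a) \<Rightarrow> 'r" where
  "zero_cochain R G n = (\<lambda>x\<in>tuples G n. \<zero>\<^bsub>R\<^esub>)"

text \<open>The graded algebra \<open>\<Oplus>\<^sub>n C\<^sup>n(G,R)\<close> of continuous cochains under the cup product; an element
  is the sequence of its homogeneous components.\<close>

definition cochain_algebra ::
    "('r, 'c) ring_scheme \<Rightarrow> ('a, 'b) monoid_scheme \<Rightarrow> 'a topology
      \<Rightarrow> ('r, nat \<Rightarrow> (nat \<Rightarrow> 'a) \<Rightarrow> 'r) graded_algebra" where
  "cochain_algebra R G T =
    (let C = {c. (\<forall>n. c n \<in> cochains R G T n) \<and> finite {n. c n \<noteq> zero_cochain R G n}}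
     in \<lparr>carrier = C,
         monoid.mult = (\<lambda>c d n. \<lambda>x\<in>tuples G n. \<Oplus>\<^bsub>R\<^esub>k\<in>{..n}. cup R G k (n - k) (c k) (d (n - k)) x),
         one = (\<lambda>n. \<lambda>x\<in>tuples G n. if n = 0 then \<one>\<^bsub>R\<^esub> else \<zero>\<^bsub>R\<^esub>),
         zero = zero_cochain R G,
         add = (\<lambda>c d n. \<lambda>x\<in>tuples G n. c n x \<oplus>\<^bsub>R\<^esub> d n x),
         smult = (\<lambda>r c n. \<lambda>x\<in>tuples G n. r \<otimes>\<^bsub>R\<^esub> c n x),
         grade = (\<lambda>n. {c \<in> C. \<forall>m. m \<noteq> n \<longrightarrow> c m = zero_cochain R G m})\<rparr>)"

definition differential ::
    "('r, 'c) ring_scheme \<Rightarrow> ('a, 'b) monoid_scheme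
      \<Rightarrow> (nat \<Rightarrow> (nat \<Rightarrow> 'a) \<Rightarrow> 'r) \<Rightarrow> nat \<Rightarrow> (nat \<Rightarrow> 'a) \<Rightarrow> 'r" where
  "differential R G c n =
     (case n of 0 \<Rightarrow> zero_cochain R G 0 | Suc m \<Rightarrow> coboundary R G m (c m))"

definition cocycle_algebra ::
    "('r, 'c) ring_scheme \<Rightarrow> ('a, 'b) monoid_scheme \<Rightarrow> 'a topology
      \<Rightarrow> ('r, nat \<Rightarrow> (nat \<Rightarrow> 'a) \<Rightarrow> 'r) graded_algebra" where
  "cocycle_algebra R G T =
    (let C = cochain_algebra R G T;
         Z = {c \<in> carrier C. differential R G c = \<zero>\<^bsub>C\<^esub>}
     in C\<lparr>carrier := Z, grade := (\<lambda>n. grade C n \<inter> Z)\<rparr>)"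

definition coboundaries ::
    "('r, 'c) ring_scheme \<Rightarrow> ('a, 'b) monoid_scheme \<Rightarrow> 'a topology
      \<Rightarrow> (nat \<Rightarrow> (nat \<Rightarrow> 'a) \<Rightarrow> 'r) set" where
  "coboundaries R G T = differential R G ` carrier (cochain_algebra R G T)"

definition cohomology_algebra ::
    "('r, 'c) ring_scheme \<Rightarrow> ('a, 'b) monoid_scheme \<Rightarrow> 'a topology
      \<Rightarrow> ('r, (nat \<Rightarrow> (nat \<Rightarrow> 'a) \<Rightarrow> 'r) set) graded_algebra" where
  "cohomology_algebra R G T = quotient_algebra (cocycle_algebra R G T) (coboundaries R G T)"

text \<open>For a continuous homomorphism \<open>\<pi>\<close> from \<open>H\<close> to \<open>G\<close>, the induced map from the cohomology of \<open>G\<close> to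
  that of \<open>(H, T)\<close> sends the class of a cocycle \<open>c\<close> to the class of \<open>c \<circ> \<pi>\<close>; the union runs over all
  representatives of a class, which yield the same coset.\<close>

definition pullback_cochain ::
    "('h, 'b) monoid_scheme \<Rightarrow> ('h \<Rightarrow> 'g) \<Rightarrow> (nat \<Rightarrow> (nat \<Rightarrow> 'g) \<Rightarrow> 'r)
      \<Rightarrow> nat \<Rightarrow> (nat \<Rightarrow> 'h) \<Rightarrow> 'r" where
  "pullback_cochain H \<pi> c = (\<lambda>n. \<lambda>x\<in>tuples H n. c n (\<lambda>i\<in>{..<n}. \<pi> (x i)))"

definition inflation ::
    "('r, 'c) ring_scheme \<Rightarrow> ('h, 'b) monoid_scheme \<Rightarrow> 'h topology \<Rightarrow> ('h \<Rightarrow> 'g)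
      \<Rightarrow> (nat \<Rightarrow> (nat \<Rightarrow> 'g) \<Rightarrow> 'r) set \<Rightarrow> (nat \<Rightarrow> (nat \<Rightarrow> 'h) \<Rightarrow> 'r) set" where
  "inflation R H T \<pi> X =
     (\<Union>c\<in>X. coboundaries R H T +>\<^bsub>cocycle_algebra R H T\<^esub> pullback_cochain H \<pi> c)"


section \<open>Pro-\<open>p\<close> groups\<close>

locale topological_group = group G
  for G :: "('a, 'b) monoid_scheme" (structure) and T :: "'a topology" +
  assumes topspace_eq: "topspace T = carrier G"
    and continuous_mult: "continuous_map (prod_topology T T) T (\<lambda>(x, y). x \<otimes> y)"
    and continuous_inv: "continuous_map T T (\<lambda>x. inv x)"

text \<open>Profinite groups are compact Hausdorff groups whose open subgroups form a neighbourhood base of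
  the identity.\<close>

locale profinite_group = topological_group +
  assumes compact: "compact_space T"
    and Hausdorff: "Hausdorff_space T"
    and open_subgroup_base:
      "\<lbrakk>openin T U; \<one> \<in> U\<rbrakk> \<Longrightarrow> \<exists>H. subgroup H G \<and> openin T H \<and> H \<subseteq> U"

locale pro_p_group = profinite_group G T for p :: nat and G (structure) and T +
  assumes prime_p: "prime p"
    and open_normal_index:
      "\<lbrakk>N \<lhd> G; openin T N\<rbrakk> \<Longrightarrow> \<exists>k. card (rcosets N) = p ^ k"

definition Fp :: "nat \<Rightarrow> int ring" where
  "Fp p = residue_ring (int p)"

locale Bloch_Kato_group = pro_p_group p G T for p G T +
  assumes closed_subgroup_quadratic:
    "\<lbrakk>subgroup K G; closedin T K\<rbrakk> \<Longrightarrow>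
       quadratic_algebra (Fp p) (cohomology_algebra (Fp p) (G\<lparr>carrier := K\<rparr>) (subtopology T K))"


section \<open>Projective systems\<close>

text \<open>\<open>(i, j) \<in> r\<close> stands for \<open>i \<le> j\<close>; antisymmetry is not required.\<close>

definition directed_on :: "'i set \<Rightarrow> 'i rel \<Rightarrow> bool" where
  "directed_on I r \<longleftrightarrow> preorder_on I r \<and> I \<noteq> {} \<and>
     (\<forall>i\<in>I. \<forall>j\<in>I. \<exists>k\<in>I. (i, k) \<in> r \<and> (j, k) \<in> r)"

locale projective_system =
  fixes I :: "'i set" and r :: "'i rel"
    and G :: "'i \<Rightarrow> ('a, 'b) monoid_scheme" and T :: "'i \<Rightarrow> 'a topology"
    and \<pi> :: "'i \<Rightarrow> 'i \<Rightarrow> 'a \<Rightarrow> 'a"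
  assumes directed: "directed_on I r"
    and topological_groups: "i \<in> I \<Longrightarrow> topological_group (G i) (T i)"
    and transition_hom: "(i, j) \<in> r \<Longrightarrow> \<pi> i j \<in> hom (G j) (G i)"
    and transition_continuous: "(i, j) \<in> r \<Longrightarrow> continuous_map (T j) (T i) (\<pi> i j)"
    and transition_id: "\<lbrakk>i \<in> I; x \<in> carrier (G i)\<rbrakk> \<Longrightarrow> \<pi> i i x = x"
    and transition_comp:
      "\<lbrakk>(i, j) \<in> r; (j, k) \<in> r; x \<in> carrier (G k)\<rbrakk> \<Longrightarrow> \<pi> i j (\<pi> j k x) = \<pi> i k x"

definition projective_limit ::
    "'i set \<Rightarrow> 'i rel \<Rightarrow> ('i \<Rightarrow> ('a, 'b) monoid_scheme) \<Rightarrow> ('i \<Rightarrow> 'i \<Rightarrow> 'a \<Rightarrow> 'a)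
      \<Rightarrow> ('i \<Rightarrow> 'a) monoid" where
  "projective_limit I r G \<pi> =
     (product_group I G)
       \<lparr>carrier := {x \<in> carrier (product_group I G). \<forall>(i, j)\<in>r. \<pi> i j (x j) = x i}\<rparr>"

definition projective_limit_topology ::
    "'i set \<Rightarrow> 'i rel \<Rightarrow> ('i \<Rightarrow> ('a, 'b) monoid_scheme) \<Rightarrow> ('i \<Rightarrow> 'a topology)
      \<Rightarrow> ('i \<Rightarrow> 'i \<Rightarrow> 'a \<Rightarrow> 'a) \<Rightarrow> ('i \<Rightarrow> 'a) topology" where
  "projective_limit_topology I r G T \<pi> =
     subtopology (product_topology T I) (carrier (projective_limit I r G \<pi>))"

end

theory Submission
  imports Defs "HOL-Analysis.Abstract_Topological_Spaces"
begin

text \<open>Let \<open>L\<close> be the limit of the groups \<open>G\<^sub>i\<close>. Every continuous map from \<open>L\<^sup>n\<close> to a discrete set factors through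
  some \<open>G\<^sub>i\<^sup>n\<close> because \<open>L\<close> is compact, and \<open>L \<rightarrow> G\<^sub>i\<close> is surjective. So the cochains of \<open>L\<close> are the directed
  union of those of the \<open>G\<^sub>i\<close>, and, the inflation maps being injective, the cohomology ring of \<open>L\<close> is the
  directed union of those of the \<open>G\<^sub>i\<close>. A connected graded algebra \<open>A\<close> is quadratic iff it is the image of the
  free algebra on \<open>A\<^sub>1\<close> under a graded homomorphism whose kernel is generated, as an ideal, by the linearity
  relations and by elements of degree 2. This passes to directed unions: a relation in the union involves
  finitely many elements of degree 1, so it comes from a relation in a member of the union, where it is a
  consequence of linear and quadratic relations.\<close>

text \<open>Two obstacles shape the argument. The isomorphism in the definition of a quadratic
  algebra need not be the identity in degree 1, so presentations of different members of the union
  are unrelated. They are not adjusted. The free algebra on \<open>A\<^sub>1\<close> gets its own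
  evaluation \<epsilon>, the identity on generators, and each presentation \<open>\<psi> i\<close>
  is tied to it by a map \<open>\<sigma> i\<close> of free algebras with \<epsilon> after
  \<open>\<sigma> i\<close> equal to \<open>lam i\<close> after \<open>\<psi> i\<close>. As
  \<open>lam i\<close> is injective, a relation in the range of \<open>\<sigma> i\<close> comes from
  a relation of the member. The second obstacle: products of cohomology classes are unions over all
  representatives, so for the limit a product is not known in advance to be a single class. This too
  is inherited from the members. Two representatives of a class differ by the coboundary of one
  cochain, which lives on some \<open>G\<^sub>j\<close>; far enough up, any two representatives come
  from one member, whose cohomology is a ring by hypothesis.\<close>

section \<open>Quotients of algebras\<close>

text \<open>Scalars act as multiplication by \<open>r \<odot> \<one>\<close>: this is all that is needed for ideals to be submodules,
  hence for the scalar multiplication of cosets to be well defined.\<close>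

locale scalar_ring = ring A
  for R :: "('r, 'c) ring_scheme" and A :: "('r, 'a, 'd) graded_algebra_scheme" (structure) +
  assumes smult_closed: "\<lbrakk>r \<in> carrier R; x \<in> carrier A\<rbrakk> \<Longrightarrow> r \<odot>\<^bsub>A\<^esub> x \<in> carrier A"
    and smult_eq: "\<lbrakk>r \<in> carrier R; x \<in> carrier A\<rbrakk> \<Longrightarrow> r \<odot>\<^bsub>A\<^esub> x = (r \<odot>\<^bsub>A\<^esub> \<one>\<^bsub>A\<^esub>) \<otimes>\<^bsub>A\<^esub> x"

locale assoc_algebra = module R A + ring A
  for R :: "('r, 'c) ring_scheme" (structure)
    and A :: "('r, 'a, 'd) graded_algebra_scheme" (structure) +
  assumes smult_mult_left:
      "\<lbrakk>r \<in> carrier R; x \<in> carrier A; y \<in> carrier A\<rbrakk> \<Longrightarrow>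
        (r \<odot>\<^bsub>A\<^esub> x) \<otimes>\<^bsub>A\<^esub> y = r \<odot>\<^bsub>A\<^esub> (x \<otimes>\<^bsub>A\<^esub> y)"
    and smult_mult_right:
      "\<lbrakk>r \<in> carrier R; x \<in> carrier A; y \<in> carrier A\<rbrakk> \<Longrightarrow>
        x \<otimes>\<^bsub>A\<^esub> (r \<odot>\<^bsub>A\<^esub> y) = r \<odot>\<^bsub>A\<^esub> (x \<otimes>\<^bsub>A\<^esub> y)"

lemma (in graded_algebra) assoc_algebra: "assoc_algebra R A"
proof -
  have "module R A" "ring A" ..
  then show ?thesis
    by (rule assoc_algebra.intro) (rule assoc_algebra_axioms.intro[OF smult_mult_left smult_mult_right])
qed

lemma (in assoc_algebra) scalar_ring: "scalar_ring R A"
proof -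
  have "ring A" ..
  then interpret ring A .
  show ?thesis
  proof (unfold_locales, goal_cases)
    case (1 r x) then show ?case by (rule smult_closed)
  next
    case (2 r x)
    then show ?case using smult_mult_left[of r "\<one>\<^bsub>A\<^esub>" x] by (simp only: one_closed l_one)
  qed
qed

text \<open>The preimage of an ideal is an ideal, so it suffices to test generators. This carries
  ideal membership along homomorphisms in the kernel computations below.\<close>

lemma genideal_mono_vimage:
  assumes "ring_hom_ring F F' h" "ideal N F'" "X \<subseteq> carrier F" "h ` X \<subseteq> N"
    and "x \<in> genideal F X"
  shows "h x \<in> N"
proof -
  interpret h: ring_hom_ring F F' h by fact
  have "genideal F X \<subseteq> {r \<in> carrier F. h r \<in> N}"
    by (rule h.R.genideal_minimal[OF h.ideal_vimage[OF assms(2)]]) (use assms(3,4) in blast)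
  then show ?thesis using assms(5) by blast
qed

text \<open>Surjectivity is what makes the image absorb arbitrary factors: each of them lifts to
  \<open>F\<close>.\<close>

lemma surj_image_ideal:
  assumes "ring_hom_ring F F' h" "h ` carrier F = carrier F'" "ideal N F"
  shows "ideal (h ` N) F'"
proof -
  interpret h: ring_hom_ring F F' h by fact
  interpret N: ideal N F by fact
  show ?thesis
  proof (rule idealI[OF h.S.ring_axioms])
    show "subgroup (h ` N) (add_monoid F')"
      by (rule group_hom.subgroup_img_is_subgroup[OF h.a_group_hom N.a_subgroup])
  next
    fix a x assume a: "a \<in> h ` N" and x: "x \<in> carrier F'"
    obtain b where b: "b \<in> N" "a = h b" using a by blast
    obtain y where y: "y \<in> carrier F" "x = h y" using x assms(2) by blast
    have bF: "b \<in> carrier F" using b(1) by (rule N.Icarr)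
    have "h (y \<otimes>\<^bsub>F\<^esub> b) = x \<otimes>\<^bsub>F'\<^esub> a" using y(1) bF unfolding y(2) b(2) by (rule h.hom_mult)
    then show "x \<otimes>\<^bsub>F'\<^esub> a \<in> h ` N" using N.I_l_closed[OF b(1) y(1)] by (metis imageI)
    have "h (b \<otimes>\<^bsub>F\<^esub> y) = a \<otimes>\<^bsub>F'\<^esub> x" using bF y(1) unfolding y(2) b(2) by (rule h.hom_mult)
    then show "a \<otimes>\<^bsub>F'\<^esub> x \<in> h ` N" using N.I_r_closed[OF b(1) y(1)] by (metis imageI)
  qed
qed

lemma quotient_algebra_simps:
  "carrier (quotient_algebra A I) = (\<lambda>x. I +>\<^bsub>A\<^esub> x) ` carrier A"
  "monoid.mult (quotient_algebra A I) = rcoset_mult A I"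
  "one (quotient_algebra A I) = I +>\<^bsub>A\<^esub> \<one>\<^bsub>A\<^esub>"
  "zero (quotient_algebra A I) = I"
  "add (quotient_algebra A I) = set_add A"
  "smult (quotient_algebra A I) = (\<lambda>r X. \<Union>x\<in>X. I +>\<^bsub>A\<^esub> (r \<odot>\<^bsub>A\<^esub> x))"
  "grade (quotient_algebra A I) = (\<lambda>n. (\<lambda>x. I +>\<^bsub>A\<^esub> x) ` grade A n)"
  by (auto simp: quotient_algebra_def FactRing_def A_RCOSETS_def')

section \<open>Quotients by two-sided ideals\<close>

context scalar_ring
begin

lemma ideal_smult_closed:
  assumes "ideal I A" "r \<in> carrier R" "x \<in> I"
  shows "r \<odot> x \<in> I"
proof -
  interpret I: ideal I A by fact
  show ?thesis using assms(2,3) by (simp add: smult_eq[of r x] I.Icarr I.I_l_closed smult_closed)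
qed

lemma smult_add:
  assumes "r \<in> carrier R" "x \<in> carrier A" "y \<in> carrier A"
  shows "r \<odot> (x \<oplus> y) = r \<odot> x \<oplus> r \<odot> y"
  using assms by (simp add: smult_eq[of r x] smult_eq[of r y] smult_eq[of r "x \<oplus> y"] smult_closed r_distr)

lemma quotient_hom:
  assumes "ideal I A"
  shows "ring_hom_ring A (quotient_algebra A I) (\<lambda>x. I +> x)"
proof -
  interpret I: ideal I A by fact
  have h: "(\<lambda>x. I +> x) \<in> ring_hom A (quotient_algebra A I)"
    using I.rcos_ring_hom
    unfolding ring_hom_def quotient_algebra_simps FactRing_def by (simp add: A_RCOSETS_def')
  have "ring ((quotient_algebra A I)\<lparr>carrier := (\<lambda>x. I +> x) ` carrier A, zero := I +> \<zero>\<rparr>)"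
    by (rule ring_hom_imp_img_ring[OF h])
  \<comment> \<open>The image ring has \<open>I +> \<zero>\<close> as its zero, the quotient has
    \<open>I\<close>.\<close>
  moreover have "I +> \<zero> = I" using a_coset_add_zero[OF I.a_subset] .
  ultimately have "ring (quotient_algebra A I)"
    by (simp add: quotient_algebra_def FactRing_def A_RCOSETS_def' UNION_singleton_eq_range)
  then show ?thesis
    by (rule ring_hom_ringI2[OF ring_axioms _ h])
qed

text \<open>Representatives \<open>i \<oplus> x\<close> and \<open>x\<close> of a coset have
  multiples that differ by \<open>r \<odot> i\<close>, which lies in \<open>I\<close>; so the union
  defining the scalar multiplication has equal terms.\<close>

lemma quotient_smult:
  assumes "ideal I A" "r \<in> carrier R" "x \<in> carrier A"
  shows "r \<odot>\<^bsub>quotient_algebra A I\<^esub> (I +> x) = I +> (r \<odot> x)"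
proof -
  interpret I: ideal I A by fact
  have *: "I +> (r \<odot> y) = I +> (r \<odot> x)" if y: "y \<in> I +> x" for y
  proof -
    obtain i where i: "i \<in> I" "y = i \<oplus> x" using y unfolding a_r_coset_def' by blast
    have "r \<odot> y = r \<odot> i \<oplus> r \<odot> x" unfolding i(2)
      by (rule smult_add[OF assms(2) I.Icarr[OF i(1)] assms(3)])
    moreover have "r \<odot> i \<in> I" by (rule ideal_smult_closed[OF assms(1,2) i(1)])
    ultimately show ?thesis
      using I.Icarr smult_closed[OF assms(2,3)]
      by (metis I.a_repr_independence' I.a_rcos_const a_coset_add_assoc I.a_subset)
  qed
  have "x \<in> I +> x" using I.a_rcos_self[OF assms(3)] .
  then show ?thesis unfolding quotient_algebra_simps using * by blast
qed

text \<open>Makes the structure stable under quotients, so that everything proved here applies again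
  to the second quotient in the definition of a quadratic algebra.\<close>

lemma quotient_scalar_ring:
  assumes "ideal I A"
  shows "scalar_ring R (quotient_algebra A I)"
proof -
  interpret q: ring_hom_ring A "quotient_algebra A I" "\<lambda>x. I +> x" by (rule quotient_hom[OF assms])
  show ?thesis
  proof (unfold_locales, goal_cases)
    case (1 r X)
    then obtain x where x: "x \<in> carrier A" "X = I +> x" unfolding quotient_algebra_simps by blast
    then show ?case using q.hom_closed[OF smult_closed[OF 1(1) x(1)]] 1(1)
      by (simp add: quotient_smult[OF assms])
  next
    case (2 r X)
    then obtain x where x: "x \<in> carrier A" "X = I +> x" unfolding quotient_algebra_simps by blast
    have "r \<odot>\<^bsub>quotient_algebra A I\<^esub> X = I +> ((r \<odot> \<one>) \<otimes> x)"
      unfolding x(2) quotient_smult[OF assms 2(1) x(1)] smult_eq[OF 2(1) x(1)] ..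
    also have "\<dots> = (I +> (r \<odot> \<one>)) \<otimes>\<^bsub>quotient_algebra A I\<^esub> (I +> x)"
      by (rule q.hom_mult[OF smult_closed[OF 2(1) one_closed] x(1)])
    also have "I +> (r \<odot> \<one>) = r \<odot>\<^bsub>quotient_algebra A I\<^esub> \<one>\<^bsub>quotient_algebra A I\<^esub>"
      unfolding quotient_algebra_simps(3) quotient_smult[OF assms 2(1) one_closed] ..
    finally show ?case unfolding x(2) .
  qed
qed

lemma coset_zero_iff:
  assumes "ideal I A" "x \<in> carrier A"
  shows "I +> x = \<zero>\<^bsub>quotient_algebra A I\<^esub> \<longleftrightarrow> x \<in> I"
  using quotient_eq_iff_same_a_r_cos[OF assms zero_closed] assms(2)
  unfolding quotient_algebra_simps
  by (metis a_rcos_zero assms(1) ideal.rcos_const_imp_mem)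

end

text \<open>The shape of the quotient in \<open>quadratic_algebra\<close>: for \<open>X\<close> the
  linearity relations, \<open>T\<close> is the tensor algebra, and \<open>Y\<close> consists of
  representatives in the free algebra of the quadratic relations.\<close>

locale iterated_quotient = scalar_ring R F
  for R :: "('r, 'c) ring_scheme" and F :: "('r, 'a, 'd) graded_algebra_scheme" (structure) +
  fixes X Y :: "'a set"
  assumes X_subset: "X \<subseteq> carrier F" and Y_subset: "Y \<subseteq> carrier F"
begin

definition T where "T = quotient_algebra F (Idl X)"
definition Q where "Q = quotient_algebra T (Idl\<^bsub>T\<^esub> ((\<lambda>x. Idl X +> x) ` Y))"
definition proj where "proj a = Idl\<^bsub>T\<^esub> ((\<lambda>x. Idl X +> x) ` Y) +>\<^bsub>T\<^esub> (Idl X +> a)"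

lemma ideal_X: "ideal (Idl X) F" by (rule genideal_ideal[OF X_subset])

lemma T_hom: "ring_hom_ring F T (\<lambda>x. Idl X +> x)"
  unfolding T_def by (rule quotient_hom[OF ideal_X])

sublocale T: scalar_ring R T
  unfolding T_def by (rule quotient_scalar_ring[OF ideal_X])

lemma ideal_Y: "ideal (Idl\<^bsub>T\<^esub> ((\<lambda>x. Idl X +> x) ` Y)) T"
proof (rule T.genideal_ideal)
  show "(\<lambda>x. Idl X +> x) ` Y \<subseteq> carrier T"
    using Y_subset unfolding T_def quotient_algebra_simps by blast
qed

lemma proj_hom: "ring_hom_ring F Q proj"
proof -
  interpret t: ring_hom_ring F T "\<lambda>x. Idl X +> x" by (rule T_hom)
  interpret q: ring_hom_ring T Q "\<lambda>x. Idl\<^bsub>T\<^esub> ((\<lambda>x. Idl X +> x) ` Y) +>\<^bsub>T\<^esub> x"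
    unfolding Q_def by (rule T.quotient_hom[OF ideal_Y])
  have "proj \<in> ring_hom F Q"
    using ring_hom_trans[OF t.homh q.homh] unfolding comp_def proj_def .
  then show ?thesis by (rule ring_hom_ringI2[OF ring_axioms q.S.ring_axioms])
qed

lemma proj_surj: "proj ` carrier F = carrier Q"
  unfolding Q_def quotient_algebra_simps T_def image_image proj_def ..

lemma proj_grade: "proj ` grade F n = grade Q n"
  unfolding Q_def quotient_algebra_simps T_def image_image proj_def ..

lemma proj_smult:
  assumes "r \<in> carrier R" "x \<in> carrier F"
  shows "proj (r \<odot> x) = r \<odot>\<^bsub>Q\<^esub> proj x"
proof -
  have c: "Idl X +> x \<in> carrier T" using assms(2) unfolding T_def quotient_algebra_simps by blast
  have "Idl X +> (r \<odot> x) = r \<odot>\<^bsub>T\<^esub> (Idl X +> x)"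
    unfolding T_def quotient_smult[OF ideal_X assms] ..
  then show ?thesis unfolding proj_def Q_def T.quotient_smult[OF ideal_Y assms(1) c] by (rule arg_cong)
qed

text \<open>Ideals of \<open>T\<close> correspond to ideals of \<open>F\<close> that contain
  \<open>Idl X\<close>, and the correspondence matches generating sets: the ideal generated by the
  image of \<open>Y\<close> pulls back to the one generated by \<open>X\<close> and
  \<open>Y\<close>.\<close>

lemma kernel_proj:
  assumes a: "a \<in> carrier F"
  shows "proj a = \<zero>\<^bsub>Q\<^esub> \<longleftrightarrow> a \<in> Idl (X \<union> Y)"
proof -
  interpret t: ring_hom_ring F T "\<lambda>x. Idl X +> x" by (rule T_hom)
  let ?N = "Idl (X \<union> Y)"
  have XY: "X \<union> Y \<subseteq> carrier F" using X_subset Y_subset by blast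
  have N: "ideal ?N F" by (rule genideal_ideal[OF XY])
  interpret N: ideal ?N F by (rule N)
  interpret L: ideal "Idl X" F by (rule ideal_X)
  have XN: "Idl X \<subseteq> ?N" by (rule genideal_minimal[OF N]) (use genideal_self[OF XY] in blast)
  have tN: "ideal ((\<lambda>x. Idl X +> x) ` ?N) T"
  proof (rule surj_image_ideal[OF T_hom _ N])
    show "(\<lambda>x. Idl X +> x) ` carrier F = carrier T" unfolding T_def quotient_algebra_simps ..
  qed
  have YN: "Y \<subseteq> ?N" using genideal_self[OF XY] by blast
  have c: "Idl X +> a \<in> carrier T" by (rule t.hom_closed[OF a])
  have Yc: "(\<lambda>x. Idl X +> x) ` Y \<subseteq> carrier T"
    using Y_subset unfolding T_def quotient_algebra_simps by blast
  have 1: "proj a = \<zero>\<^bsub>Q\<^esub> \<longleftrightarrow> Idl X +> a \<in> Idl\<^bsub>T\<^esub> ((\<lambda>x. Idl X +> x) ` Y)"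
    unfolding proj_def Q_def by (rule T.coset_zero_iff[OF ideal_Y c])
  also have "\<dots> \<longleftrightarrow> a \<in> ?N"
  proof
    assume "Idl X +> a \<in> Idl\<^bsub>T\<^esub> ((\<lambda>x. Idl X +> x) ` Y)"
    moreover have "Idl\<^bsub>T\<^esub> ((\<lambda>x. Idl X +> x) ` Y) \<subseteq> (\<lambda>x. Idl X +> x) ` ?N"
      by (rule T.genideal_minimal[OF tN]) (use YN in blast)
    ultimately obtain b where b: "b \<in> ?N" "Idl X +> a = Idl X +> b" by blast
    have bF: "b \<in> carrier F" by (rule N.Icarr[OF b(1)])
    have "a \<ominus> b \<in> ?N"
      using quotient_eq_iff_same_a_r_cos[OF ideal_X a bF] b(2) XN by blast
    then have "(a \<ominus> b) \<oplus> b \<in> ?N" using b(1) by (rule N.a_closed)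
    moreover have "(a \<ominus> b) \<oplus> b = a" using a bF by algebra
    ultimately show "a \<in> ?N" by simp
  next
    assume aN: "a \<in> ?N"
    show "Idl X +> a \<in> Idl\<^bsub>T\<^esub> ((\<lambda>x. Idl X +> x) ` Y)"
    proof (rule genideal_mono_vimage[OF T_hom ideal_Y XY _ aN], rule image_subsetI)
      fix x assume x: "x \<in> X \<union> Y"
      show "Idl X +> x \<in> Idl\<^bsub>T\<^esub> ((\<lambda>x. Idl X +> x) ` Y)"
      proof (cases "x \<in> Y")
        case True
        then show ?thesis using T.genideal_self[OF Yc] by blast
      next
        case False
        then have "x \<in> Idl X" using x genideal_self[OF X_subset] by blast
        then have "Idl X +> x = \<zero>\<^bsub>T\<^esub>"
          unfolding T_def using coset_zero_iff[OF ideal_X] L.Icarr by blast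
        then show ?thesis using additive_subgroup.zero_closed[OF ideal.axioms(1)[OF ideal_Y]] by simp
      qed
    qed
  qed
  finally show ?thesis .
qed

end

section \<open>Surjections with the same kernel\<close>

lemma ring_hom_eq_iff:
  assumes "ring_hom_ring F A h" "x \<in> carrier F" "y \<in> carrier F"
  shows "h x = h y \<longleftrightarrow> h (x \<ominus>\<^bsub>F\<^esub> y) = \<zero>\<^bsub>A\<^esub>"
proof -
  interpret h: ring_hom_ring F A h by fact
  have "h (x \<ominus>\<^bsub>F\<^esub> y) = h x \<ominus>\<^bsub>A\<^esub> h y"
    unfolding a_minus_def using assms(2,3) by (simp add: h.hom_add h.hom_a_inv)
  then show ?thesis using assms(2,3) by (simp add: h.S.r_right_minus_eq)
qed

text \<open>Equal kernels mean equal fibres. Hence the value of \<open>h\<close> at a chosen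
  preimage under \<open>q\<close> does not depend on the choice, and distinct elements get distinct
  values.\<close>

lemma ring_iso_of_same_kernel:
  assumes q: "ring_hom_ring F Q q" and h: "ring_hom_ring F A h"
    and qs: "q ` carrier F = carrier Q" and hs: "h ` carrier F = carrier A"
    and ker: "\<And>x. x \<in> carrier F \<Longrightarrow> q x = \<zero>\<^bsub>Q\<^esub> \<longleftrightarrow> h x = \<zero>\<^bsub>A\<^esub>"
  obtains \<phi> where "\<phi> \<in> ring_iso Q A" "\<And>x. x \<in> carrier F \<Longrightarrow> \<phi> (q x) = h x"
proof -
  interpret q: ring_hom_ring F Q q by fact
  interpret h: ring_hom_ring F A h by fact
  define \<phi> where "\<phi> y = h (SOME x. x \<in> carrier F \<and> q x = y)" for y
  have eq: "q x = q y \<longleftrightarrow> h x = h y" if "x \<in> carrier F" "y \<in> carrier F" for x y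
    unfolding ring_hom_eq_iff[OF q that] ring_hom_eq_iff[OF h that]
    by (rule ker[OF q.R.minus_closed[OF that]])
  have \<phi>: "\<phi> (q x) = h x" if x: "x \<in> carrier F" for x
  proof -
    have "(SOME z. z \<in> carrier F \<and> q z = q x) \<in> carrier F \<and> q (SOME z. z \<in> carrier F \<and> q z = q x) = q x"
      by (rule someI[where P = "\<lambda>z. z \<in> carrier F \<and> q z = q x", of x]) (simp add: x)
    then show ?thesis unfolding \<phi>_def using eq x by blast
  qed
  have "\<phi> \<in> ring_hom Q A"
  proof (rule ring_hom_memI)
    fix x assume "x \<in> carrier Q"
    then obtain a where "a \<in> carrier F" "x = q a" using qs by blast
    then show "\<phi> x \<in> carrier A" by (simp add: \<phi>)
  next
    fix x y assume "x \<in> carrier Q" "y \<in> carrier Q"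
    then obtain a b where ab: "a \<in> carrier F" "x = q a" "b \<in> carrier F" "y = q b" using qs by blast
    have "\<phi> (q (a \<otimes>\<^bsub>F\<^esub> b)) = h a \<otimes>\<^bsub>A\<^esub> h b" using ab by (subst \<phi>) simp_all
    then show "\<phi> (x \<otimes>\<^bsub>Q\<^esub> y) = \<phi> x \<otimes>\<^bsub>A\<^esub> \<phi> y" using ab by (simp add: \<phi>)
    have "\<phi> (q (a \<oplus>\<^bsub>F\<^esub> b)) = h a \<oplus>\<^bsub>A\<^esub> h b" using ab by (subst \<phi>) simp_all
    then show "\<phi> (x \<oplus>\<^bsub>Q\<^esub> y) = \<phi> x \<oplus>\<^bsub>A\<^esub> \<phi> y" using ab by (simp add: \<phi>)
  next
    have "\<phi> (q \<one>\<^bsub>F\<^esub>) = \<one>\<^bsub>A\<^esub>" by (subst \<phi>) simp_all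
    then show "\<phi> \<one>\<^bsub>Q\<^esub> = \<one>\<^bsub>A\<^esub>" by simp
  qed
  moreover have "bij_betw \<phi> (carrier Q) (carrier A)"
    unfolding bij_betw_def inj_on_def qs[symmetric] hs[symmetric]
    using \<phi> eq by (auto simp: image_image intro!: image_eqI)
  ultimately have "\<phi> \<in> ring_iso Q A" unfolding ring_iso_def by blast
  with \<phi> show ?thesis by (rule that[rotated])
qed

section \<open>Free algebras\<close>

locale free_algebra_on = cring R for R :: "('r, 'c) ring_scheme" (structure) +
  fixes V :: "'v set"
begin

abbreviation F where "F \<equiv> free_algebra R V"

definition mon :: "'r \<Rightarrow> 'v list \<Rightarrow> 'v list \<Rightarrow> 'r" where
  "mon r w = (\<lambda>u. if u = w then r else \<zero>)"

lemma F_simps: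
  "\<zero>\<^bsub>F\<^esub> = (\<lambda>w. \<zero>)"
  "\<one>\<^bsub>F\<^esub> = mon \<one> []"
  "f \<oplus>\<^bsub>F\<^esub> g = (\<lambda>w. f w \<oplus> g w)"
  "r \<odot>\<^bsub>F\<^esub> f = (\<lambda>w. r \<otimes> f w)"
  "f \<otimes>\<^bsub>F\<^esub> g = (\<lambda>w. \<Oplus>k\<in>{..length w}. f (take k w) \<otimes> g (drop k w))"
  by (simp_all add: free_algebra_def mon_def)

lemma carrier_iff:
  "f \<in> carrier F \<longleftrightarrow> (\<forall>w. f w \<in> carrier R) \<and> (\<forall>w. w \<notin> lists V \<longrightarrow> f w = \<zero>) \<and> finite {w. f w \<noteq> \<zero>}"
  by (simp add: free_algebra_def)

lemma grade_iff: "f \<in> grade F n \<longleftrightarrow> f \<in> carrier F \<and> (\<forall>w. length w \<noteq> n \<longrightarrow> f w = \<zero>)"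
  by (simp add: free_algebra_def)

lemma carrierD: "f \<in> carrier F \<Longrightarrow> f w \<in> carrier R"
  unfolding carrier_iff by blast

lemma supp_finite: "f \<in> carrier F \<Longrightarrow> finite {w. f w \<noteq> \<zero>}"
  unfolding carrier_iff by blast

lemma supp_lists: "f \<in> carrier F \<Longrightarrow> {w. f w \<noteq> \<zero>} \<subseteq> lists V"
  unfolding carrier_iff by blast

lemma mon_closed: "\<lbrakk>r \<in> carrier R; w \<in> lists V\<rbrakk> \<Longrightarrow> mon r w \<in> carrier F"
  unfolding carrier_iff mon_def by (auto intro: finite_subset[of _ "{w}"])

lemma mon_zero: "mon \<zero> w = \<zero>\<^bsub>F\<^esub>"
  by (auto simp: mon_def F_simps)

lemma free_gen_eq: "free_gen R v = mon \<one> [v]"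
  by (auto simp: free_gen_def mon_def)

lemma gen_closed: "v \<in> V \<Longrightarrow> free_gen R v \<in> carrier F"
  unfolding free_gen_eq by (rule mon_closed) auto

lemma add_closed: "\<lbrakk>f \<in> carrier F; g \<in> carrier F\<rbrakk> \<Longrightarrow> f \<oplus>\<^bsub>F\<^esub> g \<in> carrier F"
  unfolding carrier_iff F_simps
  by (auto intro!: finite_subset[of "{w. f w \<oplus> g w \<noteq> \<zero>}" "{w. f w \<noteq> \<zero>} \<union> {w. g w \<noteq> \<zero>}"])

lemma smult_closed: "\<lbrakk>r \<in> carrier R; f \<in> carrier F\<rbrakk> \<Longrightarrow> r \<odot>\<^bsub>F\<^esub> f \<in> carrier F"
  unfolding carrier_iff F_simps
  by (auto intro!: finite_subset[of "{w. r \<otimes> f w \<noteq> \<zero>}" "{w. f w \<noteq> \<zero>}"])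

lemma smult_mon: "\<lbrakk>r \<in> carrier R; s \<in> carrier R\<rbrakk> \<Longrightarrow> r \<odot>\<^bsub>F\<^esub> mon s w = mon (r \<otimes> s) w"
  unfolding F_simps mon_def by auto

lemma abelian_group_F: "abelian_group F"
proof (rule abelian_groupI)
  show "\<zero>\<^bsub>F\<^esub> \<in> carrier F" unfolding carrier_iff F_simps by simp
next
  fix f g h assume "f \<in> carrier F" "g \<in> carrier F" "h \<in> carrier F"
  then show "(f \<oplus>\<^bsub>F\<^esub> g) \<oplus>\<^bsub>F\<^esub> h = f \<oplus>\<^bsub>F\<^esub> (g \<oplus>\<^bsub>F\<^esub> h)"
    unfolding F_simps by (auto simp: carrierD a_assoc)
next
  fix f g assume "f \<in> carrier F" "g \<in> carrier F"
  then show "f \<oplus>\<^bsub>F\<^esub> g = g \<oplus>\<^bsub>F\<^esub> f"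
    unfolding F_simps by (auto simp: carrierD a_comm)
next
  fix f assume f: "f \<in> carrier F"
  then show "\<zero>\<^bsub>F\<^esub> \<oplus>\<^bsub>F\<^esub> f = f" unfolding F_simps by (auto simp: carrierD)
  show "\<exists>g\<in>carrier F. g \<oplus>\<^bsub>F\<^esub> f = \<zero>\<^bsub>F\<^esub>"
  proof (rule bexI[of _ "\<lambda>w. \<ominus> f w"])
    show "(\<lambda>w. \<ominus> f w) \<oplus>\<^bsub>F\<^esub> f = \<zero>\<^bsub>F\<^esub>"
      unfolding F_simps using f by (auto simp: carrierD l_neg)
    show "(\<lambda>w. \<ominus> f w) \<in> carrier F"
      using f unfolding carrier_iff
      by (auto intro!: finite_subset[of "{w. \<ominus> f w \<noteq> \<zero>}" "{w. f w \<noteq> \<zero>}"])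
  qed
qed (rule add_closed)

sublocale FA: abelian_group F by (rule abelian_group_F)

text \<open>Removes one monomial at a time from the finite support. Confining the support to
  \<open>W\<close> allows inductions inside one degree or over words in a smaller alphabet.\<close>

lemma monomial_induct [consumes 2, case_names mon add zero]:
  assumes "f \<in> carrier F" "{w. f w \<noteq> \<zero>} \<subseteq> W"
    and mon: "\<And>r w. \<lbrakk>r \<in> carrier R; w \<in> W; w \<in> lists V\<rbrakk> \<Longrightarrow> P (mon r w)"
    and add: "\<And>f g. \<lbrakk>f \<in> carrier F; g \<in> carrier F; P f; P g\<rbrakk> \<Longrightarrow> P (f \<oplus>\<^bsub>F\<^esub> g)"
    and zero: "P \<zero>\<^bsub>F\<^esub>"
  shows "P f"
  using assms(1,2)
proof (induction "card {w. f w \<noteq> \<zero>}" arbitrary: f)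
  case 0
  then have "{w. f w \<noteq> \<zero>} = {}" using supp_finite by (metis card_0_eq)
  then have "f = \<zero>\<^bsub>F\<^esub>" unfolding F_simps by auto
  then show ?case using zero by simp
next
  case (Suc n)
  then obtain w where w: "f w \<noteq> \<zero>" by (metis (mono_tags, lifting) Zero_not_Suc card.empty empty_Collect_eq)
  define g where "g = f(w := \<zero>)"
  have supp: "{u. g u \<noteq> \<zero>} = {u. f u \<noteq> \<zero>} - {w}" unfolding g_def by auto
  have g: "g \<in> carrier F"
    using Suc.prems(1) unfolding carrier_iff supp unfolding g_def by auto
  have wl: "w \<in> lists V" "w \<in> W" using w Suc.prems supp_lists by blast+
  have "n = card {u. g u \<noteq> \<zero>}"
    unfolding supp using Suc.hyps(2) w supp_finite[OF Suc.prems(1)] by simp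
  moreover have "{u. g u \<noteq> \<zero>} \<subseteq> W" using Suc.prems(2) unfolding supp by blast
  ultimately have "P g" using Suc.hyps(1) g by blast
  moreover have "P (mon (f w) w)" using mon[OF carrierD[OF Suc.prems(1)]] wl by blast
  moreover have "g \<oplus>\<^bsub>F\<^esub> mon (f w) w = f"
    unfolding F_simps g_def mon_def using carrierD[OF Suc.prems(1)] by auto
  ultimately show ?case
    using add[OF g mon_closed[OF carrierD[OF Suc.prems(1)] wl(1)]] by metis
qed

lemma mult_closed:
  assumes "f \<in> carrier F" "g \<in> carrier F"
  shows "f \<otimes>\<^bsub>F\<^esub> g \<in> carrier F"
  unfolding carrier_iff
proof (intro conjI allI impI)
  fix w show "(f \<otimes>\<^bsub>F\<^esub> g) w \<in> carrier R"
    unfolding F_simps using assms by (auto intro!: finsum_closed simp: carrierD)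
next
  fix w assume w: "w \<notin> lists V"
  have "f (take k w) \<otimes> g (drop k w) = \<zero>" for k
  proof -
    have "take k w \<notin> lists V \<or> drop k w \<notin> lists V"
      using w by (metis append_in_lists_conv append_take_drop_id)
    then have "f (take k w) = \<zero> \<or> g (drop k w) = \<zero>" using assms unfolding carrier_iff by blast
    then show ?thesis using assms by (auto simp: carrierD)
  qed
  then show "(f \<otimes>\<^bsub>F\<^esub> g) w = \<zero>" unfolding F_simps by simp
next
  \<comment> \<open>A nonzero coefficient at \<open>w\<close> requires a splitting of
    \<open>w\<close> into words from the two supports, and there are only finitely many such
    concatenations.\<close>
  have "{w. (f \<otimes>\<^bsub>F\<^esub> g) w \<noteq> \<zero>} \<subseteq> (\<lambda>(u, v). u @ v) ` ({w. f w \<noteq> \<zero>} \<times> {w. g w \<noteq> \<zero>})"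
  proof
    fix w assume w: "w \<in> {w. (f \<otimes>\<^bsub>F\<^esub> g) w \<noteq> \<zero>}"
    have "\<exists>k. f (take k w) \<otimes> g (drop k w) \<noteq> \<zero>"
    proof (rule ccontr)
      assume "\<nexists>k. f (take k w) \<otimes> g (drop k w) \<noteq> \<zero>"
      then have "(f \<otimes>\<^bsub>F\<^esub> g) w = \<zero>" unfolding F_simps by simp
      then show False using w by simp
    qed
    then obtain k where "f (take k w) \<otimes> g (drop k w) \<noteq> \<zero>" by blast
    then have "f (take k w) \<noteq> \<zero> \<and> g (drop k w) \<noteq> \<zero>" using assms by (auto simp: carrierD)
    then show "w \<in> (\<lambda>(u, v). u @ v) ` ({w. f w \<noteq> \<zero>} \<times> {w. g w \<noteq> \<zero>})"
      by (intro image_eqI[of _ _ "(take k w, drop k w)"]) auto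
  qed
  then show "finite {w. (f \<otimes>\<^bsub>F\<^esub> g) w \<noteq> \<zero>}"
    by (rule finite_subset) (use assms supp_finite in auto)
qed

lemma mult_add_left:
  assumes "f \<in> carrier F" "g \<in> carrier F" "h \<in> carrier F"
  shows "(f \<oplus>\<^bsub>F\<^esub> g) \<otimes>\<^bsub>F\<^esub> h = f \<otimes>\<^bsub>F\<^esub> h \<oplus>\<^bsub>F\<^esub> g \<otimes>\<^bsub>F\<^esub> h"
  unfolding F_simps using assms
  by (auto simp: carrierD l_distr finsum_addf Pi_def)

lemma mult_add_right:
  assumes "f \<in> carrier F" "g \<in> carrier F" "h \<in> carrier F"
  shows "h \<otimes>\<^bsub>F\<^esub> (f \<oplus>\<^bsub>F\<^esub> g) = h \<otimes>\<^bsub>F\<^esub> f \<oplus>\<^bsub>F\<^esub> h \<otimes>\<^bsub>F\<^esub> g"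
  unfolding F_simps using assms
  by (auto simp: carrierD r_distr finsum_addf Pi_def)

lemma mult_mon:
  assumes "r \<in> carrier R" "s \<in> carrier R"
  shows "mon r u \<otimes>\<^bsub>F\<^esub> mon s v = mon (r \<otimes> s) (u @ v)"
proof
  fix w
  have "(mon r u \<otimes>\<^bsub>F\<^esub> mon s v) w = (\<Oplus>k\<in>{..length w}. mon r u (take k w) \<otimes> mon s v (drop k w))"
    unfolding F_simps ..
  \<comment> \<open>At most one splitting contributes, the one at \<open>length u\<close>, and only
    if \<open>w\<close> is the concatenation; the conditional isolates this term.\<close>
  also have "\<dots> = (\<Oplus>k\<in>{..length w}. if k = length u then mon (r \<otimes> s) (u @ v) w else \<zero>)"
  proof (rule finsum_cong')
    show "(\<lambda>k. if k = length u then mon (r \<otimes> s) (u @ v) w else \<zero>) \<in> {..length w} \<rightarrow> carrier R"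
      using assms by (auto simp: mon_def)
  next
    fix k assume k: "k \<in> {..length w}"
    show "mon r u (take k w) \<otimes> mon s v (drop k w)
        = (if k = length u then mon (r \<otimes> s) (u @ v) w else \<zero>)"
    proof (cases "take k w = u \<and> drop k w = v")
      case True
      then have "w = u @ v" using append_take_drop_id[of k w] by simp
      moreover have "k = length u" using True k by auto
      ultimately show ?thesis by (simp add: mon_def)
    next
      case False
      then have "\<not> (k = length u \<and> w = u @ v)" by auto
      then show ?thesis using False assms by (auto simp: mon_def)
    qed
  qed simp
  also have "\<dots> = mon (r \<otimes> s) (u @ v) w"
  proof (cases "length u \<le> length w")
    case True
    then show ?thesis
      using add.finprod_singleton_swap[of "length u" "{..length w}" "\<lambda>k. mon (r \<otimes> s) (u @ v) w"] assms
      by (auto simp: mon_def)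
  next
    \<comment> \<open>Here \<open>w\<close> is shorter than \<open>u\<close>: no splitting
      qualifies, and \<open>w\<close> is not the concatenation either, so both sides vanish.\<close>
    case False
    then have "(\<Oplus>k\<in>{..length w}. if k = length u then mon (r \<otimes> s) (u @ v) w else \<zero>)
      = (\<Oplus>k\<in>{..length w}. \<zero>)" by (intro finsum_cong') auto
    then show ?thesis using False by (auto simp: mon_def)
  qed
  finally show "(mon r u \<otimes>\<^bsub>F\<^esub> mon s v) w = mon (r \<otimes> s) (u @ v) w" .
qed

lemma F_induct [consumes 1, case_names mon add]:
  assumes "f \<in> carrier F"
    and mon: "\<And>r w. \<lbrakk>r \<in> carrier R; w \<in> lists V\<rbrakk> \<Longrightarrow> P (mon r w)"
    and add: "\<And>f g. \<lbrakk>f \<in> carrier F; g \<in> carrier F; P f; P g\<rbrakk> \<Longrightarrow> P (f \<oplus>\<^bsub>F\<^esub> g)"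
  shows "P f"
  using assms(1) subset_UNIV
proof (induction rule: monomial_induct)
  case zero
  show ?case using mon[of \<zero> "[]"] by (simp add: mon_zero)
qed (use mon add in auto)

text \<open>Both sides are additive in every argument, which leaves monomials, where the claim is
  associativity of concatenation and of the coefficients.\<close>

lemma mult_assoc:
  assumes f: "f \<in> carrier F" and g: "g \<in> carrier F" and h: "h \<in> carrier F"
  shows "(f \<otimes>\<^bsub>F\<^esub> g) \<otimes>\<^bsub>F\<^esub> h = f \<otimes>\<^bsub>F\<^esub> (g \<otimes>\<^bsub>F\<^esub> h)"
  using f
proof (induction rule: F_induct)
  case (add f f')
  then show ?case using g h by (simp add: mult_add_left mult_closed)
next
  case m1: (mon r u)
  show ?case using g
  proof (induction rule: F_induct)
    case (add f f')
    then show ?case using h mon_closed[OF m1] by (simp add: mult_add_left mult_add_right mult_closed)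
  next
    case m2: (mon s v)
    show ?case using h
    proof (induction rule: F_induct)
      case (add f f')
      then show ?case using mon_closed[OF m1] mon_closed[OF m2] by (simp add: mult_add_right mult_closed)
    next
      case (mon t w)
      then show ?case using m1 m2 by (simp add: mult_mon m_assoc)
    qed
  qed
qed

lemma mult_one:
  assumes f: "f \<in> carrier F"
  shows "\<one>\<^bsub>F\<^esub> \<otimes>\<^bsub>F\<^esub> f = f" "f \<otimes>\<^bsub>F\<^esub> \<one>\<^bsub>F\<^esub> = f"
proof -
  have 1: "\<one>\<^bsub>F\<^esub> \<in> carrier F" unfolding F_simps by (rule mon_closed) auto
  show "\<one>\<^bsub>F\<^esub> \<otimes>\<^bsub>F\<^esub> f = f" using f
  proof (induction rule: F_induct)
    case (mon r w) then show ?case unfolding F_simps(2) by (simp add: mult_mon)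
  next
    case (add f g) then show ?case using 1 by (simp add: mult_add_right)
  qed
  show "f \<otimes>\<^bsub>F\<^esub> \<one>\<^bsub>F\<^esub> = f" using f
  proof (induction rule: F_induct)
    case (mon r w) then show ?case unfolding F_simps(2) by (simp add: mult_mon)
  next
    case (add f g) then show ?case using 1 by (simp add: mult_add_left)
  qed
qed

lemma ring_F: "ring F"
proof (rule ringI[OF abelian_group_F])
  have 1: "\<one>\<^bsub>F\<^esub> \<in> carrier F" unfolding F_simps by (rule mon_closed) auto
  show "monoid F" by (rule monoidI) (rule mult_closed 1 mult_assoc mult_one | assumption)+
qed (rule mult_add_left mult_add_right | assumption)+

lemma module_F: "module R F"
  by (rule moduleI[OF is_cring abelian_group_F])
    (auto simp: smult_closed[unfolded F_simps(4)] F_simps(3,4) carrierD l_distr r_distr m_assoc)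

lemma assoc_algebra_F: "assoc_algebra R F"
proof (intro assoc_algebra.intro assoc_algebra_axioms.intro)
  fix r f g assume r: "r \<in> carrier R" and fg: "f \<in> carrier F" "g \<in> carrier F"
  show "(r \<odot>\<^bsub>F\<^esub> f) \<otimes>\<^bsub>F\<^esub> g = r \<odot>\<^bsub>F\<^esub> (f \<otimes>\<^bsub>F\<^esub> g)"
    unfolding F_simps using r fg
    by (auto simp: carrierD m_assoc finsum_rdistr Pi_def)
  show "f \<otimes>\<^bsub>F\<^esub> (r \<odot>\<^bsub>F\<^esub> g) = r \<odot>\<^bsub>F\<^esub> (f \<otimes>\<^bsub>F\<^esub> g)"
    unfolding F_simps using r fg
    by (auto simp: carrierD m_lcomm finsum_rdistr Pi_def)
qed (rule module_F ring_F)+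

text \<open>Every word is a product of generators, so values on generators propagate to words, by
  linearity to monomials and by additivity to everything. It serves to compare two maps out of the
  free algebra of a member in \<open>eps_sigma\<close>.\<close>

lemma hom_unique:
  assumes h: "ring_hom_ring F B h" "\<And>r f. \<lbrakk>r \<in> carrier R; f \<in> carrier F\<rbrakk> \<Longrightarrow> h (r \<odot>\<^bsub>F\<^esub> f) = r \<odot>\<^bsub>B\<^esub> h f"
    and k: "ring_hom_ring F B k" "\<And>r f. \<lbrakk>r \<in> carrier R; f \<in> carrier F\<rbrakk> \<Longrightarrow> k (r \<odot>\<^bsub>F\<^esub> f) = r \<odot>\<^bsub>B\<^esub> k f"
    and gen: "\<And>v. v \<in> V \<Longrightarrow> h (free_gen R v) = k (free_gen R v)"
    and f: "f \<in> carrier F"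
  shows "h f = k f"
proof -
  interpret h: ring_hom_ring F B h by (rule h(1))
  interpret k: ring_hom_ring F B k by (rule k(1))
  show ?thesis using f
  proof (induction rule: F_induct)
    case (add f g)
    then show ?case by (simp only: h.hom_add k.hom_add)
  next
    case (mon r w)
    have "h (mon \<one> w) = k (mon \<one> w)" using mon(2)
    proof (induction w)
      case Nil
      then show ?case using h.hom_one k.hom_one unfolding F_simps by simp
    next
      case (Cons v w)
      then have c: "free_gen R v \<in> carrier F" "mon \<one> w \<in> carrier F"
        using gen_closed mon_closed by auto
      have "mon \<one> (v # w) = free_gen R v \<otimes>\<^bsub>F\<^esub> mon \<one> w"
        unfolding free_gen_eq by (subst mult_mon) auto
      then show ?case using Cons gen by (simp add: h.hom_mult[OF c] k.hom_mult[OF c])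
    qed
    moreover have "mon r w = r \<odot>\<^bsub>F\<^esub> mon \<one> w" using mon by (simp add: smult_mon)
    ultimately show ?case using mon mon_closed[OF one_closed mon(2)] by (simp add: h(2) k(2))
  qed
qed

end

section \<open>Evaluation: the universal property of free algebras\<close>

locale free_algebra_eval = free_algebra_on R V + B: assoc_algebra R B
  for R :: "('r, 'c) ring_scheme" (structure) and V :: "'v set"
    and B :: "('r, 'b, 'd) graded_algebra_scheme" +
  fixes g :: "'v \<Rightarrow> 'b"
  assumes g_closed: "v \<in> V \<Longrightarrow> g v \<in> carrier B"
begin

definition word :: "'v list \<Rightarrow> 'b" where
  "word w = foldr (\<lambda>v x. g v \<otimes>\<^bsub>B\<^esub> x) w \<one>\<^bsub>B\<^esub>"

definition ev :: "('v list \<Rightarrow> 'r) \<Rightarrow> 'b" where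
  "ev f = (\<Oplus>\<^bsub>B\<^esub>w\<in>{w. f w \<noteq> \<zero>}. f w \<odot>\<^bsub>B\<^esub> word w)"

lemma word_closed: "w \<in> lists V \<Longrightarrow> word w \<in> carrier B"
  by (induction w) (auto simp: word_def g_closed)

lemma word_append:
  "\<lbrakk>u \<in> lists V; v \<in> lists V\<rbrakk> \<Longrightarrow> word (u @ v) = word u \<otimes>\<^bsub>B\<^esub> word v"
proof (induction u)
  case Nil then show ?case using word_closed[of v] by (simp add: word_def)
next
  case (Cons a u)
  then have "word (a # (u @ v)) = g a \<otimes>\<^bsub>B\<^esub> (word u \<otimes>\<^bsub>B\<^esub> word v)" by (simp add: word_def)
  also have "\<dots> = g a \<otimes>\<^bsub>B\<^esub> word u \<otimes>\<^bsub>B\<^esub> word v"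
    using Cons.prems word_closed[of u] word_closed[of v] g_closed[of a] by (simp add: B.m_assoc)
  finally show ?case by (simp add: word_def)
qed

text \<open>Sums over different supports become comparable only on a common finite set of words.
  That set must stay inside \<open>lists V\<close>, where the values of \<open>word\<close> are
  known to lie in \<open>B\<close>.\<close>

lemma ev_superset:
  assumes "f \<in> carrier F" "finite S" "{w. f w \<noteq> \<zero>} \<subseteq> S" "S \<subseteq> lists V"
  shows "ev f = (\<Oplus>\<^bsub>B\<^esub>w\<in>S. f w \<odot>\<^bsub>B\<^esub> word w)"
  unfolding ev_def
proof (rule B.add.finprod_mono_neutral_cong_left[OF assms(2,3)])
  fix w assume "w \<in> S - {w. f w \<noteq> \<zero>}"
  then show "f w \<odot>\<^bsub>B\<^esub> word w = \<zero>\<^bsub>B\<^esub>"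
    using assms(4) B.smult_l_null[OF word_closed, of w] by auto
next
  have "f w \<odot>\<^bsub>B\<^esub> word w \<in> carrier B" if "w \<in> S" for w
    using B.smult_closed[OF carrierD[OF assms(1)] word_closed, of w w] assms(4) that by blast
  then show "(\<lambda>w. f w \<odot>\<^bsub>B\<^esub> word w) \<in> S \<rightarrow> carrier B" by simp
qed simp

lemma ev_closed: "f \<in> carrier F \<Longrightarrow> ev f \<in> carrier B"
  unfolding ev_def
proof (rule B.finsum_closed, rule Pi_I)
  fix w assume f: "f \<in> carrier F" "w \<in> {w. f w \<noteq> \<zero>}"
  then have "w \<in> lists V" using supp_lists by blast
  then show "f w \<odot>\<^bsub>B\<^esub> word w \<in> carrier B"
    by (rule B.smult_closed[OF carrierD[OF f(1)] word_closed])
qed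

lemma ev_add:
  assumes f: "f \<in> carrier F" and h: "h \<in> carrier F"
  shows "ev (f \<oplus>\<^bsub>F\<^esub> h) = ev f \<oplus>\<^bsub>B\<^esub> ev h"
proof -
  let ?S = "{w. f w \<noteq> \<zero>} \<union> {w. h w \<noteq> \<zero>}"
  have S: "finite ?S" "?S \<subseteq> lists V" using supp_finite supp_lists f h by auto
  have c: "(f \<oplus>\<^bsub>F\<^esub> h) \<in> carrier F" by (rule add_closed[OF f h])
  have W: "word w \<in> carrier B" if "w \<in> ?S" for w using word_closed S(2) that by blast
  have "ev (f \<oplus>\<^bsub>F\<^esub> h) = (\<Oplus>\<^bsub>B\<^esub>w\<in>?S. (f w \<oplus> h w) \<odot>\<^bsub>B\<^esub> word w)"
  proof (subst ev_superset[OF c S(1) _ S(2)])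
    show "{w. (f \<oplus>\<^bsub>F\<^esub> h) w \<noteq> \<zero>} \<subseteq> ?S" unfolding F_simps by auto
  qed (simp add: F_simps)
  also have "\<dots> = (\<Oplus>\<^bsub>B\<^esub>w\<in>?S. f w \<odot>\<^bsub>B\<^esub> word w \<oplus>\<^bsub>B\<^esub> h w \<odot>\<^bsub>B\<^esub> word w)"
  proof (rule B.finsum_cong'[OF refl])
    show "(\<lambda>w. f w \<odot>\<^bsub>B\<^esub> word w \<oplus>\<^bsub>B\<^esub> h w \<odot>\<^bsub>B\<^esub> word w) \<in> ?S \<rightarrow> carrier B"
      by (intro Pi_I B.add.m_closed B.smult_closed carrierD[OF f] carrierD[OF h] W)
    fix w assume "w \<in> ?S"
    then show "(f w \<oplus> h w) \<odot>\<^bsub>B\<^esub> word w = f w \<odot>\<^bsub>B\<^esub> word w \<oplus>\<^bsub>B\<^esub> h w \<odot>\<^bsub>B\<^esub> word w"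
      by (intro B.smult_l_distr carrierD[OF f] carrierD[OF h] W)
  qed
  also have "\<dots> = (\<Oplus>\<^bsub>B\<^esub>w\<in>?S. f w \<odot>\<^bsub>B\<^esub> word w) \<oplus>\<^bsub>B\<^esub> (\<Oplus>\<^bsub>B\<^esub>w\<in>?S. h w \<odot>\<^bsub>B\<^esub> word w)"
    by (rule B.finsum_addf; intro Pi_I B.smult_closed carrierD[OF f] carrierD[OF h] W)
  finally show ?thesis
    using ev_superset[OF f S(1) _ S(2)] ev_superset[OF h S(1) _ S(2)] by auto
qed

lemma ev_mon:
  assumes r: "r \<in> carrier R" and w: "w \<in> lists V"
  shows "ev (mon r w) = r \<odot>\<^bsub>B\<^esub> word w"
proof -
  have "ev (mon r w) = (\<Oplus>\<^bsub>B\<^esub>u\<in>{w}. mon r w u \<odot>\<^bsub>B\<^esub> word u)"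
    by (rule ev_superset[OF mon_closed[OF r w]]) (use w in \<open>auto simp: mon_def\<close>)
  also have "\<dots> = r \<odot>\<^bsub>B\<^esub> word w"
    using B.smult_closed[OF r word_closed[OF w]] by (simp add: mon_def B.add.finprod_insert)
  finally show ?thesis .
qed

lemma ev_gen: "v \<in> V \<Longrightarrow> ev (free_gen R v) = g v"
  unfolding free_gen_eq by (subst ev_mon) (auto simp: word_def g_closed)

text \<open>Induction on monomials avoids comparing the two supports: a scalar that is a zero
  divisor can shrink the support of \<open>f\<close>.\<close>

lemma ev_smult:
  assumes r: "r \<in> carrier R" and f: "f \<in> carrier F"
  shows "ev (r \<odot>\<^bsub>F\<^esub> f) = r \<odot>\<^bsub>B\<^esub> ev f"
  using f
proof (induction rule: F_induct)
  case (mon s w)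
  then show ?case using r word_closed[of w]
    by (simp add: smult_mon ev_mon B.smult_assoc1)
next
  case (add f f')
  have "r \<odot>\<^bsub>F\<^esub> (f \<oplus>\<^bsub>F\<^esub> f') = r \<odot>\<^bsub>F\<^esub> f \<oplus>\<^bsub>F\<^esub> r \<odot>\<^bsub>F\<^esub> f'"
    by (rule module.smult_r_distr[OF module_F r add(1,2)])
  then show ?case using add r by (simp add: ev_add smult_closed B.smult_r_distr ev_closed)
qed

text \<open>Biadditivity reduces to monomials; there \<open>word_append\<close> handles the words,
  and scalars are pulled out of both factors.\<close>

lemma ev_mult:
  assumes f: "f \<in> carrier F" and h: "h \<in> carrier F"
  shows "ev (f \<otimes>\<^bsub>F\<^esub> h) = ev f \<otimes>\<^bsub>B\<^esub> ev h"
  using f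
proof (induction rule: F_induct)
  case (add f f')
  then show ?case using h by (simp add: mult_add_left ev_add mult_closed ev_closed B.l_distr)
next
  case m: (mon r u)
  show ?case using h
  proof (induction rule: F_induct)
    case (add h h')
    then show ?case using mon_closed[OF m]
      by (simp add: mult_add_right ev_add mult_closed ev_closed B.r_distr)
  next
    case (mon s v)
    have c: "word u \<in> carrier B" "word v \<in> carrier B" using word_closed m mon by auto
    have sv: "s \<odot>\<^bsub>B\<^esub> word v \<in> carrier B" using mon(1) c(2) by (rule B.smult_closed)
    have "ev (mon r u \<otimes>\<^bsub>F\<^esub> mon s v) = (r \<otimes> s) \<odot>\<^bsub>B\<^esub> (word u \<otimes>\<^bsub>B\<^esub> word v)"
      using m mon by (simp add: mult_mon ev_mon word_append)
    also have "\<dots> = (r \<odot>\<^bsub>B\<^esub> word u) \<otimes>\<^bsub>B\<^esub> (s \<odot>\<^bsub>B\<^esub> word v)"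
      unfolding B.smult_mult_left[OF m(1) c(1) sv] B.smult_mult_right[OF mon(1) c]
      using m mon c by (simp add: B.smult_assoc1)
    finally show ?case using m mon by (simp add: ev_mon)
  qed
qed

lemma ev_hom: "ring_hom_ring F B ev"
proof (rule ring_hom_ringI2[OF ring_F B.ring_axioms], rule ring_hom_memI)
  show "ev \<one>\<^bsub>F\<^esub> = \<one>\<^bsub>B\<^esub>" unfolding F_simps by (subst ev_mon) (auto simp: word_def)
qed (rule ev_closed ev_mult ev_add | assumption)+

end

\<comment> \<open>so that the simplifier does not turn \<open>grade A 1\<close> into \<open>grade A (Suc 0)\<close>\<close>
declare One_nat_def [simp del]

section \<open>Quadratic presentations\<close>

text \<open>The kernel of the map from the free algebra on \<open>A\<^sub>1\<close> to the twofold quotient in the definition of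
  a quadratic algebra is the ideal generated by the linearity relations and by representatives
  of the quadratic relations.\<close>

definition quadratic_presentation ::
  "('r, 'c) ring_scheme \<Rightarrow> ('r, 'a, 'd) graded_algebra_scheme \<Rightarrow> ('a list \<Rightarrow> 'r) set
    \<Rightarrow> (('a list \<Rightarrow> 'r) \<Rightarrow> 'a) \<Rightarrow> bool" where
  "quadratic_presentation R A S \<psi> \<longleftrightarrow>
     (let F = free_algebra R (grade A 1)
      in S \<subseteq> grade F 2 \<and> ring_hom_ring F A \<psi> \<and> \<psi> ` carrier F = carrier A \<and>
         (\<forall>r\<in>carrier R. \<forall>f\<in>carrier F. \<psi> (r \<odot>\<^bsub>F\<^esub> f) = r \<odot>\<^bsub>A\<^esub> \<psi> f) \<and>
         (\<forall>n. \<psi> ` grade F n = grade A n) \<and>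
         (\<forall>f\<in>carrier F. \<psi> f = \<zero>\<^bsub>A\<^esub> \<longleftrightarrow>
            f \<in> Idl\<^bsub>F\<^esub> (linearity_relations R (A\<lparr>carrier := grade A 1\<rparr>) \<union> S)))"

lemma quadratic_presentationD:
  assumes "quadratic_presentation R A S \<psi>"
  shows "ring_hom_ring (free_algebra R (grade A 1)) A \<psi>"
    and "\<lbrakk>r \<in> carrier R; f \<in> carrier (free_algebra R (grade A 1))\<rbrakk> \<Longrightarrow>
      \<psi> (r \<odot>\<^bsub>free_algebra R (grade A 1)\<^esub> f) = r \<odot>\<^bsub>A\<^esub> \<psi> f"
    and "\<psi> ` grade (free_algebra R (grade A 1)) n = grade A n"
    and "\<psi> ` carrier (free_algebra R (grade A 1)) = carrier A"
    and "f \<in> carrier (free_algebra R (grade A 1)) \<Longrightarrow> \<psi> f = \<zero>\<^bsub>A\<^esub> \<longleftrightarrow>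
      f \<in> Idl\<^bsub>free_algebra R (grade A 1)\<^esub> (linearity_relations R (A\<lparr>carrier := grade A 1\<rparr>) \<union> S)"
    and "S \<subseteq> grade (free_algebra R (grade A 1)) 2"
  using assms unfolding quadratic_presentation_def Let_def by blast+

lemma (in graded_algebra) grade_subset: "grade A n \<subseteq> carrier A"
  by (rule submoduleE(1)[OF grade_submodule])

lemma (in graded_algebra) linearity_relations_subset:
  "linearity_relations R (A\<lparr>carrier := grade A 1\<rparr>) \<subseteq> carrier (free_algebra R (grade A 1))"
proof -
  interpret F: free_algebra_on R "grade A 1" ..
  have g: "free_gen R u \<in> carrier F.F" if "u \<in> grade A 1" for u using that by (rule F.gen_closed)
  have "free_gen R (u \<oplus>\<^bsub>A\<^esub> v) \<ominus>\<^bsub>F.F\<^esub> (free_gen R u \<oplus>\<^bsub>F.F\<^esub> free_gen R v) \<in> carrier F.F"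
    if "u \<in> grade A 1" "v \<in> grade A 1" for u v
    by (intro abelian_group.minus_closed[OF F.abelian_group_F] F.add_closed g that submoduleE(5)[OF grade_submodule])
  moreover have "free_gen R (r \<odot>\<^bsub>A\<^esub> v) \<ominus>\<^bsub>F.F\<^esub> (r \<odot>\<^bsub>F.F\<^esub> free_gen R v) \<in> carrier F.F"
    if "r \<in> carrier R" "v \<in> grade A 1" for r v
    by (intro abelian_group.minus_closed[OF F.abelian_group_F] F.smult_closed g that submoduleE(4)[OF grade_submodule])
  ultimately show ?thesis unfolding linearity_relations_def Let_def by auto
qed

text \<open>From left to right, compose the projection of the free algebra onto the twofold quotient
  with the given isomorphism; \<open>kernel_proj\<close> computes the kernel. From right to left,
  \<open>\<psi>\<close> and the projection are surjections with the same kernel, so their targets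
  are isomorphic, and the isomorphism inherits scalars and degrees from
  \<open>\<psi>\<close>.\<close>

lemma quadratic_algebra_iff:
  "quadratic_algebra R A \<longleftrightarrow>
     connected_graded_algebra R A \<and> (\<exists>S \<psi>. quadratic_presentation R A S \<psi>)"
proof (cases "graded_algebra R A")
  case False
  then show ?thesis unfolding quadratic_algebra_def connected_graded_algebra_def by blast
next
  case True
  then interpret graded_algebra R A .
  define L where "L = linearity_relations R (A\<lparr>carrier := grade A 1\<rparr>)"
  define F where "F = free_algebra R (grade A 1)"
  interpret FF: free_algebra_on R "grade A 1" ..
  interpret F: scalar_ring R F
    unfolding F_def by (rule assoc_algebra.scalar_ring[OF FF.assoc_algebra_F])
  have LF: "L \<subseteq> carrier F" unfolding L_def F_def by (rule linearity_relations_subset)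
  have F2: "grade F n \<subseteq> carrier F" for n unfolding F_def using FF.grade_iff by blast
  define t where "t x = Idl\<^bsub>F\<^esub> L +>\<^bsub>F\<^esub> x" for x
  define T where "T = tensor_algebra R (A\<lparr>carrier := grade A 1\<rparr>)"
  have T: "T = quotient_algebra F (Idl\<^bsub>F\<^esub> L)"
    unfolding T_def tensor_algebra_def F_def L_def by simp
  have T2: "grade T 2 = t ` grade F 2" unfolding T quotient_algebra_simps t_def ..
  have iq: "iterated_quotient R F L S" if "S \<subseteq> grade F 2" for S
    using LF F2[of 2] that by unfold_locales blast+
  have "(\<exists>S' \<subseteq> grade T 2. graded_algebra_iso R (quotient_algebra T (Idl\<^bsub>T\<^esub> S')) A \<noteq> {})
    \<longleftrightarrow> (\<exists>S \<psi>. quadratic_presentation R A S \<psi>)"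
  proof
    assume "\<exists>S' \<subseteq> grade T 2. graded_algebra_iso R (quotient_algebra T (Idl\<^bsub>T\<^esub> S')) A \<noteq> {}"
    then obtain S' \<phi> where S': "S' \<subseteq> t ` grade F 2"
      and \<phi>: "\<phi> \<in> graded_algebra_iso R (quotient_algebra T (Idl\<^bsub>T\<^esub> S')) A" unfolding T2 by blast
    \<comment> \<open>Degree 2 of the tensor algebra is the image of degree 2 of the free algebra,
      so the quadratic relations have homogeneous representatives there.\<close>
    obtain S where S: "S \<subseteq> grade F 2" "S' = t ` S" using S' by (rule subset_imageE)
    interpret q: iterated_quotient R F L S by (rule iq[OF S(1)])
    have Q: "quotient_algebra T (Idl\<^bsub>T\<^esub> S') = q.Q"
      unfolding q.Q_def q.T_def T S(2) t_def ..
    interpret p: ring_hom_ring F q.Q q.proj by (rule q.proj_hom)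
    have \<phi>': "\<phi> \<in> ring_hom q.Q A" "bij_betw \<phi> (carrier q.Q) (carrier A)"
      using \<phi> unfolding Q graded_algebra_iso_def ring_iso_def by blast+
    interpret \<phi>: ring_hom_ring q.Q A \<phi> by (rule ring_hom_ringI2[OF p.S.ring_axioms ring_axioms \<phi>'(1)])
    have "\<phi> \<circ> q.proj \<in> ring_hom F A" by (rule ring_hom_trans[OF p.homh \<phi>.homh])
    then have 1: "ring_hom_ring F A (\<phi> \<circ> q.proj)" by (rule ring_hom_ringI2[OF F.ring_axioms ring_axioms])
    have 2: "(\<phi> \<circ> q.proj) ` carrier F = carrier A"
      using \<phi>'(2) unfolding image_comp[symmetric] q.proj_surj by (simp add: bij_betw_def)
    have 3: "(\<phi> \<circ> q.proj) ` grade F n = grade A n" for n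
      using \<phi> unfolding image_comp[symmetric] q.proj_grade Q graded_algebra_iso_def by blast
    have 4: "(\<phi> \<circ> q.proj) (r \<odot>\<^bsub>F\<^esub> f) = r \<odot>\<^bsub>A\<^esub> (\<phi> \<circ> q.proj) f" if "r \<in> carrier R" "f \<in> carrier F" for r f
      using \<phi> that p.hom_closed[OF that(2)] unfolding Q graded_algebra_iso_def by (simp add: q.proj_smult)
    have 5: "(\<phi> \<circ> q.proj) f = \<zero>\<^bsub>A\<^esub> \<longleftrightarrow> f \<in> Idl\<^bsub>F\<^esub> (L \<union> S)" if f: "f \<in> carrier F" for f
    proof -
      have "\<phi> (q.proj f) = \<zero>\<^bsub>A\<^esub> \<longleftrightarrow> \<phi> (q.proj f) = \<phi> \<zero>\<^bsub>q.Q\<^esub>" by simp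
      also have "\<dots> \<longleftrightarrow> q.proj f = \<zero>\<^bsub>q.Q\<^esub>"
        by (rule inj_on_eq_iff[OF bij_betw_imp_inj_on[OF \<phi>'(2)]]) (use f in auto)
      finally show ?thesis using q.kernel_proj[OF f] by simp
    qed
    have "quadratic_presentation R A S (\<phi> \<circ> q.proj)"
      unfolding quadratic_presentation_def Let_def F_def[symmetric] L_def[symmetric]
      using S(1) 1 2 3 4 5 by blast
    then show "\<exists>S \<psi>. quadratic_presentation R A S \<psi>" by blast
  next
    assume "\<exists>S \<psi>. quadratic_presentation R A S \<psi>"
    then obtain S \<psi> where pres: "quadratic_presentation R A S \<psi>" by blast
    note \<psi> = quadratic_presentationD(1,4)[OF pres, folded F_def]
      and lin = quadratic_presentationD(2)[OF pres, folded F_def]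
      and gr = quadratic_presentationD(3)[OF pres, folded F_def]
      and ker = quadratic_presentationD(5)[OF pres, folded F_def L_def]
      and S = quadratic_presentationD(6)[OF pres, folded F_def]
    interpret q: iterated_quotient R F L S by (rule iq[OF S])
    interpret p: ring_hom_ring F q.Q q.proj by (rule q.proj_hom)
    have same: "q.proj f = \<zero>\<^bsub>q.Q\<^esub> \<longleftrightarrow> \<psi> f = \<zero>\<^bsub>A\<^esub>" if "f \<in> carrier F" for f
      unfolding q.kernel_proj[OF that] ker[OF that] ..
    obtain \<phi> where \<phi>: "\<phi> \<in> ring_iso q.Q A" "\<And>f. f \<in> carrier F \<Longrightarrow> \<phi> (q.proj f) = \<psi> f"
      by (rule ring_iso_of_same_kernel[OF q.proj_hom \<psi>(1) q.proj_surj \<psi>(2) same]) blast+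
    have "\<phi> \<in> graded_algebra_iso R q.Q A"
      unfolding graded_algebra_iso_def
    proof (intro CollectI conjI ballI allI)
      fix r x assume r: "r \<in> carrier R" and x: "x \<in> carrier q.Q"
      obtain f where f: "f \<in> carrier F" "x = q.proj f" using x unfolding q.proj_surj[symmetric] by blast
      have "\<phi> (r \<odot>\<^bsub>q.Q\<^esub> x) = \<phi> (q.proj (r \<odot>\<^bsub>F\<^esub> f))" unfolding f(2) q.proj_smult[OF r f(1)] ..
      also have "\<dots> = r \<odot>\<^bsub>A\<^esub> \<phi> x"
        unfolding f(2) \<phi>(2)[OF F.smult_closed[OF r f(1)]] \<phi>(2)[OF f(1)] by (rule lin[OF r f(1)])
      finally show "\<phi> (r \<odot>\<^bsub>q.Q\<^esub> x) = r \<odot>\<^bsub>A\<^esub> \<phi> x" .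
    next
      fix n
      have "\<phi> ` grade q.Q n = \<psi> ` grade F n"
        unfolding q.proj_grade[symmetric] image_image
        by (rule image_cong[OF refl]) (use F2 \<phi>(2) in blast)
      then show "\<phi> ` grade q.Q n = grade A n" unfolding gr .
    qed (rule \<phi>(1))
    moreover have "q.Q = quotient_algebra T (Idl\<^bsub>T\<^esub> (t ` S))"
      unfolding q.Q_def q.T_def T t_def ..
    moreover have "t ` S \<subseteq> grade T 2" unfolding T2 using S by blast
    ultimately show "\<exists>S' \<subseteq> grade T 2. graded_algebra_iso R (quotient_algebra T (Idl\<^bsub>T\<^esub> S')) A \<noteq> {}"
      by auto
  qed
  then show ?thesis unfolding quadratic_algebra_def Let_def T_def by blast
qed

section \<open>The linear map that a presentation induces in degree 1\<close>

locale presented_algebra = graded_algebra R A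
  for R :: "('r, 'c) ring_scheme" (structure)
    and A :: "('r, 'a, 'd) graded_algebra_scheme" (structure) +
  fixes S :: "('a list \<Rightarrow> 'r) set" and \<psi> :: "('a list \<Rightarrow> 'r) \<Rightarrow> 'a"
  assumes presentation: "quadratic_presentation R A S \<psi>"
begin

sublocale V: free_algebra_on R "grade A 1" ..

sublocale \<psi>: ring_hom_ring V.F A \<psi> by (rule quadratic_presentationD(1)[OF presentation])

lemma linear: "\<lbrakk>r \<in> carrier R; f \<in> carrier V.F\<rbrakk> \<Longrightarrow> \<psi> (r \<odot>\<^bsub>V.F\<^esub> f) = r \<odot>\<^bsub>A\<^esub> \<psi> f"
  by (rule quadratic_presentationD(2)[OF presentation])

lemma psi_relation:
  assumes "x \<in> linearity_relations R (A\<lparr>carrier := grade A 1\<rparr>) \<union> S"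
  shows "\<psi> x = \<zero>\<^bsub>A\<^esub>"
proof -
  have sub: "linearity_relations R (A\<lparr>carrier := grade A 1\<rparr>) \<union> S \<subseteq> carrier V.F"
    using linearity_relations_subset quadratic_presentationD(6)[OF presentation] V.grade_iff by blast
  have "x \<in> Idl\<^bsub>V.F\<^esub> (linearity_relations R (A\<lparr>carrier := grade A 1\<rparr>) \<union> S)"
    using \<psi>.R.genideal_self[OF sub] assms by blast
  moreover have "x \<in> carrier V.F" using sub assms by blast
  ultimately show ?thesis using quadratic_presentationD(5)[OF presentation] by blast
qed

text \<open>The corresponding linearity relation lies in the kernel of \<open>\<psi>\<close>.
  Together with \<open>psi_gen_smult\<close> this makes \<open>\<psi>\<close> linear on generators,
  though not necessarily the identity there.\<close>

lemma psi_gen_add: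
  assumes "u \<in> grade A 1" "v \<in> grade A 1"
  shows "\<psi> (free_gen R (u \<oplus>\<^bsub>A\<^esub> v)) = \<psi> (free_gen R u) \<oplus>\<^bsub>A\<^esub> \<psi> (free_gen R v)"
proof -
  have c: "free_gen R u \<in> carrier V.F" "free_gen R v \<in> carrier V.F"
    "free_gen R (u \<oplus>\<^bsub>A\<^esub> v) \<in> carrier V.F"
    using assms submoduleE(5)[OF grade_submodule assms] by (auto intro: V.gen_closed)
  have "\<psi> (free_gen R (u \<oplus>\<^bsub>A\<^esub> v) \<ominus>\<^bsub>V.F\<^esub> (free_gen R u \<oplus>\<^bsub>V.F\<^esub> free_gen R v)) = \<zero>\<^bsub>A\<^esub>"
    by (rule psi_relation) (use assms in \<open>auto simp: linearity_relations_def Let_def\<close>)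
  then have "\<psi> (free_gen R (u \<oplus>\<^bsub>A\<^esub> v)) = \<psi> (free_gen R u \<oplus>\<^bsub>V.F\<^esub> free_gen R v)"
    using ring_hom_eq_iff[OF \<psi>.ring_hom_ring_axioms c(3) V.add_closed[OF c(1,2)]] by simp
  then show ?thesis using \<psi>.hom_add[OF c(1,2)] by simp
qed

lemma psi_gen_smult:
  assumes "r \<in> carrier R" "v \<in> grade A 1"
  shows "\<psi> (free_gen R (r \<odot>\<^bsub>A\<^esub> v)) = r \<odot>\<^bsub>A\<^esub> \<psi> (free_gen R v)"
proof -
  have c: "free_gen R v \<in> carrier V.F" "free_gen R (r \<odot>\<^bsub>A\<^esub> v) \<in> carrier V.F"
    using assms submoduleE(4)[OF grade_submodule assms] by (auto intro: V.gen_closed)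
  have "\<psi> (free_gen R (r \<odot>\<^bsub>A\<^esub> v) \<ominus>\<^bsub>V.F\<^esub> (r \<odot>\<^bsub>V.F\<^esub> free_gen R v)) = \<zero>\<^bsub>A\<^esub>"
    by (rule psi_relation) (use assms in \<open>auto simp: linearity_relations_def Let_def\<close>)
  then have "\<psi> (free_gen R (r \<odot>\<^bsub>A\<^esub> v)) = \<psi> (r \<odot>\<^bsub>V.F\<^esub> free_gen R v)"
    using ring_hom_eq_iff[OF \<psi>.ring_hom_ring_axioms c(2) V.smult_closed[OF assms(1) c(1)]] by simp
  then show ?thesis using linear[OF assms(1) c(1)] by simp
qed

text \<open>Degree 1 of the free algebra consists of linear combinations of generators, and by the
  linearity relations \<open>\<psi>\<close> takes the same value on such a combination as on a
  single generator. Since \<open>\<psi>\<close> maps degree 1 onto degree 1, the induced linear map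
  is onto.\<close>

lemma grade_one_eq: "grade A 1 = (\<lambda>v. \<psi> (free_gen R v)) ` grade A 1"
proof
  have "\<psi> (free_gen R v) \<in> grade A 1" if v: "v \<in> grade A 1" for v
  proof -
    have "free_gen R v \<in> grade V.F 1"
      unfolding V.grade_iff using V.gen_closed[OF v] by (auto simp: free_gen_def)
    then show ?thesis using quadratic_presentationD(3)[OF presentation] by blast
  qed
  then show "(\<lambda>v. \<psi> (free_gen R v)) ` grade A 1 \<subseteq> grade A 1" by blast
  have *: "\<exists>v\<in>grade A 1. \<psi> f = \<psi> (free_gen R v)" if f: "f \<in> grade V.F 1" for f
  proof -
    have "f \<in> carrier V.F" "{w. f w \<noteq> \<zero>} \<subseteq> {w. length w = 1}" using f unfolding V.grade_iff by auto
    then show ?thesis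
    proof (induction rule: V.monomial_induct)
      case (mon r w)
      then obtain v where v: "w = [v]" "v \<in> grade A 1" by (auto simp: length_Suc_conv One_nat_def)
      have "V.mon r w = r \<odot>\<^bsub>V.F\<^esub> free_gen R v" unfolding v(1) V.free_gen_eq using mon by (simp add: V.smult_mon)
      then have "\<psi> (V.mon r w) = \<psi> (free_gen R (r \<odot>\<^bsub>A\<^esub> v))"
        using linear[OF mon(1) V.gen_closed[OF v(2)]] psi_gen_smult[OF mon(1) v(2)] by simp
      then show ?case using submoduleE(4)[OF grade_submodule mon(1) v(2)] by blast
    next
      case (add f g)
      then obtain u v where uv: "u \<in> grade A 1" "v \<in> grade A 1"
        "\<psi> f = \<psi> (free_gen R u)" "\<psi> g = \<psi> (free_gen R v)" by blast
      have "\<psi> (f \<oplus>\<^bsub>V.F\<^esub> g) = \<psi> (free_gen R (u \<oplus>\<^bsub>A\<^esub> v))"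
        unfolding psi_gen_add[OF uv(1,2)] \<psi>.hom_add[OF add(1,2)] uv(3,4) ..
      then show ?case using submoduleE(5)[OF grade_submodule uv(1,2)] by blast
    next
      case zero
      have z: "\<zero>\<^bsub>A\<^esub> \<in> grade A 1"
        using subgroup.one_closed[OF submodule.axioms(1)[OF grade_submodule]] by simp
      \<comment> \<open>The generator at the zero vector is not the zero of the free algebra; that
        \<open>\<psi>\<close> annihilates it follows from compatibility with the scalar
        zero.\<close>
      have "\<psi> (free_gen R (\<zero> \<odot>\<^bsub>A\<^esub> \<zero>\<^bsub>A\<^esub>)) = \<zero> \<odot>\<^bsub>A\<^esub> \<psi> (free_gen R \<zero>\<^bsub>A\<^esub>)"
        by (rule psi_gen_smult[OF R.zero_closed z])
      then have "\<psi> (free_gen R \<zero>\<^bsub>A\<^esub>) = \<zero>\<^bsub>A\<^esub>"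
        using \<psi>.hom_closed[OF V.gen_closed[OF z]] by simp
      then show ?case using z \<psi>.hom_zero by metis
    qed
  qed
  show "grade A 1 \<subseteq> (\<lambda>v. \<psi> (free_gen R v)) ` grade A 1"
  proof
    fix x assume "x \<in> grade A 1"
    then have "x \<in> \<psi> ` grade V.F 1"
      by (simp only: quadratic_presentationD(3)[OF presentation])
    then obtain f where "f \<in> grade V.F 1" "x = \<psi> f" by (rule imageE) auto
    then show "x \<in> (\<lambda>v. \<psi> (free_gen R v)) ` grade A 1" using * by blast
  qed
qed

end

section \<open>Directed unions of quadratic algebras\<close>

lemma directed_finite_bound:
  assumes "directed_on I r" "finite S" "S \<subseteq> I"
  obtains k where "k \<in> I" "\<And>i. i \<in> S \<Longrightarrow> (i, k) \<in> r"
proof -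
  have refl: "(i, i) \<in> r" if "i \<in> I" for i
    using assms(1) that by (auto simp: directed_on_def preorder_on_def refl_on_def)
  have tr: "trans r" using assms(1) by (auto simp: directed_on_def preorder_on_def)
  have "\<exists>k\<in>I. \<forall>i\<in>S. (i, k) \<in> r"
    using assms(2,3)
  proof (induction S)
    case empty then show ?case using assms(1) by (auto simp: directed_on_def)
  next
    case (insert a S)
    then obtain k where k: "k \<in> I" "\<forall>i\<in>S. (i, k) \<in> r" by blast
    then obtain l where "l \<in> I" "(a, l) \<in> r" "(k, l) \<in> r"
      using assms(1) insert.prems unfolding directed_on_def by blast
    moreover then have "(i, l) \<in> r" if "i \<in> S" for i
      using k(2) that by (meson transD[OF tr])
    ultimately show ?case by blast
  qed
  then show ?thesis using that by blast
qed

text \<open>\<open>A\<close> is a bare structure here: that it is an algebra will be inferred from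
  the members. Monotonicity is expressed through the images of the maps \<open>lam i\<close>, so
  that no transition maps have to be carried along.\<close>

locale algebra_directed_union =
  fixes R :: "('r, 'c) ring_scheme" (structure)
    and A :: "('r, 'a, 'd) graded_algebra_scheme"
    and I :: "'i set" and r :: "'i rel"
    and B :: "'i \<Rightarrow> ('r, 'b, 'e) graded_algebra_scheme" and lam :: "'i \<Rightarrow> 'b \<Rightarrow> 'a"
  assumes directed: "directed_on I r"
    and connected: "i \<in> I \<Longrightarrow> connected_graded_algebra R (B i)"
    and lam_closed: "\<lbrakk>i \<in> I; x \<in> carrier (B i)\<rbrakk> \<Longrightarrow> lam i x \<in> carrier A"
    and lam_add: "\<lbrakk>i \<in> I; x \<in> carrier (B i); y \<in> carrier (B i)\<rbrakk> \<Longrightarrow>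
      lam i (x \<oplus>\<^bsub>B i\<^esub> y) = lam i x \<oplus>\<^bsub>A\<^esub> lam i y"
    and lam_mult: "\<lbrakk>i \<in> I; x \<in> carrier (B i); y \<in> carrier (B i)\<rbrakk> \<Longrightarrow>
      lam i (x \<otimes>\<^bsub>B i\<^esub> y) = lam i x \<otimes>\<^bsub>A\<^esub> lam i y"
    and lam_smult: "\<lbrakk>i \<in> I; s \<in> carrier R; x \<in> carrier (B i)\<rbrakk> \<Longrightarrow>
      lam i (s \<odot>\<^bsub>B i\<^esub> x) = s \<odot>\<^bsub>A\<^esub> lam i x"
    and lam_one: "i \<in> I \<Longrightarrow> lam i \<one>\<^bsub>B i\<^esub> = \<one>\<^bsub>A\<^esub>"
    and lam_zero: "i \<in> I \<Longrightarrow> lam i \<zero>\<^bsub>B i\<^esub> = \<zero>\<^bsub>A\<^esub>"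
    and lam_inj: "i \<in> I \<Longrightarrow> inj_on (lam i) (carrier (B i))"
    and lam_mono: "(i, j) \<in> r \<Longrightarrow> lam i ` carrier (B i) \<subseteq> lam j ` carrier (B j)"
    and lam_mono_grade: "(i, j) \<in> r \<Longrightarrow> lam i ` grade (B i) n \<subseteq> lam j ` grade (B j) n"
    and carrier_eq: "carrier A = (\<Union>i\<in>I. lam i ` carrier (B i))"
    and grade_eq: "grade A n = (\<Union>i\<in>I. lam i ` grade (B i) n)"
begin

section \<open>The graded algebra structure of the union\<close>

lemma B_graded: "i \<in> I \<Longrightarrow> graded_algebra R (B i)"
  using connected unfolding connected_graded_algebra_def by blast

lemma obtain_preimages:
  assumes "finite X" "X \<subseteq> carrier A"
  obtains i where "i \<in> I" "X \<subseteq> lam i ` carrier (B i)"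
proof -
  have "\<forall>x\<in>X. \<exists>i\<in>I. x \<in> lam i ` carrier (B i)" using assms(2) carrier_eq by blast
  then obtain f where f: "\<And>x. x \<in> X \<Longrightarrow> f x \<in> I \<and> x \<in> lam (f x) ` carrier (B (f x))" by metis
  obtain k where k: "k \<in> I" "\<And>i. i \<in> f ` X \<Longrightarrow> (i, k) \<in> r"
    by (rule directed_finite_bound[OF directed, of "f ` X"]) (use assms(1) f in blast)+
  have "X \<subseteq> lam k ` carrier (B k)"
  proof
    fix x assume "x \<in> X"
    then show "x \<in> lam k ` carrier (B k)" using f[of x] lam_mono[OF k(2)[of "f x"]] by blast
  qed
  then show ?thesis by (rule that[OF k(1)])
qed

text \<open>An axiom of an algebra involves at most three elements, so a single member contains all
  that is needed to verify it.\<close>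

lemma obtain3:
  assumes "a \<in> carrier A" "b \<in> carrier A" "c \<in> carrier A"
  obtains i x y z where "i \<in> I" "x \<in> carrier (B i)" "y \<in> carrier (B i)" "z \<in> carrier (B i)"
    "a = lam i x" "b = lam i y" "c = lam i z"
proof -
  obtain i where "i \<in> I" "{a, b, c} \<subseteq> lam i ` carrier (B i)"
    by (rule obtain_preimages[of "{a, b, c}"]) (use assms in auto)
  moreover then obtain x y z where "x \<in> carrier (B i)" "a = lam i x" "y \<in> carrier (B i)" "b = lam i y"
    "z \<in> carrier (B i)" "c = lam i z" by (auto elim!: imageE)
  ultimately show ?thesis by (intro that)
qed

lemma grade_subset: "grade A n \<subseteq> carrier A"
  unfolding grade_eq carrier_eq using graded_algebra.grade_subset[OF B_graded] by blast

lemma obtain2_grade: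
  assumes "a \<in> grade A m" "b \<in> grade A n"
  obtains i x y where "i \<in> I" "x \<in> grade (B i) m" "y \<in> grade (B i) n"
    "a = lam i x" "b = lam i y"
proof -
  obtain i j where ij: "i \<in> I" "j \<in> I" "a \<in> lam i ` grade (B i) m" "b \<in> lam j ` grade (B j) n"
    using assms grade_eq by blast
  obtain k where k: "k \<in> I" "(i, k) \<in> r" "(j, k) \<in> r"
    using directed ij(1,2) unfolding directed_on_def by blast
  show ?thesis using that[OF k(1)] lam_mono_grade[OF k(2), of m] lam_mono_grade[OF k(3), of n] ij(3,4)
    by blast
qed

lemma R_cring: "cring R"
proof -
  obtain i where "i \<in> I" using directed unfolding directed_on_def by blast
  then interpret graded_algebra R "B i" by (rule B_graded)
  show ?thesis by (rule R.is_cring)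
qed

lemma zero_closed: "\<zero>\<^bsub>A\<^esub> \<in> carrier A" and one_closed: "\<one>\<^bsub>A\<^esub> \<in> carrier A"
proof -
  obtain i where i: "i \<in> I" using directed unfolding directed_on_def by blast
  interpret graded_algebra R "B i" by (rule B_graded[OF i])
  show "\<zero>\<^bsub>A\<^esub> \<in> carrier A" using lam_closed[OF i, of "\<zero>\<^bsub>B i\<^esub>"] by (simp add: lam_zero[OF i])
  show "\<one>\<^bsub>A\<^esub> \<in> carrier A" using lam_closed[OF i, of "\<one>\<^bsub>B i\<^esub>"] by (simp add: lam_one[OF i])
qed

lemma operations_closed:
  assumes "a \<in> carrier A" "b \<in> carrier A"
  shows "a \<oplus>\<^bsub>A\<^esub> b \<in> carrier A" "a \<otimes>\<^bsub>A\<^esub> b \<in> carrier A"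
    "s \<in> carrier R \<Longrightarrow> s \<odot>\<^bsub>A\<^esub> a \<in> carrier A"
proof -
  obtain i x y z where i: "i \<in> I" "x \<in> carrier (B i)" "y \<in> carrier (B i)" "z \<in> carrier (B i)"
    and eq: "a = lam i x" "b = lam i y" by (rule obtain3[OF assms assms(1)])
  interpret graded_algebra R "B i" by (rule B_graded[OF i(1)])
  show "a \<oplus>\<^bsub>A\<^esub> b \<in> carrier A" "a \<otimes>\<^bsub>A\<^esub> b \<in> carrier A"
    "s \<in> carrier R \<Longrightarrow> s \<odot>\<^bsub>A\<^esub> a \<in> carrier A"
    unfolding eq using i
    by (simp_all add: lam_add[symmetric] lam_mult[symmetric] lam_smult[symmetric] lam_closed)
qed

lemma laws:
  assumes "a \<in> carrier A" "b \<in> carrier A" "c \<in> carrier A"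
  shows "a \<oplus>\<^bsub>A\<^esub> b \<oplus>\<^bsub>A\<^esub> c = a \<oplus>\<^bsub>A\<^esub> (b \<oplus>\<^bsub>A\<^esub> c)"
    and "a \<oplus>\<^bsub>A\<^esub> b = b \<oplus>\<^bsub>A\<^esub> a"
    and "\<zero>\<^bsub>A\<^esub> \<oplus>\<^bsub>A\<^esub> a = a"
    and "\<exists>d\<in>carrier A. d \<oplus>\<^bsub>A\<^esub> a = \<zero>\<^bsub>A\<^esub>"
    and "a \<otimes>\<^bsub>A\<^esub> b \<otimes>\<^bsub>A\<^esub> c = a \<otimes>\<^bsub>A\<^esub> (b \<otimes>\<^bsub>A\<^esub> c)"
    and "\<one>\<^bsub>A\<^esub> \<otimes>\<^bsub>A\<^esub> a = a" and "a \<otimes>\<^bsub>A\<^esub> \<one>\<^bsub>A\<^esub> = a"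
    and "(a \<oplus>\<^bsub>A\<^esub> b) \<otimes>\<^bsub>A\<^esub> c = a \<otimes>\<^bsub>A\<^esub> c \<oplus>\<^bsub>A\<^esub> b \<otimes>\<^bsub>A\<^esub> c"
    and "c \<otimes>\<^bsub>A\<^esub> (a \<oplus>\<^bsub>A\<^esub> b) = c \<otimes>\<^bsub>A\<^esub> a \<oplus>\<^bsub>A\<^esub> c \<otimes>\<^bsub>A\<^esub> b"
    and "\<one> \<odot>\<^bsub>A\<^esub> a = a"
    and "s \<in> carrier R \<Longrightarrow> s \<odot>\<^bsub>A\<^esub> (a \<oplus>\<^bsub>A\<^esub> b) = s \<odot>\<^bsub>A\<^esub> a \<oplus>\<^bsub>A\<^esub> s \<odot>\<^bsub>A\<^esub> b"
    and "\<lbrakk>s \<in> carrier R; t \<in> carrier R\<rbrakk> \<Longrightarrow> (s \<oplus> t) \<odot>\<^bsub>A\<^esub> a = s \<odot>\<^bsub>A\<^esub> a \<oplus>\<^bsub>A\<^esub> t \<odot>\<^bsub>A\<^esub> a"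
    and "\<lbrakk>s \<in> carrier R; t \<in> carrier R\<rbrakk> \<Longrightarrow> (s \<otimes> t) \<odot>\<^bsub>A\<^esub> a = s \<odot>\<^bsub>A\<^esub> (t \<odot>\<^bsub>A\<^esub> a)"
    and "s \<in> carrier R \<Longrightarrow> (s \<odot>\<^bsub>A\<^esub> a) \<otimes>\<^bsub>A\<^esub> b = s \<odot>\<^bsub>A\<^esub> (a \<otimes>\<^bsub>A\<^esub> b)"
    and "s \<in> carrier R \<Longrightarrow> a \<otimes>\<^bsub>A\<^esub> (s \<odot>\<^bsub>A\<^esub> b) = s \<odot>\<^bsub>A\<^esub> (a \<otimes>\<^bsub>A\<^esub> b)"
proof -
  obtain i x y z where i: "i \<in> I" and c: "x \<in> carrier (B i)" "y \<in> carrier (B i)" "z \<in> carrier (B i)"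
    and eq: "a = lam i x" "b = lam i y" "c = lam i z" by (rule obtain3[OF assms])
  interpret graded_algebra R "B i" by (rule B_graded[OF i])
  interpret R: cring R by (rule R_cring)
  note simps = lam_add[OF i, symmetric] lam_mult[OF i, symmetric] lam_smult[OF i, symmetric]
    lam_one[OF i, symmetric] lam_zero[OF i, symmetric]
  show "a \<oplus>\<^bsub>A\<^esub> b \<oplus>\<^bsub>A\<^esub> c = a \<oplus>\<^bsub>A\<^esub> (b \<oplus>\<^bsub>A\<^esub> c)"
    unfolding eq using c by (simp add: simps M.a_assoc)
  show "a \<oplus>\<^bsub>A\<^esub> b = b \<oplus>\<^bsub>A\<^esub> a"
    unfolding eq using c M.a_comm[of x y] by (simp add: simps)
  show "\<zero>\<^bsub>A\<^esub> \<oplus>\<^bsub>A\<^esub> a = a" unfolding eq using c by (simp add: simps)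
  have "lam i (\<ominus>\<^bsub>B i\<^esub> x) \<oplus>\<^bsub>A\<^esub> a = \<zero>\<^bsub>A\<^esub>" unfolding eq using c by (simp add: simps M.l_neg)
  then show "\<exists>d\<in>carrier A. d \<oplus>\<^bsub>A\<^esub> a = \<zero>\<^bsub>A\<^esub>" using lam_closed[OF i M.a_inv_closed[OF c(1)]] by blast
  show "a \<otimes>\<^bsub>A\<^esub> b \<otimes>\<^bsub>A\<^esub> c = a \<otimes>\<^bsub>A\<^esub> (b \<otimes>\<^bsub>A\<^esub> c)" unfolding eq using c by (simp add: simps m_assoc)
  show "\<one>\<^bsub>A\<^esub> \<otimes>\<^bsub>A\<^esub> a = a" "a \<otimes>\<^bsub>A\<^esub> \<one>\<^bsub>A\<^esub> = a" unfolding eq using c by (simp_all add: simps)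
  show "(a \<oplus>\<^bsub>A\<^esub> b) \<otimes>\<^bsub>A\<^esub> c = a \<otimes>\<^bsub>A\<^esub> c \<oplus>\<^bsub>A\<^esub> b \<otimes>\<^bsub>A\<^esub> c" unfolding eq using c by (simp add: simps l_distr)
  show "c \<otimes>\<^bsub>A\<^esub> (a \<oplus>\<^bsub>A\<^esub> b) = c \<otimes>\<^bsub>A\<^esub> a \<oplus>\<^bsub>A\<^esub> c \<otimes>\<^bsub>A\<^esub> b" unfolding eq using c by (simp add: simps r_distr)
  show "\<one> \<odot>\<^bsub>A\<^esub> a = a" unfolding eq using c by (simp add: simps)
  show "s \<odot>\<^bsub>A\<^esub> (a \<oplus>\<^bsub>A\<^esub> b) = s \<odot>\<^bsub>A\<^esub> a \<oplus>\<^bsub>A\<^esub> s \<odot>\<^bsub>A\<^esub> b" if "s \<in> carrier R"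
    unfolding eq using c that by (simp add: simps smult_r_distr)
  show "(s \<oplus> t) \<odot>\<^bsub>A\<^esub> a = s \<odot>\<^bsub>A\<^esub> a \<oplus>\<^bsub>A\<^esub> t \<odot>\<^bsub>A\<^esub> a" if "s \<in> carrier R" "t \<in> carrier R"
    unfolding eq using c that by (simp add: simps smult_l_distr)
  show "(s \<otimes> t) \<odot>\<^bsub>A\<^esub> a = s \<odot>\<^bsub>A\<^esub> (t \<odot>\<^bsub>A\<^esub> a)" if "s \<in> carrier R" "t \<in> carrier R"
    unfolding eq using c that by (simp add: simps smult_assoc1)
  show "(s \<odot>\<^bsub>A\<^esub> a) \<otimes>\<^bsub>A\<^esub> b = s \<odot>\<^bsub>A\<^esub> (a \<otimes>\<^bsub>A\<^esub> b)" if "s \<in> carrier R"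
    unfolding eq using c that by (simp add: simps smult_mult_left)
  show "a \<otimes>\<^bsub>A\<^esub> (s \<odot>\<^bsub>A\<^esub> b) = s \<odot>\<^bsub>A\<^esub> (a \<otimes>\<^bsub>A\<^esub> b)" if "s \<in> carrier R"
    unfolding eq using c that by (simp add: simps smult_mult_right)
qed

text \<open>\<open>laws\<close> speaks about three elements at once; laws in fewer variables are
  recovered by filling the other places with zero.\<close>

lemmas unary_laws = laws(3,4,6,7,10,12,13)[OF _ zero_closed zero_closed]
lemmas binary_laws = laws(2,11,14,15)[OF _ _ zero_closed]
lemmas smult_closed = operations_closed(3)[OF _ zero_closed]

lemma abelian_group_A: "abelian_group A"
  by (rule abelian_groupI)
    (rule operations_closed(1) zero_closed laws(1) binary_laws(1) unary_laws(1,2) | assumption)+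

lemma ring_A: "ring A"
proof (rule ringI[OF abelian_group_A])
  show "monoid A"
    by (rule monoidI) (rule operations_closed(2) one_closed laws(5) unary_laws(3,4) | assumption)+
qed (rule laws(8,9) | assumption)+

lemma module_A: "module R A"
  by (rule moduleI[OF R_cring abelian_group_A])
    (rule smult_closed unary_laws(5-7) binary_laws(2) | assumption)+

lemma assoc_algebra_A: "assoc_algebra R A"
  by (intro assoc_algebra.intro assoc_algebra_axioms.intro)
    (rule module_A ring_A binary_laws(3,4) | assumption)+

lemma lam_hom: "i \<in> I \<Longrightarrow> ring_hom_ring (B i) A (lam i)"
proof -
  assume i: "i \<in> I"
  interpret graded_algebra R "B i" by (rule B_graded[OF i])
  have "lam i \<in> ring_hom (B i) A"
    by (rule ring_hom_memI) (rule lam_closed[OF i] lam_add[OF i] lam_mult[OF i] lam_one[OF i] | assumption)+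
  then show ?thesis by (rule ring_hom_ringI2[OF ring_axioms ring_A])
qed

lemma lam_finsum:
  assumes i: "i \<in> I" and "finite S" "\<And>n. n \<in> S \<Longrightarrow> h n \<in> carrier (B i)"
  shows "lam i (\<Oplus>\<^bsub>B i\<^esub>n\<in>S. h n) = (\<Oplus>\<^bsub>A\<^esub>n\<in>S. lam i (h n))"
proof -
  interpret graded_algebra R "B i" by (rule B_graded[OF i])
  interpret A: ring A by (rule ring_A)
  show ?thesis using assms(2,3)
  proof (induction S)
    case empty then show ?case by (simp add: lam_zero[OF i])
  next
    case (insert n S)
    then have "h n \<in> carrier (B i)" "h \<in> S \<rightarrow> carrier (B i)" by auto
    moreover from this have "(\<lambda>n. lam i (h n)) \<in> S \<rightarrow> carrier A" "lam i (h n) \<in> carrier A"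
      using lam_closed[OF i] by auto
    ultimately show ?case using insert by (simp add: M.finsum_insert A.finsum_insert lam_add[OF i])
  qed
qed

lemma grade_submodule: "submodule (grade A n) R A"
proof (rule module.submoduleI[OF module_A grade_subset])
  obtain i where i: "i \<in> I" using directed unfolding directed_on_def by blast
  interpret graded_algebra R "B i" by (rule B_graded[OF i])
  have "\<zero>\<^bsub>B i\<^esub> \<in> grade (B i) n"
    using subgroup.one_closed[OF submodule.axioms(1)[OF grade_submodule]] by simp
  then show "\<zero>\<^bsub>A\<^esub> \<in> grade A n" unfolding grade_eq lam_zero[OF i, symmetric] using i by blast
next
  fix a assume "a \<in> grade A n"
  then obtain i x where i: "i \<in> I" and x: "x \<in> grade (B i) n" "a = lam i x" using grade_eq by blast
  interpret graded_algebra R "B i" by (rule B_graded[OF i])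
  interpret l: ring_hom_ring "B i" A "lam i" by (rule lam_hom[OF i])
  have "\<ominus>\<^bsub>A\<^esub> a = lam i (\<ominus>\<^bsub>B i\<^esub> x)"
    using l.hom_a_inv[OF subsetD[OF grade_subset x(1)]] x(2) by simp
  then show "\<ominus>\<^bsub>A\<^esub> a \<in> grade A n"
    unfolding grade_eq using submoduleE(3)[OF grade_submodule x(1)] i by blast
next
  fix a b assume "a \<in> grade A n" "b \<in> grade A n"
  then obtain i x y where i: "i \<in> I" and xy: "x \<in> grade (B i) n" "y \<in> grade (B i) n"
    "a = lam i x" "b = lam i y" by (rule obtain2_grade)
  interpret graded_algebra R "B i" by (rule B_graded[OF i])
  have "a \<oplus>\<^bsub>A\<^esub> b = lam i (x \<oplus>\<^bsub>B i\<^esub> y)" unfolding xy(3,4)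
    by (rule lam_add[OF i, symmetric]) (use xy grade_subset in blast)+
  then show "a \<oplus>\<^bsub>A\<^esub> b \<in> grade A n"
    unfolding grade_eq using submoduleE(5)[OF grade_submodule xy(1,2)] i by blast
next
  fix s a assume s: "s \<in> carrier R" and "a \<in> grade A n"
  then obtain i x where i: "i \<in> I" and x: "x \<in> grade (B i) n" "a = lam i x" using grade_eq by blast
  interpret graded_algebra R "B i" by (rule B_graded[OF i])
  have "s \<odot>\<^bsub>A\<^esub> a = lam i (s \<odot>\<^bsub>B i\<^esub> x)" unfolding x(2)
    by (rule lam_smult[OF i s, symmetric]) (use x grade_subset in blast)+
  then show "s \<odot>\<^bsub>A\<^esub> a \<in> grade A n"
    unfolding grade_eq using submoduleE(4)[OF grade_submodule s x(1)] i by blast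
qed

text \<open>Only finitely many components are nonzero, so one index bounds all of theirs, while zero
  lifts to every member. The conclusion covers all later members in order that two decompositions
  can be compared in a common one.\<close>

lemma decomposition_lift:
  assumes h: "\<And>n. h n \<in> grade A n" "finite {n. h n \<noteq> \<zero>\<^bsub>A\<^esub>}"
  obtains i where "i \<in> I" "\<And>j. (i, j) \<in> r \<Longrightarrow> j \<in> I \<Longrightarrow> \<exists>k. \<forall>n. k n \<in> grade (B j) n \<and> h n = lam j (k n)"
proof -
  have "\<forall>n. \<exists>i\<in>I. h n \<in> lam i ` grade (B i) n" using h(1) grade_eq by blast
  then obtain f where f: "\<And>n. f n \<in> I" "\<And>n. h n \<in> lam (f n) ` grade (B (f n)) n" by metis
  obtain i where i: "i \<in> I" "\<And>k. k \<in> f ` {n. h n \<noteq> \<zero>\<^bsub>A\<^esub>} \<Longrightarrow> (k, i) \<in> r"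
    by (rule directed_finite_bound[OF directed, of "f ` {n. h n \<noteq> \<zero>\<^bsub>A\<^esub>}"]) (use h(2) f(1) in blast)+
  have tr: "trans r" using directed unfolding directed_on_def preorder_on_def by blast
  have "\<exists>k. \<forall>n. k n \<in> grade (B j) n \<and> h n = lam j (k n)" if j: "(i, j) \<in> r" "j \<in> I" for j
  proof -
    have "\<exists>x. x \<in> grade (B j) n \<and> h n = lam j x" for n
    proof (cases "h n = \<zero>\<^bsub>A\<^esub>")
      case True
      interpret graded_algebra R "B j" by (rule B_graded[OF j(2)])
      have "\<zero>\<^bsub>B j\<^esub> \<in> grade (B j) n"
        using subgroup.one_closed[OF submodule.axioms(1)[OF grade_submodule]] by simp
      then show ?thesis using True lam_zero[OF j(2)] by metis
    next
      case False
      then have "(f n, i) \<in> r" by (intro i(2)) simp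
      then have "(f n, j) \<in> r" using j(1) by (rule transD[OF tr])
      then have "h n \<in> lam j ` grade (B j) n" by (rule subsetD[OF lam_mono_grade f(2)])
      then show ?thesis by blast
    qed
    then show ?thesis by metis
  qed
  then show ?thesis by (rule that[OF i(1)])
qed

lemma lam_eq_zero_iff:
  assumes "i \<in> I" "x \<in> carrier (B i)"
  shows "lam i x = \<zero>\<^bsub>A\<^esub> \<longleftrightarrow> x = \<zero>\<^bsub>B i\<^esub>"
proof -
  interpret graded_algebra R "B i" by (rule B_graded[OF assms(1)])
  have "\<zero>\<^bsub>B i\<^esub> \<in> carrier (B i)" by simp
  then show ?thesis
    using inj_on_eq_iff[OF lam_inj[OF assms(1)] assms(2)] by (simp add: lam_zero[OF assms(1), symmetric])
qed

text \<open>Injectivity of \<open>lam i\<close> preserves the support exactly, so that the two sums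
  run over the same degrees.\<close>

lemma lam_decomposition:
  assumes i: "i \<in> I" and k: "\<And>n. k n \<in> grade (B i) n"
    and fin: "finite {n. lam i (k n) \<noteq> \<zero>\<^bsub>A\<^esub>}"
  shows "{n. lam i (k n) \<noteq> \<zero>\<^bsub>A\<^esub>} = {n. k n \<noteq> \<zero>\<^bsub>B i\<^esub>}"
    and "(\<Oplus>\<^bsub>A\<^esub>n\<in>{n. lam i (k n) \<noteq> \<zero>\<^bsub>A\<^esub>}. lam i (k n)) = lam i (\<Oplus>\<^bsub>B i\<^esub>n\<in>{n. k n \<noteq> \<zero>\<^bsub>B i\<^esub>}. k n)"
proof -
  interpret graded_algebra R "B i" by (rule B_graded[OF i])
  have kc: "k n \<in> carrier (B i)" for n using k grade_subset by blast
  show eq: "{n. lam i (k n) \<noteq> \<zero>\<^bsub>A\<^esub>} = {n. k n \<noteq> \<zero>\<^bsub>B i\<^esub>}" using lam_eq_zero_iff[OF i kc] by blast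
  show "(\<Oplus>\<^bsub>A\<^esub>n\<in>{n. lam i (k n) \<noteq> \<zero>\<^bsub>A\<^esub>}. lam i (k n)) = lam i (\<Oplus>\<^bsub>B i\<^esub>n\<in>{n. k n \<noteq> \<zero>\<^bsub>B i\<^esub>}. k n)"
    using fin kc unfolding eq by (intro lam_finsum[OF i, symmetric]) auto
qed

text \<open>A decomposition is pushed forward from a member containing \<open>a\<close>. For
  uniqueness, two decompositions are pulled back to a common member; their sums have the same image
  there, hence are equal, and uniqueness in that member applies.\<close>

lemma grade_direct_sum:
  assumes a: "a \<in> carrier A"
  shows "\<exists>!h. (\<forall>n. h n \<in> grade A n) \<and> finite {n. h n \<noteq> \<zero>\<^bsub>A\<^esub>}
    \<and> a = (\<Oplus>\<^bsub>A\<^esub>n\<in>{n. h n \<noteq> \<zero>\<^bsub>A\<^esub>}. h n)"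
proof (rule ex_ex1I)
  obtain i x where i: "i \<in> I" and x: "x \<in> carrier (B i)" "a = lam i x" using a carrier_eq by blast
  interpret graded_algebra R "B i" by (rule B_graded[OF i])
  obtain k where k: "\<And>n. k n \<in> grade (B i) n" "finite {n. k n \<noteq> \<zero>\<^bsub>B i\<^esub>}"
    "x = (\<Oplus>\<^bsub>B i\<^esub>n\<in>{n. k n \<noteq> \<zero>\<^bsub>B i\<^esub>}. k n)"
    using grade_direct_sum[OF x(1)] by blast
  have kc: "k n \<in> carrier (B i)" for n using k(1) grade_subset by blast
  have fin: "finite {n. lam i (k n) \<noteq> \<zero>\<^bsub>A\<^esub>}" using k(2) lam_eq_zero_iff[OF i kc] by simp
  have "\<forall>n. lam i (k n) \<in> grade A n" unfolding grade_eq using k(1) i by blast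
  moreover have "a = (\<Oplus>\<^bsub>A\<^esub>n\<in>{n. lam i (k n) \<noteq> \<zero>\<^bsub>A\<^esub>}. lam i (k n))"
    unfolding lam_decomposition(2)[OF i k(1) fin] k(3)[symmetric] x(2) ..
  ultimately show "\<exists>h. (\<forall>n. h n \<in> grade A n) \<and> finite {n. h n \<noteq> \<zero>\<^bsub>A\<^esub>}
    \<and> a = (\<Oplus>\<^bsub>A\<^esub>n\<in>{n. h n \<noteq> \<zero>\<^bsub>A\<^esub>}. h n)" using fin by (intro exI[of _ "\<lambda>n. lam i (k n)"]) blast
next
  fix h h' assume h: "(\<forall>n. h n \<in> grade A n) \<and> finite {n. h n \<noteq> \<zero>\<^bsub>A\<^esub>} \<and> a = (\<Oplus>\<^bsub>A\<^esub>n\<in>{n. h n \<noteq> \<zero>\<^bsub>A\<^esub>}. h n)"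
    and h': "(\<forall>n. h' n \<in> grade A n) \<and> finite {n. h' n \<noteq> \<zero>\<^bsub>A\<^esub>} \<and> a = (\<Oplus>\<^bsub>A\<^esub>n\<in>{n. h' n \<noteq> \<zero>\<^bsub>A\<^esub>}. h' n)"
  obtain i where i: "i \<in> I"
    "\<And>j. (i, j) \<in> r \<Longrightarrow> j \<in> I \<Longrightarrow> \<exists>k. \<forall>n. k n \<in> grade (B j) n \<and> h n = lam j (k n)"
    by (rule decomposition_lift[of h]) (use h in auto)
  obtain i' where i': "i' \<in> I"
    "\<And>j. (i', j) \<in> r \<Longrightarrow> j \<in> I \<Longrightarrow> \<exists>k. \<forall>n. k n \<in> grade (B j) n \<and> h' n = lam j (k n)"
    by (rule decomposition_lift[of h']) (use h' in auto)
  obtain j where j: "j \<in> I" "(i, j) \<in> r" "(i', j) \<in> r"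
    using directed i(1) i'(1) unfolding directed_on_def by blast
  obtain k where k: "\<And>n. k n \<in> grade (B j) n" "h = (\<lambda>n. lam j (k n))" using i(2)[OF j(2,1)] by blast
  obtain k' where k': "\<And>n. k' n \<in> grade (B j) n" "h' = (\<lambda>n. lam j (k' n))" using i'(2)[OF j(3,1)] by blast
  interpret graded_algebra R "B j" by (rule B_graded[OF j(1)])
  have kc: "k n \<in> carrier (B j)" "k' n \<in> carrier (B j)" for n using k(1) k'(1) grade_subset by blast+
  have f: "finite {n. lam j (k n) \<noteq> \<zero>\<^bsub>A\<^esub>}" "finite {n. lam j (k' n) \<noteq> \<zero>\<^bsub>A\<^esub>}"
    using h h' unfolding k(2) k'(2) by blast+
  note d = lam_decomposition[OF j(1) k(1) f(1)] and d' = lam_decomposition[OF j(1) k'(1) f(2)]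
  let ?s = "\<Oplus>\<^bsub>B j\<^esub>n\<in>{n. k n \<noteq> \<zero>\<^bsub>B j\<^esub>}. k n" and ?s' = "\<Oplus>\<^bsub>B j\<^esub>n\<in>{n. k' n \<noteq> \<zero>\<^bsub>B j\<^esub>}. k' n"
  have sc: "?s \<in> carrier (B j)" "?s' \<in> carrier (B j)" using kc by (auto intro!: M.finsum_closed)
  have "lam j ?s = a" "lam j ?s' = a" using h h' unfolding d(2)[symmetric] d'(2)[symmetric] k(2) k'(2) by auto
  then have "lam j ?s = lam j ?s'" by simp
  then have "?s = ?s'" by (rule inj_onD[OF lam_inj[OF j(1)] _ sc])
  then have "k = k'" using grade_direct_sum[OF sc(1)] k(1) k'(1) f unfolding d(1) d'(1) by blast
  then show "h = h'" unfolding k(2) k'(2) by simp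
qed

lemma graded_algebra_A: "graded_algebra R A"
proof (intro graded_algebra.intro graded_algebra_axioms.intro)
  obtain i where i: "i \<in> I" using directed unfolding directed_on_def by blast
  interpret graded_algebra R "B i" by (rule B_graded[OF i])
  show "\<one>\<^bsub>A\<^esub> \<in> grade A 0" unfolding grade_eq lam_one[OF i, symmetric] using grade_one i by blast
next
  fix a b m n assume "a \<in> grade A m" "b \<in> grade A n"
  then obtain i x y where i: "i \<in> I" and xy: "x \<in> grade (B i) m" "y \<in> grade (B i) n"
    "a = lam i x" "b = lam i y" by (rule obtain2_grade)
  interpret graded_algebra R "B i" by (rule B_graded[OF i])
  have "a \<otimes>\<^bsub>A\<^esub> b = lam i (x \<otimes>\<^bsub>B i\<^esub> y)" unfolding xy(3,4)
    by (rule lam_mult[OF i, symmetric]) (use xy grade_subset in blast)+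
  then show "a \<otimes>\<^bsub>A\<^esub> b \<in> grade A (m + n)" unfolding grade_eq using grade_mult[OF xy(1,2)] i by blast
qed (rule module_A ring_A binary_laws(3,4) grade_submodule grade_direct_sum | assumption)+

text \<open>The members all have the same degree 0 inside \<open>A\<close>, namely the scalar
  multiples of the unit.\<close>

lemma connected_A: "connected_graded_algebra R A"
  unfolding connected_graded_algebra_def
proof (rule conjI[OF graded_algebra_A])
  have R: "s \<odot>\<^bsub>A\<^esub> \<one>\<^bsub>A\<^esub> = lam i (s \<odot>\<^bsub>B i\<^esub> \<one>\<^bsub>B i\<^esub>)" if "i \<in> I" "s \<in> carrier R" for i s
  proof -
    interpret graded_algebra R "B i" by (rule B_graded[OF that(1)])
    show ?thesis using that by (simp add: lam_smult lam_one)
  qed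
  obtain i where i: "i \<in> I" using directed unfolding directed_on_def by blast
  interpret graded_algebra R "B i" by (rule B_graded[OF i])
  have b: "bij_betw (\<lambda>s. s \<odot>\<^bsub>B i\<^esub> \<one>\<^bsub>B i\<^esub>) (carrier R) (grade (B i) 0)" if "i \<in> I" for i
    using connected[OF that] unfolding connected_graded_algebra_def by blast
  have inj: "inj_on (\<lambda>s. s \<odot>\<^bsub>A\<^esub> \<one>\<^bsub>A\<^esub>) (carrier R)"
  proof (rule inj_onI)
    fix s t assume st: "s \<in> carrier R" "t \<in> carrier R" "s \<odot>\<^bsub>A\<^esub> \<one>\<^bsub>A\<^esub> = t \<odot>\<^bsub>A\<^esub> \<one>\<^bsub>A\<^esub>"
    then have "s \<odot>\<^bsub>B i\<^esub> \<one>\<^bsub>B i\<^esub> = t \<odot>\<^bsub>B i\<^esub> \<one>\<^bsub>B i\<^esub>"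
      using R[OF i] inj_onD[OF lam_inj[OF i]] by simp
    then show "s = t" by (rule inj_onD[OF bij_betw_imp_inj_on[OF b[OF i]] _ st(1,2)])
  qed
  have "lam i ` grade (B i) 0 = (\<lambda>s. s \<odot>\<^bsub>A\<^esub> \<one>\<^bsub>A\<^esub>) ` carrier R" if "i \<in> I" for i
    unfolding bij_betw_imp_surj_on[OF b[OF that], symmetric] image_image
    by (rule image_cong[OF refl]) (rule R[OF that, symmetric])
  then have "grade A 0 = (\<Union>i\<in>I. (\<lambda>s. s \<odot>\<^bsub>A\<^esub> \<one>\<^bsub>A\<^esub>) ` carrier R)"
    unfolding grade_eq by (rule SUP_cong[OF refl])
  then have "grade A 0 = (\<lambda>s. s \<odot>\<^bsub>A\<^esub> \<one>\<^bsub>A\<^esub>) ` carrier R" using i by auto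
  then show "bij_betw (\<lambda>s. s \<odot>\<^bsub>A\<^esub> \<one>\<^bsub>A\<^esub>) (carrier R) (grade A 0)"
    using inj by (simp add: bij_betw_def)
qed

end

section \<open>A quadratic presentation of the union\<close>

locale quadratic_directed_union = algebra_directed_union R A I r B lam
  for R :: "('r, 'c) ring_scheme" (structure)
    and A :: "('r, 'a, 'd) graded_algebra_scheme"
    and I :: "'i set" and r :: "'i rel"
    and B :: "'i \<Rightarrow> ('r, 'b, 'e) graded_algebra_scheme" and lam :: "'i \<Rightarrow> 'b \<Rightarrow> 'a" +
  fixes S :: "'i \<Rightarrow> ('b list \<Rightarrow> 'r) set" and \<psi> :: "'i \<Rightarrow> ('b list \<Rightarrow> 'r) \<Rightarrow> 'b"
  assumes presentation: "i \<in> I \<Longrightarrow> quadratic_presentation R (B i) (S i) (\<psi> i)"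
begin

sublocale A: graded_algebra R A by (rule graded_algebra_A)

sublocale V: free_algebra_on R "grade A 1" ..

sublocale \<epsilon>: free_algebra_eval R "grade A 1" A "\<lambda>v. v"
proof -
  interpret assoc_algebra R A by (rule assoc_algebra_A)
  show "free_algebra_eval R (grade A 1) A (\<lambda>v. v)" by unfold_locales (use grade_subset in blast)
qed

text \<open>Not simply \<open>lam i v\<close>: the presentation \<open>\<psi> i\<close> may act on
  degree 1 by a nontrivial linear map, and including this twist is what makes
  \<open>eps_sigma\<close> true on generators.\<close>

definition w :: "'i \<Rightarrow> 'b \<Rightarrow> 'a" where "w i v = lam i (\<psi> i (free_gen R v))"

definition \<sigma> where "\<sigma> i = free_algebra_eval.ev R V.F (\<lambda>v. free_gen R (w i v))"

lemma presented: "i \<in> I \<Longrightarrow> presented_algebra R (B i) (S i) (\<psi> i)"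
  using B_graded presentation by (simp add: presented_algebra_def presented_algebra_axioms_def)

text \<open>By \<open>grade_one_eq\<close> the twist maps degree 1 of the member onto itself, so it
  does not change which letters of \<open>A\<close> can be reached.\<close>

lemma w_image: "i \<in> I \<Longrightarrow> w i ` grade (B i) 1 = lam i ` grade (B i) 1"
proof -
  assume i: "i \<in> I"
  interpret P: presented_algebra R "B i" "S i" "\<psi> i" by (rule presented[OF i])
  have "w i ` grade (B i) 1 = lam i ` ((\<lambda>v. \<psi> i (free_gen R v)) ` grade (B i) 1)"
    unfolding w_def image_image ..
  then show ?thesis by (simp only: P.grade_one_eq[symmetric])
qed

lemma w_closed: "\<lbrakk>i \<in> I; v \<in> grade (B i) 1\<rbrakk> \<Longrightarrow> w i v \<in> grade A 1"
  unfolding grade_eq using w_image by blast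

lemma w_eval: "i \<in> I \<Longrightarrow> free_algebra_eval R (grade (B i) 1) V.F (\<lambda>v. free_gen R (w i v))"
proof -
  assume i: "i \<in> I"
  interpret assoc_algebra R V.F by (rule V.assoc_algebra_F)
  show ?thesis by unfold_locales (rule V.gen_closed[OF w_closed[OF i]])
qed

text \<open>Both sides are linear homomorphisms on the free algebra of the member, and
  \<open>w\<close> was chosen so that they agree on generators.\<close>

lemma eps_sigma:
  assumes i: "i \<in> I" and f: "f \<in> carrier (free_algebra R (grade (B i) 1))"
  shows "\<epsilon>.ev (\<sigma> i f) = lam i (\<psi> i f)"
proof -
  interpret P: presented_algebra R "B i" "S i" "\<psi> i" by (rule presented[OF i])
  interpret s: free_algebra_eval R "grade (B i) 1" V.F "\<lambda>v. free_gen R (w i v)" by (rule w_eval[OF i])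
  interpret l: ring_hom_ring "B i" A "lam i" by (rule lam_hom[OF i])
  interpret e: ring_hom_ring V.F A "\<epsilon>.ev" by (rule \<epsilon>.ev_hom)
  interpret sh: ring_hom_ring P.V.F V.F "\<sigma> i" unfolding \<sigma>_def by (rule s.ev_hom)
  have 1: "ring_hom_ring P.V.F A (\<lambda>f. \<epsilon>.ev (\<sigma> i f))"
    using ring_hom_trans[OF sh.homh e.homh] unfolding comp_def
    by (rule ring_hom_ringI2[OF P.V.ring_F ring_A])
  have 2: "ring_hom_ring P.V.F A (\<lambda>f. lam i (\<psi> i f))"
    using ring_hom_trans[OF P.\<psi>.homh l.homh] unfolding comp_def
    by (rule ring_hom_ringI2[OF P.V.ring_F ring_A])
  show ?thesis
  proof (rule P.V.hom_unique[OF 1 _ 2 _ _ f])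
    fix s f assume s: "s \<in> carrier R" and f: "f \<in> carrier P.V.F"
    show "\<epsilon>.ev (\<sigma> i (s \<odot>\<^bsub>P.V.F\<^esub> f)) = s \<odot>\<^bsub>A\<^esub> \<epsilon>.ev (\<sigma> i f)"
      unfolding \<sigma>_def s.ev_smult[OF s f] by (rule \<epsilon>.ev_smult[OF s s.ev_closed[OF f]])
    show "lam i (\<psi> i (s \<odot>\<^bsub>P.V.F\<^esub> f)) = s \<odot>\<^bsub>A\<^esub> lam i (\<psi> i f)"
      unfolding P.linear[OF s f] by (rule lam_smult[OF i s P.\<psi>.hom_closed[OF f]])
  next
    fix v assume v: "v \<in> grade (B i) 1"
    show "\<epsilon>.ev (\<sigma> i (free_gen R v)) = lam i (\<psi> i (free_gen R v))"
      unfolding \<sigma>_def s.ev_gen[OF v] \<epsilon>.ev_gen[OF w_closed[OF i v]] by (rule w_def)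
  qed
qed

lemma sigma_mon:
  assumes i: "i \<in> I" and s: "s \<in> carrier R" and u: "u \<in> lists (grade (B i) 1)"
  shows "\<sigma> i (free_algebra_on.mon R s u) = V.mon s (map (w i) u)"
proof -
  interpret P: presented_algebra R "B i" "S i" "\<psi> i" by (rule presented[OF i])
  interpret s: free_algebra_eval R "grade (B i) 1" V.F "\<lambda>v. free_gen R (w i v)" by (rule w_eval[OF i])
  have word: "s.word u = V.mon \<one> (map (w i) u)" using u
  proof (induction u)
    case Nil then show ?case unfolding s.word_def by (simp add: V.F_simps(2))
  next
    case (Cons v u)
    have "s.word (v # u) = V.mon \<one> [w i v] \<otimes>\<^bsub>V.F\<^esub> s.word u"
      unfolding s.word_def by (simp add: V.free_gen_eq)
    then show ?case using Cons by (simp add: V.mult_mon)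
  qed
  have "\<sigma> i (P.V.mon s u) = s \<odot>\<^bsub>V.F\<^esub> V.mon \<one> (map (w i) u)"
    unfolding \<sigma>_def s.ev_mon[OF s u] word ..
  then show ?thesis using s by (simp add: V.smult_mon)
qed

text \<open>Words are translated letter by letter (\<open>sigma_mon\<close>), so their length is
  preserved.\<close>

lemma sigma_grade:
  assumes i: "i \<in> I" and x: "x \<in> grade (free_algebra R (grade (B i) 1)) n"
  shows "\<sigma> i x \<in> grade V.F n"
proof -
  interpret P: presented_algebra R "B i" "S i" "\<psi> i" by (rule presented[OF i])
  interpret s: free_algebra_eval R "grade (B i) 1" V.F "\<lambda>v. free_gen R (w i v)" by (rule w_eval[OF i])
  interpret sh: ring_hom_ring P.V.F V.F "\<sigma> i" unfolding \<sigma>_def by (rule s.ev_hom)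
  have "x \<in> carrier P.V.F" "{u. x u \<noteq> \<zero>} \<subseteq> {u. length u = n}"
    using x unfolding P.V.grade_iff by auto
  then show ?thesis
  proof (induction rule: P.V.monomial_induct)
    case (mon r u)
    have "map (w i) u \<in> lists (grade A 1)" using mon(3) w_closed[OF i] by auto
    then show ?case
      using V.mon_closed[OF mon(1)] mon(2) unfolding sigma_mon[OF i mon(1,3)] V.grade_iff
      by (auto simp: V.mon_def)
  next
    case (add f g)
    then show ?case using V.add_closed unfolding sh.hom_add[OF add(1,2)] V.grade_iff V.F_simps(3) by simp
  next
    case zero
    then show ?case using V.FA.zero_closed unfolding sh.hom_zero V.grade_iff V.F_simps(1) by simp
  qed
qed

text \<open>Each monomial is lifted by choosing preimages of its letters under \<open>w i\<close>.
  Such a lift is not canonical, but the set \<open>N\<close> of admissible lengths ensures that a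
  homogeneous element has a homogeneous lift.\<close>

lemma sigma_lift:
  assumes i: "i \<in> I" and f: "f \<in> carrier V.F"
    and supp: "{u. f u \<noteq> \<zero>} \<subseteq> {u \<in> lists (lam i ` grade (B i) 1). length u \<in> N}"
  shows "\<exists>b\<in>carrier (free_algebra R (grade (B i) 1)).
    \<sigma> i b = f \<and> (\<forall>u. length u \<notin> N \<longrightarrow> b u = \<zero>)"
proof -
  interpret P: presented_algebra R "B i" "S i" "\<psi> i" by (rule presented[OF i])
  interpret s: free_algebra_eval R "grade (B i) 1" V.F "\<lambda>v. free_gen R (w i v)" by (rule w_eval[OF i])
  interpret sh: ring_hom_ring P.V.F V.F "\<sigma> i" unfolding \<sigma>_def by (rule s.ev_hom)
  show ?thesis using f supp
  proof (induction rule: V.monomial_induct)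
    case (mon r u)
    then have "u \<in> lists (w i ` grade (B i) 1)" unfolding w_image[OF i] by blast
    then obtain u' where u': "u' \<in> lists (grade (B i) 1)" "u = map (w i) u'"
      unfolding lists_image by blast
    have "\<sigma> i (P.V.mon r u') = V.mon r u" unfolding u'(2) by (rule sigma_mon[OF i mon(1) u'(1)])
    moreover have "length u' \<in> N" using mon(2) u'(2) by auto
    ultimately show ?case using P.V.mon_closed[OF mon(1) u'(1)]
      by (intro bexI[of _ "P.V.mon r u'"]) (auto simp: P.V.mon_def)
  next
    case (add f g)
    then obtain b c where bc: "b \<in> carrier P.V.F" "c \<in> carrier P.V.F" "\<sigma> i b = f" "\<sigma> i c = g"
      "\<forall>u. length u \<notin> N \<longrightarrow> b u = \<zero>" "\<forall>u. length u \<notin> N \<longrightarrow> c u = \<zero>" by blast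
    have "\<sigma> i (b \<oplus>\<^bsub>P.V.F\<^esub> c) = f \<oplus>\<^bsub>V.F\<^esub> g" unfolding sh.hom_add[OF bc(1,2)] bc(3,4) ..
    moreover have "\<forall>u. length u \<notin> N \<longrightarrow> (b \<oplus>\<^bsub>P.V.F\<^esub> c) u = \<zero>" using bc(5,6) unfolding P.V.F_simps(3) by simp
    ultimately show ?case using P.V.add_closed[OF bc(1,2)] by blast
  next
    case zero
    have "\<zero>\<^bsub>P.V.F\<^esub> \<in> carrier P.V.F" "\<forall>u. length u \<notin> N \<longrightarrow> \<zero>\<^bsub>P.V.F\<^esub> u = \<zero>"
      by (rule P.V.FA.zero_closed) (simp add: P.V.F_simps(1))
    then show ?case using sh.hom_zero by blast
  qed
qed

text \<open>Only finitely many letters occur in \<open>f\<close>, so one member contains all of them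
  in degree 1.\<close>

lemma obtain_sigma:
  assumes f: "f \<in> carrier V.F"
  obtains i b where "i \<in> I" "b \<in> carrier (free_algebra R (grade (B i) 1))" "\<sigma> i b = f"
    "\<forall>n. f \<in> grade V.F n \<longrightarrow> b \<in> grade (free_algebra R (grade (B i) 1)) n"
proof -
  define X where "X = (\<Union>u\<in>{u. f u \<noteq> \<zero>}. set u)"
  have X: "finite X" "X \<subseteq> grade A 1"
    unfolding X_def using V.supp_finite[OF f] V.supp_lists[OF f] by auto
  have "\<forall>x\<in>X. \<exists>i\<in>I. x \<in> lam i ` grade (B i) 1" using X(2) grade_eq by blast
  then obtain c where c: "\<And>x. x \<in> X \<Longrightarrow> c x \<in> I \<and> x \<in> lam (c x) ` grade (B (c x)) 1" by metis
  obtain i where i: "i \<in> I" "\<And>k. k \<in> c ` X \<Longrightarrow> (k, i) \<in> r"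
    by (rule directed_finite_bound[OF directed, of "c ` X"]) (use X(1) c in blast)+
  have Xi: "X \<subseteq> lam i ` grade (B i) 1"
  proof
    fix x assume x: "x \<in> X"
    show "x \<in> lam i ` grade (B i) 1"
      by (rule subsetD[OF lam_mono_grade[OF i(2)]]) (use c[OF x] x in blast)+
  qed
  interpret P: presented_algebra R "B i" "S i" "\<psi> i" by (rule presented[OF i(1)])
  \<comment> \<open>The lengths that occur in \<open>f\<close>; if \<open>f\<close> is homogeneous
    of degree \<open>n\<close>, no length other than \<open>n\<close> is among them, and the lift
    inherits this.\<close>
  let ?N = "length ` {u. f u \<noteq> \<zero>}"
  have supp: "{u. f u \<noteq> \<zero>} \<subseteq> {u \<in> lists (lam i ` grade (B i) 1). length u \<in> ?N}"
    using Xi unfolding X_def by (auto simp: lists_eq_set)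
  obtain b where b: "b \<in> carrier P.V.F" "\<sigma> i b = f" "\<And>u. length u \<notin> ?N \<Longrightarrow> b u = \<zero>"
    using sigma_lift[OF i(1) f supp] by blast
  have "b \<in> grade P.V.F n" if "f \<in> grade V.F n" for n
    unfolding P.V.grade_iff
  proof (intro conjI allI impI)
    fix u :: "'b list" assume "length u \<noteq> n"
    then have "length u \<notin> ?N" using that unfolding V.grade_iff by auto
    then show "b u = \<zero>" by (rule b(3))
  qed (rule b(1))
  then show ?thesis using that[OF i(1) b(1,2)] by blast
qed

text \<open>\<open>w i\<close> is a composite of linear maps, so it carries each defining relation
  of linearity to a relation of the same kind.\<close>

lemma sigma_linearity:
  assumes i: "i \<in> I" and x: "x \<in> linearity_relations R (B i\<lparr>carrier := grade (B i) 1\<rparr>)"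
  shows "\<sigma> i x \<in> linearity_relations R (A\<lparr>carrier := grade A 1\<rparr>)"
proof -
  interpret P: presented_algebra R "B i" "S i" "\<psi> i" by (rule presented[OF i])
  interpret s: free_algebra_eval R "grade (B i) 1" V.F "\<lambda>v. free_gen R (w i v)" by (rule w_eval[OF i])
  interpret sh: ring_hom_ring P.V.F V.F "\<sigma> i" unfolding \<sigma>_def by (rule s.ev_hom)
  have gen: "\<sigma> i (free_gen R v) = free_gen R (w i v)" if "v \<in> grade (B i) 1" for v
    unfolding \<sigma>_def by (rule s.ev_gen[OF that])
  have diff: "\<sigma> i (x \<ominus>\<^bsub>P.V.F\<^esub> y) = \<sigma> i x \<ominus>\<^bsub>V.F\<^esub> \<sigma> i y"
    if "x \<in> carrier P.V.F" "y \<in> carrier P.V.F" for x y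
    unfolding a_minus_def using that by (simp add: sh.hom_add sh.hom_a_inv)
  consider (add) u v where "u \<in> grade (B i) 1" "v \<in> grade (B i) 1"
      "x = free_gen R (u \<oplus>\<^bsub>B i\<^esub> v) \<ominus>\<^bsub>P.V.F\<^esub> (free_gen R u \<oplus>\<^bsub>P.V.F\<^esub> free_gen R v)"
    | (smult) s v where "s \<in> carrier R" "v \<in> grade (B i) 1"
      "x = free_gen R (s \<odot>\<^bsub>B i\<^esub> v) \<ominus>\<^bsub>P.V.F\<^esub> (s \<odot>\<^bsub>P.V.F\<^esub> free_gen R v)"
    using x unfolding linearity_relations_def Let_def by auto
  then show ?thesis
  proof cases
    case add
    have uv: "u \<oplus>\<^bsub>B i\<^esub> v \<in> grade (B i) 1"
      by (rule P.submoduleE(5)[OF P.grade_submodule add(1,2)])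
    note c = P.V.gen_closed[OF add(1)] P.V.gen_closed[OF add(2)] P.V.gen_closed[OF uv]
    have "w i (u \<oplus>\<^bsub>B i\<^esub> v) = w i u \<oplus>\<^bsub>A\<^esub> w i v"
      unfolding w_def P.psi_gen_add[OF add(1,2)]
      by (rule lam_add[OF i P.\<psi>.hom_closed[OF c(1)] P.\<psi>.hom_closed[OF c(2)]])
    then have "\<sigma> i x = free_gen R (w i u \<oplus>\<^bsub>A\<^esub> w i v) \<ominus>\<^bsub>V.F\<^esub> (free_gen R (w i u) \<oplus>\<^bsub>V.F\<^esub> free_gen R (w i v))"
      unfolding add(3) diff[OF c(3) P.V.add_closed[OF c(1,2)]] sh.hom_add[OF c(1,2)]
        gen[OF add(1)] gen[OF add(2)] gen[OF uv] by simp
    then show ?thesis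
      unfolding linearity_relations_def Let_def using w_closed[OF i add(1)] w_closed[OF i add(2)] by auto
  next
    case smult
    have sv: "s \<odot>\<^bsub>B i\<^esub> v \<in> grade (B i) 1"
      by (rule P.submoduleE(4)[OF P.grade_submodule smult(1,2)])
    note c = P.V.gen_closed[OF smult(2)] P.V.gen_closed[OF sv]
    have "w i (s \<odot>\<^bsub>B i\<^esub> v) = s \<odot>\<^bsub>A\<^esub> w i v"
      unfolding w_def P.psi_gen_smult[OF smult(1,2)]
      by (rule lam_smult[OF i smult(1) P.\<psi>.hom_closed[OF c(1)]])
    moreover have "\<sigma> i (s \<odot>\<^bsub>P.V.F\<^esub> free_gen R v) = s \<odot>\<^bsub>V.F\<^esub> \<sigma> i (free_gen R v)"
      unfolding \<sigma>_def by (rule s.ev_smult[OF smult(1) c(1)])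
    ultimately have "\<sigma> i x = free_gen R (s \<odot>\<^bsub>A\<^esub> w i v) \<ominus>\<^bsub>V.F\<^esub> (s \<odot>\<^bsub>V.F\<^esub> free_gen R (w i v))"
      unfolding smult(3) diff[OF c(2) P.V.smult_closed[OF smult(1) c(1)]] gen[OF smult(2)] gen[OF sv] by simp
    then show ?thesis
      unfolding linearity_relations_def Let_def using w_closed[OF i smult(2)] smult(1) by auto
  qed
qed

text \<open>The largest admissible set of quadratic relations. It is defined from \<epsilon> alone,
  so the sets \<open>S i\<close> of the members need not be glued: their images fall into it
  automatically.\<close>

definition S0 where "S0 = {f \<in> grade V.F 2. \<epsilon>.ev f = \<zero>\<^bsub>A\<^esub>}"

text \<open>The substantial direction is from left to right. A relation \<open>f\<close> of
  \<open>A\<close> is written as \<open>\<sigma> i b\<close>; then \<open>b\<close> is a relation of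
  the member and hence a consequence of its linear and quadratic relations, and
  \<open>\<sigma> i\<close> sends these to linearity relations and to elements of
  \<open>S0\<close>.\<close>

lemma kernel_eps:
  assumes f: "f \<in> carrier V.F"
  shows "\<epsilon>.ev f = \<zero>\<^bsub>A\<^esub> \<longleftrightarrow> f \<in> Idl\<^bsub>V.F\<^esub> (linearity_relations R (A\<lparr>carrier := grade A 1\<rparr>) \<union> S0)"
    (is "_ \<longleftrightarrow> f \<in> Idl\<^bsub>V.F\<^esub> ?X")
proof
  interpret e: ring_hom_ring V.F A "\<epsilon>.ev" by (rule \<epsilon>.ev_hom)
  have X: "?X \<subseteq> carrier V.F"
    using A.linearity_relations_subset unfolding S0_def V.grade_iff by blast
  {
    assume e0: "\<epsilon>.ev f = \<zero>\<^bsub>A\<^esub>"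
    obtain i b where i: "i \<in> I" and b: "b \<in> carrier (free_algebra R (grade (B i) 1))" "\<sigma> i b = f"
      by (rule obtain_sigma[OF f]) blast
    interpret P: presented_algebra R "B i" "S i" "\<psi> i" by (rule presented[OF i])
    interpret s: free_algebra_eval R "grade (B i) 1" V.F "\<lambda>v. free_gen R (w i v)" by (rule w_eval[OF i])
    have sh: "ring_hom_ring P.V.F V.F (\<sigma> i)" unfolding \<sigma>_def by (rule s.ev_hom)
    let ?Y = "linearity_relations R (B i\<lparr>carrier := grade (B i) 1\<rparr>) \<union> S i"
    have "lam i (\<psi> i b) = \<zero>\<^bsub>A\<^esub>" using e0 eps_sigma[OF i b(1)] b(2) by simp
    \<comment> \<open>This is where injectivity of the embeddings enters: a relation that holds in
      the union already holds in the member.\<close>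
    then have "\<psi> i b = \<zero>\<^bsub>B i\<^esub>" using lam_eq_zero_iff[OF i P.\<psi>.hom_closed[OF b(1)]] by blast
    then have bY: "b \<in> Idl\<^bsub>P.V.F\<^esub> ?Y" using quadratic_presentationD(5)[OF presentation[OF i] b(1)] by blast
    have "\<sigma> i x \<in> grade V.F 2" if "x \<in> S i" for x
      using sigma_grade[OF i] quadratic_presentationD(6)[OF presentation[OF i]] that by blast
    moreover have "\<epsilon>.ev (\<sigma> i x) = \<zero>\<^bsub>A\<^esub>" if x: "x \<in> S i" for x
    proof -
      have "x \<in> carrier P.V.F"
        using x quadratic_presentationD(6)[OF presentation[OF i]] P.V.grade_iff by blast
      then show ?thesis
        using eps_sigma[OF i] P.psi_relation[of x] x by (simp add: lam_zero[OF i])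
    qed
    ultimately have "\<sigma> i ` S i \<subseteq> S0"
      unfolding S0_def by blast
    then have "\<sigma> i ` ?Y \<subseteq> ?X" using sigma_linearity[OF i] by blast
    also have "\<dots> \<subseteq> Idl\<^bsub>V.F\<^esub> ?X" by (rule e.R.genideal_self[OF X])
    finally have "\<sigma> i ` ?Y \<subseteq> Idl\<^bsub>V.F\<^esub> ?X" .
    moreover have "?Y \<subseteq> carrier P.V.F"
      using P.linearity_relations_subset quadratic_presentationD(6)[OF presentation[OF i]] P.V.grade_iff by blast
    ultimately have "\<sigma> i b \<in> Idl\<^bsub>V.F\<^esub> ?X"
      by (rule genideal_mono_vimage[OF sh e.R.genideal_ideal[OF X] _ _ bY, rotated])
    then show "f \<in> Idl\<^bsub>V.F\<^esub> ?X" unfolding b(2) .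
  }
  assume fX: "f \<in> Idl\<^bsub>V.F\<^esub> ?X"
  have "\<epsilon>.ev f \<in> {\<zero>\<^bsub>A\<^esub>}"
  \<comment> \<open>Apply the test on generators to the zero ideal of \<open>A\<close>.\<close>
  proof (rule genideal_mono_vimage[OF \<epsilon>.ev_hom A.zeroideal X _ fX], rule image_subsetI)
    fix x assume "x \<in> ?X"
    then consider (S0) "x \<in> S0" | (add) u v where "u \<in> grade A 1" "v \<in> grade A 1"
        "x = free_gen R (u \<oplus>\<^bsub>A\<^esub> v) \<ominus>\<^bsub>V.F\<^esub> (free_gen R u \<oplus>\<^bsub>V.F\<^esub> free_gen R v)"
      | (smult) s v where "s \<in> carrier R" "v \<in> grade A 1"
        "x = free_gen R (s \<odot>\<^bsub>A\<^esub> v) \<ominus>\<^bsub>V.F\<^esub> (s \<odot>\<^bsub>V.F\<^esub> free_gen R v)"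
      unfolding linearity_relations_def Let_def by auto
    then have "\<epsilon>.ev x = \<zero>\<^bsub>A\<^esub>"
    proof cases
      case S0 then show ?thesis unfolding S0_def by blast
    next
      case add
      have uv: "u \<oplus>\<^bsub>A\<^esub> v \<in> grade A 1" by (rule A.submoduleE(5)[OF A.grade_submodule add(1,2)])
      note c = V.gen_closed[OF add(1)] V.gen_closed[OF add(2)]
      show ?thesis unfolding add(3)
          ring_hom_eq_iff[OF \<epsilon>.ev_hom V.gen_closed[OF uv] V.add_closed[OF c], symmetric]
          \<epsilon>.ev_add[OF c] \<epsilon>.ev_gen[OF uv] \<epsilon>.ev_gen[OF add(1)] \<epsilon>.ev_gen[OF add(2)] ..
    next
      case smult
      have sv: "s \<odot>\<^bsub>A\<^esub> v \<in> grade A 1" by (rule A.submoduleE(4)[OF A.grade_submodule smult(1,2)])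
      note c = V.gen_closed[OF smult(2)]
      show ?thesis unfolding smult(3)
          ring_hom_eq_iff[OF \<epsilon>.ev_hom V.gen_closed[OF sv] V.smult_closed[OF smult(1) c], symmetric]
          \<epsilon>.ev_smult[OF smult(1) c] \<epsilon>.ev_gen[OF sv] \<epsilon>.ev_gen[OF smult(2)] ..
    qed
    then show "\<epsilon>.ev x \<in> {\<zero>\<^bsub>A\<^esub>}" by simp
  qed
  then show "\<epsilon>.ev f = \<zero>\<^bsub>A\<^esub>" by simp
qed

text \<open>Homogeneous lifts transfer the statement to the presentations of the members, which
  respect degrees by assumption.\<close>

lemma eps_grade: "\<epsilon>.ev ` grade V.F n = grade A n"
proof
  show "\<epsilon>.ev ` grade V.F n \<subseteq> grade A n"
  proof (rule image_subsetI)
    fix f assume f: "f \<in> grade V.F n"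
    then have "f \<in> carrier V.F" unfolding V.grade_iff by blast
    then obtain i b where i: "i \<in> I" and b: "b \<in> carrier (free_algebra R (grade (B i) 1))" "\<sigma> i b = f"
      and g: "\<forall>n. f \<in> grade V.F n \<longrightarrow> b \<in> grade (free_algebra R (grade (B i) 1)) n"
      by (rule obtain_sigma)
    have "\<psi> i b \<in> grade (B i) n"
      using imageI[OF g[rule_format, OF f], of "\<psi> i"] by (simp only: quadratic_presentationD(3)[OF presentation[OF i]])
    then have "lam i (\<psi> i b) \<in> grade A n" unfolding grade_eq using i by blast
    then show "\<epsilon>.ev f \<in> grade A n" using eps_sigma[OF i b(1)] b(2) by simp
  qed
  show "grade A n \<subseteq> \<epsilon>.ev ` grade V.F n"
  proof
    fix a assume "a \<in> grade A n"
    then obtain i x where i: "i \<in> I" and x: "x \<in> grade (B i) n" "a = lam i x" using grade_eq by blast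
    have "x \<in> \<psi> i ` grade (free_algebra R (grade (B i) 1)) n"
      using x(1) by (simp only: quadratic_presentationD(3)[OF presentation[OF i]])
    then obtain b where b: "x = \<psi> i b" "b \<in> grade (free_algebra R (grade (B i) 1)) n" by (rule imageE)
    interpret P: presented_algebra R "B i" "S i" "\<psi> i" by (rule presented[OF i])
    have "b \<in> carrier P.V.F" using b(2) unfolding P.V.grade_iff by blast
    then have "\<epsilon>.ev (\<sigma> i b) = a" using eps_sigma[OF i] b(1) x(2) by simp
    then show "a \<in> \<epsilon>.ev ` grade V.F n" using sigma_grade[OF i b(2)] by blast
  qed
qed

lemma eps_surj: "\<epsilon>.ev ` carrier V.F = carrier A"
proof
  show "\<epsilon>.ev ` carrier V.F \<subseteq> carrier A" using \<epsilon>.ev_closed by blast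
  show "carrier A \<subseteq> \<epsilon>.ev ` carrier V.F"
  proof
    fix a assume "a \<in> carrier A"
    then obtain i x where i: "i \<in> I" and x: "x \<in> carrier (B i)" "a = lam i x" using carrier_eq by blast
    have "x \<in> \<psi> i ` carrier (free_algebra R (grade (B i) 1))"
      using x(1) by (simp only: quadratic_presentationD(4)[OF presentation[OF i]])
    then obtain b where b: "x = \<psi> i b" "b \<in> carrier (free_algebra R (grade (B i) 1))" by (rule imageE)
    interpret s: free_algebra_eval R "grade (B i) 1" V.F "\<lambda>v. free_gen R (w i v)" by (rule w_eval[OF i])
    have "\<sigma> i b \<in> carrier V.F" unfolding \<sigma>_def by (rule s.ev_closed[OF b(2)])
    moreover have "\<epsilon>.ev (\<sigma> i b) = a" using eps_sigma[OF i b(2)] b(1) x(2) by simp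
    ultimately show "a \<in> \<epsilon>.ev ` carrier V.F" by blast
  qed
qed

lemma quadratic: "quadratic_algebra R A"
proof -
  have "quadratic_presentation R A S0 \<epsilon>.ev"
    unfolding quadratic_presentation_def Let_def
    using \<epsilon>.ev_hom eps_surj \<epsilon>.ev_smult eps_grade kernel_eps unfolding S0_def by blast
  then show ?thesis using connected_A quadratic_algebra_iff by blast
qed

end

text \<open>A presentation is chosen for each member separately, without any compatibility between
  different members.\<close>

theorem directed_union_quadratic:
  assumes "algebra_directed_union R A I r B lam" "\<And>i. i \<in> I \<Longrightarrow> quadratic_algebra R (B i)"
  shows "quadratic_algebra R A"
proof -
  have "\<forall>i\<in>I. \<exists>S \<psi>. quadratic_presentation R (B i) S \<psi>" using assms(2) quadratic_algebra_iff by blast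
  then obtain S \<psi> where "\<And>i. i \<in> I \<Longrightarrow> quadratic_presentation R (B i) (S i) (\<psi> i)" by metis
  then have "quadratic_directed_union R A I r B lam S \<psi>"
    using assms(1) by (simp add: quadratic_directed_union_def quadratic_directed_union_axioms_def)
  then show ?thesis by (rule quadratic_directed_union.quadratic)
qed

section \<open>Projective limits of compact groups\<close>

locale compact_projective_system = projective_system I r G T \<pi>
  for I :: "'i set" and r :: "'i rel"
    and G :: "'i \<Rightarrow> 'a monoid" and T :: "'i \<Rightarrow> 'a topology"
    and \<pi> :: "'i \<Rightarrow> 'i \<Rightarrow> 'a \<Rightarrow> 'a" +
  assumes compact: "i \<in> I \<Longrightarrow> compact_space (T i)"
    and Hausdorff: "i \<in> I \<Longrightarrow> Hausdorff_space (T i)"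
    and transition_surj: "(i, j) \<in> r \<Longrightarrow> \<pi> i j ` carrier (G j) = carrier (G i)"
begin

abbreviation X where "X \<equiv> product_topology T I"
abbreviation L where "L \<equiv> projective_limit I r G \<pi>"
abbreviation TL where "TL \<equiv> projective_limit_topology I r G T \<pi>"

lemma top_eq: "i \<in> I \<Longrightarrow> topspace (T i) = carrier (G i)"
  using topological_groups topological_group.topspace_eq by blast

lemma group_G: "i \<in> I \<Longrightarrow> group (G i)"
  using topological_groups topological_group.axioms(1) by blast

lemma rI: "(i, j) \<in> r \<Longrightarrow> i \<in> I \<and> j \<in> I"
  using directed unfolding directed_on_def preorder_on_def by blast

lemma r_refl: "i \<in> I \<Longrightarrow> (i, i) \<in> r"
  using directed by (auto simp: directed_on_def preorder_on_def refl_on_def)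

lemma r_trans: "(i, j) \<in> r \<Longrightarrow> (j, k) \<in> r \<Longrightarrow> (i, k) \<in> r"
  using directed unfolding directed_on_def preorder_on_def by (meson transD)

lemma topspace_X: "topspace X = (\<Pi>\<^sub>E i\<in>I. carrier (G i))"
  by (auto simp: top_eq PiE_iff)

lemma L_iff: "x \<in> carrier L \<longleftrightarrow> x \<in> topspace X \<and> (\<forall>(i, j)\<in>r. \<pi> i j (x j) = x i)"
  unfolding topspace_X by (simp add: projective_limit_def)

lemma topspace_TL: "topspace TL = carrier L"
  unfolding projective_limit_topology_def using L_iff by auto

lemma coordinate_closed: "\<lbrakk>x \<in> topspace X; i \<in> I\<rbrakk> \<Longrightarrow> x i \<in> carrier (G i)"
  unfolding topspace_X by auto

lemma L_coordinate: "\<lbrakk>x \<in> carrier L; i \<in> I\<rbrakk> \<Longrightarrow> x i \<in> carrier (G i)"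
  using L_iff coordinate_closed by blast

lemma L_compat: "\<lbrakk>x \<in> carrier L; (i, j) \<in> r\<rbrakk> \<Longrightarrow> \<pi> i j (x j) = x i"
  using L_iff by blast

lemma closed_compat: "(i, j) \<in> r \<Longrightarrow> closedin X {x \<in> topspace X. \<pi> i j (x j) = x i}"
proof (rule closedin_continuous_maps_eq[of "T i"])
  assume ij: "(i, j) \<in> r"
  show "Hausdorff_space (T i)" using rI[OF ij] Hausdorff by blast
  have "continuous_map X (T i) (\<pi> i j \<circ> (\<lambda>x. x j))"
    by (rule continuous_map_compose[OF _ transition_continuous[OF ij]], rule continuous_map_product_projection)
      (use rI[OF ij] in blast)
  then show "continuous_map X (T i) (\<lambda>x. \<pi> i j (x j))" by (simp add: comp_def)
  show "continuous_map X (T i) (\<lambda>x. x i)"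
    by (rule continuous_map_product_projection) (use rI[OF ij] in blast)
qed

lemma compact_X: "compact_space X"
  unfolding compact_space_product_topology using compact by blast

lemma closed_L: "closedin X (carrier L)"
proof -
  obtain i where "i \<in> I" using directed unfolding directed_on_def by blast
  \<comment> \<open>An intersection over an empty family would not be contained in the product
    space.\<close>
  then have ne: "r \<noteq> {}" using r_refl by blast
  have "carrier L = (\<Inter>(i, j)\<in>r. {x \<in> topspace X. \<pi> i j (x j) = x i})"
    using L_iff ne by auto
  also have "closedin X \<dots>" using ne closed_compat by (intro closedin_INT) auto
  finally show ?thesis .
qed

lemma compact_TL: "compact_space TL"
  unfolding projective_limit_topology_def
  by (rule compact_space_subtopology[OF closedin_compact_space[OF compact_X closed_L]])

text \<open>A compactness argument. For \<open>j\<close> above \<open>i\<close>, let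
  \<open>K j\<close> be the families with value \<open>g\<close> at \<open>i\<close> that are
  compatible below \<open>j\<close>. These sets are closed, nonempty because the transition map from
  \<open>G j\<close> to \<open>G i\<close> is surjective, and they decrease along the directed
  order, so they have a common point. Any two comparable indices lie below some such
  \<open>j\<close>, hence that point is compatible everywhere.\<close>

lemma projection_surj:
  assumes i: "i \<in> I" and g: "g \<in> carrier (G i)"
  shows "\<exists>x\<in>carrier L. x i = g"
proof -
  define K where "K j = {x \<in> topspace X. x i = g \<and> (\<forall>k. (k, j) \<in> r \<longrightarrow> \<pi> k j (x j) = x k)}" for j
  define J where "J = {j. (i, j) \<in> r}"
  have JI: "J \<subseteq> I" unfolding J_def using rI by blast
  have iJ: "i \<in> J" unfolding J_def using r_refl[OF i] by simp
  have closed: "closedin X (K j)" if j: "j \<in> J" for j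
  proof -
    have "closedin X ({x \<in> topspace X. x i \<in> {g}} \<inter> (\<Inter>k\<in>{k. (k, j) \<in> r}. {x \<in> topspace X. \<pi> k j (x j) = x k}))"
    proof (intro closedin_Int closedin_INT)
      show "closedin X {x \<in> topspace X. x i \<in> {g}}"
        by (rule closedin_continuous_map_preimage[OF continuous_map_product_projection[OF i]])
          (use Hausdorff[OF i] g top_eq[OF i] in \<open>simp add: closedin_Hausdorff_singleton\<close>)
      show "{k. (k, j) \<in> r} \<noteq> {}" using r_refl JI j by blast
    qed (use closed_compat in blast)
    also have "\<dots> = K j" unfolding K_def using j r_refl JI by auto
    finally show ?thesis .
  qed
  have nonempty: "K j \<noteq> {}" if j: "j \<in> J" for j
  proof -
    have ij: "(i, j) \<in> r" using j unfolding J_def by simp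
    obtain h where h: "h \<in> carrier (G j)" "\<pi> i j h = g"
      using transition_surj[OF ij] g by (metis imageE)
    \<comment> \<open>Coordinates that are not below \<open>j\<close> do not enter the conditions of
      \<open>K j\<close>; neutral elements fill them.\<close>
    define x where "x = (\<lambda>k\<in>I. if (k, j) \<in> r then \<pi> k j h else \<one>\<^bsub>G k\<^esub>)"
    have "x k \<in> carrier (G k)" if "k \<in> I" for k
      unfolding x_def using that transition_hom[of k j] h(1) group.is_monoid[OF group_G[OF that]]
      by (auto simp: hom_def Pi_iff monoid.one_closed)
    then have "x \<in> topspace X" unfolding topspace_X by (auto simp: x_def)
    moreover have "x j = h"
      unfolding x_def using r_refl j JI transition_id[OF _ h(1)] by auto
    then have "\<pi> k j (x j) = x k" if "(k, j) \<in> r" for k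
      using that rI unfolding x_def by auto
    moreover have "x i = g" unfolding x_def using i ij h(2) by simp
    ultimately show ?thesis unfolding K_def by blast
  qed
  have mono: "K j' \<subseteq> K j" if jj: "(j, j') \<in> r" "j \<in> J" for j j'
  proof
    fix x assume x: "x \<in> K j'"
    have c: "x j' \<in> carrier (G j')" using x coordinate_closed rI[OF jj(1)] unfolding K_def by blast
    have "\<pi> k j (x j) = x k" if kj: "(k, j) \<in> r" for k
    proof -
      have "\<pi> k j (x j) = \<pi> k j (\<pi> j j' (x j'))" using x jj(1) unfolding K_def by simp
      also have "\<dots> = \<pi> k j' (x j')" by (rule transition_comp[OF kj jj(1) c])
      also have "\<dots> = x k" using x r_trans[OF kj jj(1)] unfolding K_def by simp
      finally show ?thesis .
    qed
    then show "x \<in> K j" using x unfolding K_def by blast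
  qed
  have "\<Inter>(K ` J) \<noteq> {}"
  proof -
    have "\<Inter>\<F> \<noteq> {}" if F: "finite \<F>" "\<F> \<subseteq> K ` J" for \<F>
    proof -
      obtain J0 where J0: "finite J0" "J0 \<subseteq> J" "\<F> = K ` J0" using F finite_subset_image by metis
      \<comment> \<open>Including \<open>i\<close> keeps the bound inside \<open>J\<close> even when
        \<open>J0\<close> is empty.\<close>
      obtain j where j: "j \<in> I" "\<And>k. k \<in> insert i J0 \<Longrightarrow> (k, j) \<in> r"
        by (rule directed_finite_bound[OF directed, of "insert i J0"]) (use J0 JI i in auto)
      have "K j \<subseteq> \<Inter>\<F>"
        unfolding J0(3) by (rule INT_greatest) (use mono j(2) J0(2) in blast)
      moreover have "K j \<noteq> {}" by (rule nonempty) (use j(2) in \<open>simp add: J_def\<close>)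
      ultimately show ?thesis by blast
    qed
    then show ?thesis using compact_X closed unfolding compact_space_fip by (metis (no_types, lifting) imageE)
  qed
  then obtain x where x: "\<And>j. j \<in> J \<Longrightarrow> x \<in> K j" by blast
  have "\<pi> k l (x l) = x k" if kl: "(k, l) \<in> r" for k l
  proof -
    obtain j where j: "j \<in> I" "(i, j) \<in> r" "(l, j) \<in> r"
      using directed i rI[OF kl] unfolding directed_on_def by blast
    have xj: "x \<in> K j" by (rule x) (use j(2) in \<open>simp add: J_def\<close>)
    have c: "x j \<in> carrier (G j)" using xj coordinate_closed j(1) unfolding K_def by blast
    have "\<pi> k l (x l) = \<pi> k l (\<pi> l j (x j))" using xj j(3) unfolding K_def by simp
    also have "\<dots> = \<pi> k j (x j)" by (rule transition_comp[OF kl j(3) c])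
    also have "\<dots> = x k" using xj r_trans[OF kl j(3)] unfolding K_def by simp
    finally show ?thesis .
  qed
  moreover have "x \<in> topspace X" "x i = g" using x[OF iJ] unfolding K_def by auto
  ultimately show ?thesis using L_iff by (intro bexI[of _ x]) auto
qed

lemma projection_continuous: "i \<in> I \<Longrightarrow> continuous_map TL (T i) (\<lambda>x. x i)"
  unfolding projective_limit_topology_def
  by (rule continuous_map_from_subtopology[OF continuous_map_product_projection])

text \<open>A basic open set of the product constrains finitely many coordinates. On the limit each
  of them is a continuous function of the coordinate at \<open>j\<close> as soon as \<open>j\<close>
  lies above all of them. Having this for every later \<open>j\<close> allows several neighbourhoods
  to be treated at one index.\<close>

lemma basic_neighbourhood:
  assumes U: "openin TL U" and z: "z \<in> U"
  shows "\<exists>i\<in>I. \<forall>j. (i, j) \<in> r \<longrightarrow> (\<exists>V. openin (T j) V \<and> z j \<in> V \<and> {y \<in> carrier L. y j \<in> V} \<subseteq> U)"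
proof -
  obtain W where W: "openin X W" "U = W \<inter> carrier L"
    using U unfolding projective_limit_topology_def openin_subtopology by blast
  have zW: "z \<in> W" and zL: "z \<in> carrier L" using z W(2) by auto
  obtain D where D: "finite {i \<in> I. D i \<noteq> topspace (T i)}" "\<And>i. i \<in> I \<Longrightarrow> openin (T i) (D i)"
    "z \<in> Pi\<^sub>E I D" "Pi\<^sub>E I D \<subseteq> W"
    using bspec[OF W(1)[unfolded openin_product_topology_alt] zW] by blast
  let ?J = "{i \<in> I. D i \<noteq> topspace (T i)}"
  obtain i where i: "i \<in> I" "\<And>k. k \<in> ?J \<Longrightarrow> (k, i) \<in> r"
    by (rule directed_finite_bound[OF directed D(1)]) auto
  have "\<exists>V. openin (T j) V \<and> z j \<in> V \<and> {y \<in> carrier L. y j \<in> V} \<subseteq> U" if ij: "(i, j) \<in> r" for j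
  proof -
    have jI: "j \<in> I" using rI[OF ij] by blast
    have kj: "(k, j) \<in> r" if "k \<in> ?J" for k using i(2)[OF that] ij by (rule r_trans)
    \<comment> \<open>The intersection with the whole space takes care of the case in which no
      coordinate is constrained.\<close>
    define V where "V = topspace (T j) \<inter> (\<Inter>k\<in>?J. {g \<in> topspace (T j). \<pi> k j g \<in> D k})"
    have "openin (T j) V"
      unfolding V_def
    proof (cases "?J = {}")
      case True
      then show "openin (T j) (topspace (T j) \<inter> (\<Inter>k\<in>?J. {g \<in> topspace (T j). \<pi> k j g \<in> D k}))"
        unfolding True by simp
    next
      case False
      have "openin (T j) (\<Inter>k\<in>?J. {g \<in> topspace (T j). \<pi> k j g \<in> D k})"
        using D(1) False
      proof (rule openin_INT2)
        fix k assume k: "k \<in> ?J"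
        show "openin (T j) {g \<in> topspace (T j). \<pi> k j g \<in> D k}"
          by (rule openin_continuous_map_preimage[OF transition_continuous[OF kj[OF k]] D(2)]) (use k in blast)
      qed
      then show "openin (T j) (topspace (T j) \<inter> (\<Inter>k\<in>?J. {g \<in> topspace (T j). \<pi> k j g \<in> D k}))"
        by (rule openin_Int[OF openin_topspace])
    qed
    moreover have "z j \<in> V"
      unfolding V_def using L_coordinate[OF zL jI] top_eq[OF jI] L_compat[OF zL kj] D(3) by auto
    moreover have "{y \<in> carrier L. y j \<in> V} \<subseteq> U"
    proof
      fix y assume "y \<in> {y \<in> carrier L. y j \<in> V}"
      then have y: "y \<in> carrier L" "y j \<in> V" by auto
      have "y k \<in> D k" if k: "k \<in> I" for k
      proof (cases "k \<in> ?J")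
        case True
        then have "\<pi> k j (y j) \<in> D k" using y(2) unfolding V_def by blast
        then show ?thesis using L_compat[OF y(1) kj[OF True]] by simp
      next
        case False
        then show ?thesis using k top_eq[OF k] L_coordinate[OF y(1) k] by simp
      qed
      moreover have "y \<in> extensional I" using y(1) unfolding L_iff topspace_X by (auto simp: PiE_iff)
      ultimately have "y \<in> Pi\<^sub>E I D" by (simp add: PiE_iff)
      then have "y \<in> W" using D(4) by blast
      then show "y \<in> U" using W(2) y(1) by blast
    qed
    ultimately show ?thesis by blast
  qed
  then show ?thesis using i(1) by blast
qed

section \<open>Continuous functions on tuples factor through one level\<close>

abbreviation Y where "Y n \<equiv> product_topology (\<lambda>_. TL) {..<n::nat}"

lemma topspace_Y: "topspace (Y n) = tuples L n"
  by (simp add: topspace_TL)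

text \<open>The fibre of \<open>f\<close> through \<open>x\<close> is open because the target is
  discrete. Inside it the neighbourhood is built from open sets of a single \<open>T i\<close>, so
  it is a union of fibres of the projection to level \<open>i\<close>; this saturation is what
  survives in the compactness argument that follows.\<close>

lemma locally_constant:
  assumes f: "continuous_map (Y n) (discrete_topology U) f" and x: "x \<in> tuples L n"
  shows "\<exists>i\<in>I. \<exists>N. openin (Y n) N \<and> x \<in> N \<and> (\<forall>y\<in>N. f y = f x) \<and>
    (\<forall>y\<in>N. \<forall>z\<in>tuples L n. (\<forall>k<n. z k i = y k i) \<longrightarrow> z \<in> N)"
proof -
  have "f x \<in> U" using continuous_map_image_subset_topspace[OF f] x unfolding topspace_Y by auto
  then have "openin (Y n) {y \<in> topspace (Y n). f y \<in> {f x}}"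
    by (intro openin_continuous_map_preimage[OF f]) simp
  then obtain D where D: "\<And>k. k < n \<Longrightarrow> openin TL (D k)"
    "x \<in> Pi\<^sub>E {..<n} D" "Pi\<^sub>E {..<n} D \<subseteq> {y \<in> topspace (Y n). f y \<in> {f x}}"
    unfolding openin_product_topology_alt using x topspace_Y[of n]
    by (metis (mono_tags, lifting) lessThan_iff mem_Collect_eq singletonI)
  have "\<forall>k\<in>{..<n}. \<exists>i\<in>I. \<forall>j. (i, j) \<in> r \<longrightarrow>
      (\<exists>V. openin (T j) V \<and> x k j \<in> V \<and> {y \<in> carrier L. y j \<in> V} \<subseteq> D k)"
    using basic_neighbourhood[OF D(1)] D(2) by blast
  then have "\<exists>c. \<forall>k\<in>{..<n}. c k \<in> I \<and> (\<forall>j. (c k, j) \<in> r \<longrightarrow>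
      (\<exists>V. openin (T j) V \<and> x k j \<in> V \<and> {y \<in> carrier L. y j \<in> V} \<subseteq> D k))"
    unfolding Bex_def by (rule bchoice)
  then obtain c where c: "\<And>k. k < n \<Longrightarrow> c k \<in> I"
    "\<And>k j. \<lbrakk>k < n; (c k, j) \<in> r\<rbrakk> \<Longrightarrow>
      \<exists>V. openin (T j) V \<and> x k j \<in> V \<and> {y \<in> carrier L. y j \<in> V} \<subseteq> D k"
    by fastforce
  obtain i where i: "i \<in> I" "\<And>k. k \<in> c ` {..<n} \<Longrightarrow> (k, i) \<in> r"
    by (rule directed_finite_bound[OF directed, of "c ` {..<n}"]) (use c(1) in auto)
  have "\<forall>k\<in>{..<n}. \<exists>V. openin (T i) V \<and> x k i \<in> V \<and> {y \<in> carrier L. y i \<in> V} \<subseteq> D k"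
    using c(2) i(2) by auto
  then have "\<exists>V. \<forall>k\<in>{..<n}. openin (T i) (V k) \<and> x k i \<in> V k \<and> {y \<in> carrier L. y i \<in> V k} \<subseteq> D k"
    by (rule bchoice)
  then obtain V where
    V0: "\<forall>k\<in>{..<n}. openin (T i) (V k) \<and> x k i \<in> V k \<and> {y \<in> carrier L. y i \<in> V k} \<subseteq> D k"
    by (rule exE)
  have V: "openin (T i) (V k) \<and> x k i \<in> V k \<and> {y \<in> carrier L. y i \<in> V k} \<subseteq> D k" if "k < n" for k
    by (rule bspec[OF V0]) (use that in simp)
  define N where "N = (\<Pi>\<^sub>E k\<in>{..<n}. {y \<in> topspace TL. y i \<in> V k})"
  have "openin TL {y \<in> topspace TL. y i \<in> V k}" if "k < n" for k
    by (rule openin_continuous_map_preimage[OF projection_continuous[OF i(1)]]) (use V[OF that] in blast)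
  then have N1: "openin (Y n) N" unfolding N_def by (simp add: openin_PiE)
  have N2: "x \<in> N" unfolding N_def topspace_TL by (rule PiE_I) (use x V in \<open>auto simp: PiE_iff extensional_def\<close>)
  have N3: "f y = f x" if "y \<in> N" for y
  proof -
    have "y \<in> Pi\<^sub>E {..<n} D"
    proof (rule PiE_I)
      fix k assume k: "k \<in> {..<n}"
      then have "y k \<in> {y \<in> carrier L. y i \<in> V k}" using that unfolding N_def topspace_TL by blast
      then show "y k \<in> D k" using V[of k] k by blast
    qed (use that in \<open>auto simp: N_def\<close>)
    then show ?thesis using D(3) by blast
  qed
  have N4: "z \<in> N" if "y \<in> N" "z \<in> tuples L n" "\<forall>k<n. z k i = y k i" for y z
    unfolding N_def
  proof (rule PiE_I)
    fix k assume k: "k \<in> {..<n}"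
    have "y k i \<in> V k" using that(1) k unfolding N_def by blast
    then have "z k i \<in> V k" using that(3) k by simp
    then show "z k \<in> {y \<in> topspace TL. y i \<in> V k}" using that(2) k unfolding topspace_TL by blast
  qed (rule PiE_arb[OF that(2)])
  show ?thesis
  proof (rule bexI[OF _ i(1)], rule exI[of _ N], intro conjI ballI impI)
    fix y z assume "y \<in> N" "z \<in> tuples L n" "\<forall>k<n. z k i = y k i"
    then show "z \<in> N" by (rule N4)
  qed (rule N1 N2 N3 | assumption)+
qed

text \<open>Finitely many saturated neighbourhoods cover the compact space of tuples. Take
  \<open>i\<close> above their indices: tuples that agree at \<open>i\<close> agree at all these
  indices, hence lie in the same neighbourhood.\<close>

lemma eventually_constant_on_fibres:
  assumes f: "continuous_map (Y n) (discrete_topology U) f"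
  shows "\<exists>i\<in>I. \<forall>x\<in>tuples L n. \<forall>y\<in>tuples L n. (\<forall>k<n. x k i = y k i) \<longrightarrow> f x = f y"
proof -
  define good where "good N i \<longleftrightarrow> i \<in> I \<and> openin (Y n) N \<and> (\<forall>x\<in>N. \<forall>y\<in>N. f x = f y) \<and>
    (\<forall>y\<in>N. \<forall>z\<in>tuples L n. (\<forall>k<n. z k i = y k i) \<longrightarrow> z \<in> N)" for N i
  have "\<exists>N i. good N i \<and> x \<in> N" if "x \<in> tuples L n" for x
    using locally_constant[OF f that] unfolding good_def by metis
  then have "topspace (Y n) \<subseteq> \<Union>{N. \<exists>i. good N i}" unfolding topspace_Y by blast
  moreover have "\<forall>N\<in>{N. \<exists>i. good N i}. openin (Y n) N" unfolding good_def by blast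
  moreover have "compact_space (Y n)" unfolding compact_space_product_topology using compact_TL by blast
  ultimately obtain \<F> where F: "finite \<F>" "\<F> \<subseteq> {N. \<exists>i. good N i}" "topspace (Y n) \<subseteq> \<Union>\<F>"
    unfolding compact_space_alt by meson
  then have "\<forall>N\<in>\<F>. \<exists>i. good N i" by blast
  then obtain c where c: "\<And>N. N \<in> \<F> \<Longrightarrow> good N (c N)" by metis
  obtain i where i: "i \<in> I" "\<And>k. k \<in> c ` \<F> \<Longrightarrow> (k, i) \<in> r"
    by (rule directed_finite_bound[OF directed, of "c ` \<F>"]) (use F(1) c in \<open>auto simp: good_def\<close>)
  have "f x = f y" if x: "x \<in> tuples L n" and y: "y \<in> tuples L n" and xy: "\<forall>k<n. x k i = y k i" for x y
  proof -
    obtain N where N: "N \<in> \<F>" "x \<in> N" using F(3) x unfolding topspace_Y by blast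
    have "y k (c N) = x k (c N)" if "k < n" for k
    proof -
      have "x k \<in> carrier L" "y k \<in> carrier L" using x y that by auto
      then show ?thesis using L_compat[of _ "c N" i] i(2) N(1) xy that by (metis imageI)
    qed
    then have "y \<in> N" using c[OF N(1)] N(2) y unfolding good_def by blast
    then show ?thesis using c[OF N(1)] N(2) unfolding good_def by blast
  qed
  then show ?thesis using i(1) by blast
qed

lemma tuple_projection:
  fixes n :: nat and q :: "(nat \<Rightarrow> 'i \<Rightarrow> 'a) \<Rightarrow> nat \<Rightarrow> 'a"
  assumes j: "j \<in> I"
  defines "q \<equiv> \<lambda>x. \<lambda>k\<in>{..<n}. x k j"
  shows "continuous_map (Y n) (product_topology (\<lambda>_. T j) {..<n}) q"
    and "q ` tuples L n = tuples (G j) n"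
proof -
  show "continuous_map (Y n) (product_topology (\<lambda>_. T j) {..<n}) q"
    unfolding continuous_map_componentwise
  proof (intro conjI ballI)
    show "q ` topspace (Y n) \<subseteq> extensional {..<n}" unfolding q_def by auto
    fix k assume k: "k \<in> {..<n}"
    have "continuous_map (Y n) (T j) ((\<lambda>x. x j) \<circ> (\<lambda>x. x k))"
      by (rule continuous_map_compose[OF continuous_map_product_projection[OF k] projection_continuous[OF j]])
    then show "continuous_map (Y n) (T j) (\<lambda>x. q x k)" using k unfolding q_def comp_def by simp
  qed
  show "q ` tuples L n = tuples (G j) n"
  proof
    show "q ` tuples L n \<subseteq> tuples (G j) n"
    proof (rule image_subsetI)
      fix x assume "x \<in> tuples L n"
      then have "x k j \<in> carrier (G j)" if "k < n" for k
        using L_coordinate[OF _ j, of "x k"] that by blast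
      then show "q x \<in> tuples (G j) n" unfolding q_def by simp
    qed
    show "tuples (G j) n \<subseteq> q ` tuples L n"
    proof
      fix v assume v: "v \<in> tuples (G j) n"
      have "\<forall>k\<in>{..<n}. \<exists>x\<in>carrier L. x j = v k" using projection_surj[OF j] v by blast
      then obtain x where x: "\<And>k. k < n \<Longrightarrow> x k \<in> carrier L \<and> x k j = v k" by (metis lessThan_iff)
      have "v = q (restrict x {..<n})"
        using x v unfolding q_def by (auto simp: PiE_iff extensional_def fun_eq_iff)
      moreover have "restrict x {..<n} \<in> tuples L n" using x by auto
      ultimately show "v \<in> q ` tuples L n" by blast
    qed
  qed
qed

text \<open>Beyond the index of the previous lemma, \<open>f\<close> is constant on the fibres of
  the projection \<open>q\<close> and descends to a function \<open>f'\<close>. The projection is a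
  continuous surjection from a compact space onto a Hausdorff space, hence a quotient map, and
  continuity of \<open>f'\<close> follows.\<close>

lemma continuous_factor:
  assumes f: "continuous_map (Y n) (discrete_topology U) f"
  shows "\<exists>i\<in>I. \<forall>j. (i, j) \<in> r \<longrightarrow> (\<exists>f'\<in>extensional (tuples (G j) n).
    continuous_map (product_topology (\<lambda>_. T j) {..<n}) (discrete_topology U) f' \<and>
    (\<forall>x\<in>tuples L n. f x = f' (\<lambda>k\<in>{..<n}. x k j)))"
proof -
  obtain i where i: "i \<in> I"
    and eq: "\<forall>x\<in>tuples L n. \<forall>y\<in>tuples L n. (\<forall>k<n. x k i = y k i) \<longrightarrow> f x = f y"
    using eventually_constant_on_fibres[OF f] by (rule bexE)
  have "\<exists>f'\<in>extensional (tuples (G j) n).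
    continuous_map (product_topology (\<lambda>_. T j) {..<n}) (discrete_topology U) f' \<and>
    (\<forall>x\<in>tuples L n. f x = f' (\<lambda>k\<in>{..<n}. x k j))" if ij: "(i, j) \<in> r" for j
  proof -
    have j: "j \<in> I" using rI[OF ij] by blast
    define q where "q x = (\<lambda>k\<in>{..<n}. x k j)" for x :: "nat \<Rightarrow> 'i \<Rightarrow> 'a"
    have q: "continuous_map (Y n) (product_topology (\<lambda>_. T j) {..<n}) q"
      "q ` tuples L n = tuples (G j) n" unfolding q_def by (rule tuple_projection[OF j])+
    have fq: "f x = f y" if "x \<in> tuples L n" "y \<in> tuples L n" "q x = q y" for x y
    proof (rule eq[rule_format, OF that(1,2)])
      fix k assume k: "k < n"
      have "x k j = y k j" using fun_cong[OF that(3), of k] k unfolding q_def by simp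
      moreover have "x k \<in> carrier L" "y k \<in> carrier L" using that k by auto
      ultimately show "x k i = y k i" using L_compat[OF _ ij] by metis
    qed
    define f' where "f' = (\<lambda>v\<in>tuples (G j) n. f (SOME x. x \<in> tuples L n \<and> q x = v))"
    have f': "f' (q x) = f x" if x: "x \<in> tuples L n" for x
    proof -
      have "(SOME z. z \<in> tuples L n \<and> q z = q x) \<in> tuples L n \<and> q (SOME z. z \<in> tuples L n \<and> q z = q x) = q x"
        by (rule someI[where P = "\<lambda>z. z \<in> tuples L n \<and> q z = q x", of x]) (use x in simp)
      moreover have "q x \<in> tuples (G j) n" using q(2) x by blast
      ultimately show ?thesis using fq[OF _ x] unfolding f'_def by simp
    qed
    have quot: "quotient_map (Y n) (product_topology (\<lambda>_. T j) {..<n}) q"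
    proof (rule T1_Spaces.continuous_imp_quotient_map[OF q(1)])
      show "compact_space (Y n)" unfolding compact_space_product_topology using compact_TL by blast
      show "Hausdorff_space (product_topology (\<lambda>_. T j) {..<n})"
        unfolding Hausdorff_space_product_topology using Hausdorff[OF j] by blast
      show "q ` topspace (Y n) = topspace (product_topology (\<lambda>_. T j) {..<n})"
        unfolding topspace_Y q(2) by (simp add: top_eq[OF j])
    qed
    have "continuous_map (Y n) (discrete_topology U) (f' \<circ> q)"
      by (rule continuous_map_eq[OF f]) (use f' topspace_Y[of n] in auto)
    then have "continuous_map (product_topology (\<lambda>_. T j) {..<n}) (discrete_topology U) f'"
      by (rule continuous_compose_quotient_map[OF quot])
    moreover have "f' \<in> extensional (tuples (G j) n)" unfolding f'_def by simp
    ultimately show ?thesis using f' unfolding q_def by (intro bexI[of _ f']) auto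
  qed
  then show ?thesis using i by blast
qed

end

section \<open>Directed unions of cochain algebras\<close>

text \<open>Evaluates operations on cosets, which are defined as unions over representatives, once
  the individual terms are known to agree.\<close>

lemma UN_eq_const:
  assumes "a \<in> A" "\<And>x. x \<in> A \<Longrightarrow> f x = K"
  shows "(\<Union>x\<in>A. f x) = K"
  using assms by auto

lemma UN_UN_eq_const:
  assumes "a \<in> A" "b \<in> B" "\<And>x y. \<lbrakk>x \<in> A; y \<in> B\<rbrakk> \<Longrightarrow> f x y = K"
  shows "(\<Union>x\<in>A. \<Union>y\<in>B. f x y) = K"
  by (rule UN_eq_const[OF assms(1)], rule UN_eq_const[OF assms(2)]) (rule assms(3))

text \<open>\<open>W\<close> is an ambient additive group with a multiplication and a scalar multiplication about which
  nothing but closure is known, \<open>C\<close> is the subgroup of cochains and \<open>d\<close> the differential. That \<open>d\<close> squares to zero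
  and is a derivation is not needed: the hypothesis that the cohomology is a graded algebra already
  implies that products of cocycles have a well-defined class.\<close>

locale cochain_system = abelian_group W
  for R :: "('r, 'c) ring_scheme" and W :: "('r, 'x) graded_algebra" (structure) +
  fixes C :: "'x set" and d :: "'x \<Rightarrow> 'x"
  assumes C_subgroup: "additive_subgroup C W"
    and d_closed: "c \<in> C \<Longrightarrow> d c \<in> carrier W"
    and d_add: "\<lbrakk>c \<in> C; e \<in> C\<rbrakk> \<Longrightarrow> d (c \<oplus> e) = d c \<oplus> d e"
    and mult_closed: "\<lbrakk>x \<in> carrier W; y \<in> carrier W\<rbrakk> \<Longrightarrow> x \<otimes> y \<in> carrier W"
    and smult_closed: "\<lbrakk>s \<in> carrier R; x \<in> carrier W\<rbrakk> \<Longrightarrow> s \<odot> x \<in> carrier W"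
    and one_closed: "\<one> \<in> carrier W"
    and grade_C: "grade W n \<subseteq> C"
begin

definition Z where "Z = {c \<in> C. d c = \<zero>}"
definition B where "B = d ` C"
definition D where "D = W\<lparr>carrier := Z, grade := \<lambda>n. grade W n \<inter> Z\<rparr>"
definition H where "H = quotient_algebra D B"
definition cls where "cls x = B +> x"

lemma C_subset: "C \<subseteq> carrier W"
  by (rule additive_subgroup.a_subset[OF C_subgroup])

lemma Z_carrier: "z \<in> Z \<Longrightarrow> z \<in> carrier W"
  unfolding Z_def using C_subset by blast

lemma d_zero: "d \<zero> = \<zero>"
proof -
  interpret C: additive_subgroup C W by (rule C_subgroup)
  have "d \<zero> \<oplus> d \<zero> = d (\<zero> \<oplus> \<zero>)" by (rule d_add[symmetric, OF C.zero_closed C.zero_closed])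
  then have "d \<zero> \<oplus> d \<zero> = d \<zero>" by simp
  then show ?thesis using d_closed[OF C.zero_closed] by (simp only: add.l_cancel_one)
qed

lemma d_minus:
  assumes "c \<in> C"
  shows "d (\<ominus> c) = \<ominus> d c"
proof -
  interpret C: additive_subgroup C W by (rule C_subgroup)
  have c: "c \<in> carrier W" using assms C_subset by blast
  have "d (\<ominus> c) \<oplus> d c = d (\<ominus> c \<oplus> c)" by (rule d_add[symmetric, OF C.a_inv_closed[OF assms] assms])
  then have "d (\<ominus> c) \<oplus> d c = \<zero>" using c by (simp add: l_neg d_zero)
  then show ?thesis
    by (rule minus_equality[symmetric, OF _ d_closed[OF assms] d_closed[OF C.a_inv_closed[OF assms]]])
qed

text \<open>Classes are formed as cosets in the ambient group, so \<open>B\<close> is treated as a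
  subgroup of \<open>W\<close> and not of \<open>Z\<close>.\<close>

lemma B_subgroup: "additive_subgroup B W"
proof (rule additive_subgroupI, rule add.subgroupI)
  interpret C: additive_subgroup C W by (rule C_subgroup)
  show "B \<subseteq> carrier W" unfolding B_def using d_closed by blast
  show "B \<noteq> {}" unfolding B_def using C.zero_closed by blast
  fix b assume "b \<in> B"
  then obtain c where c: "c \<in> C" "b = d c" unfolding B_def by blast
  show "\<ominus> b \<in> B" unfolding B_def c(2) d_minus[OF c(1), symmetric] using C.a_inv_closed[OF c(1)] by blast
  fix b' assume "b' \<in> B"
  then obtain c' where c': "c' \<in> C" "b' = d c'" unfolding B_def by blast
  show "b \<oplus> b' \<in> B" unfolding B_def c(2) c'(2) d_add[OF c(1) c'(1), symmetric] using C.a_closed[OF c(1) c'(1)] by blast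
qed

sublocale B: abelian_subgroup B W
  by (rule abelian_subgroupI3[OF B_subgroup abelian_group_axioms])

lemma cls_D: "B +>\<^bsub>D\<^esub> x = cls x"
  unfolding cls_def a_r_coset_def' D_def by simp

lemma H_carrier: "carrier H = cls ` Z"
  unfolding H_def quotient_algebra_simps cls_D by (simp add: D_def)

lemma H_one: "\<one>\<^bsub>H\<^esub> = cls \<one>"
  unfolding H_def quotient_algebra_simps cls_D by (simp add: D_def)

lemma H_zero: "\<zero>\<^bsub>H\<^esub> = cls \<zero>"
  unfolding H_def quotient_algebra_simps cls_def by (rule a_coset_add_zero[OF B.a_subset, symmetric])

lemma H_grade: "grade H n = cls ` (grade W n \<inter> Z)"
  unfolding H_def quotient_algebra_simps cls_D by (simp add: D_def)

lemma H_add: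
  assumes "x \<in> carrier W" "y \<in> carrier W"
  shows "cls x \<oplus>\<^bsub>H\<^esub> cls y = cls (x \<oplus> y)"
proof -
  have "set_add D X Y = set_add W X Y" for X Y
    unfolding set_add_def set_mult_def D_def by simp
  then show ?thesis
    unfolding H_def quotient_algebra_simps cls_def using B.a_rcos_sum[OF assms] by simp
qed

lemma H_mult: "X \<otimes>\<^bsub>H\<^esub> Y = (\<Union>x\<in>X. \<Union>y\<in>Y. cls (x \<otimes> y))"
  unfolding H_def quotient_algebra_simps rcoset_mult_def cls_D by (simp add: D_def)

lemma H_smult: "s \<odot>\<^bsub>H\<^esub> X = (\<Union>x\<in>X. cls (s \<odot> x))"
  unfolding H_def quotient_algebra_simps cls_D by (simp add: D_def)

lemma cls_self: "x \<in> carrier W \<Longrightarrow> x \<in> cls x"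
  unfolding cls_def by (rule B.a_rcos_self)

lemma cls_memE:
  assumes "x \<in> cls z"
  obtains b where "b \<in> B" "x = b \<oplus> z"
  using assms unfolding cls_def a_r_coset_def' by blast

lemma cls_subset: "x \<in> carrier W \<Longrightarrow> cls x \<subseteq> carrier W"
  unfolding cls_def by (rule a_r_coset_subset_G[OF B.a_subset])

lemma cls_eqI: "\<lbrakk>y \<in> cls x; x \<in> carrier W\<rbrakk> \<Longrightarrow> cls y = cls x"
  unfolding cls_def by (rule a_repr_independence[symmetric, OF _ _ B.a_subgroup])

lemma cls_shift: "\<lbrakk>b \<in> B; x \<in> carrier W\<rbrakk> \<Longrightarrow> cls (b \<oplus> x) = cls x"
  by (rule cls_eqI) (auto simp: cls_def a_r_coset_def')

lemma cls_eq_iff: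
  assumes "x \<in> carrier W" "y \<in> carrier W"
  shows "cls x = cls y \<longleftrightarrow> x \<ominus> y \<in> B"
proof
  assume "cls x = cls y"
  then have "x \<in> cls y" using cls_self[OF assms(1)] by simp
  then obtain b where b: "b \<in> B" "x = b \<oplus> y" by (rule cls_memE)
  have "b \<in> carrier W" using b(1) B.a_subset by blast
  then have "x \<ominus> y = b" unfolding b(2) a_minus_def using assms(2) by (simp add: a_assoc r_neg)
  then show "x \<ominus> y \<in> B" using b(1) by simp
next
  assume *: "x \<ominus> y \<in> B"
  have "x = (x \<ominus> y) \<oplus> y" unfolding a_minus_def using assms by (simp add: a_assoc l_neg)
  then show "cls x = cls y" using cls_shift[OF * assms(2)] by simp
qed

text \<open>A set of this form is a single class as soon as it is contained in one: this turns closure of the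
  operations of \<open>H\<close> into their compatibility with classes.\<close>

lemma cls_eq_of_UN:
  assumes "(\<Union>x\<in>X. cls (f x)) \<in> carrier H" "x \<in> X" "y \<in> X" "f x \<in> carrier W" "f y \<in> carrier W"
  shows "cls (f x) = cls (f y)"
proof -
  obtain w where w: "w \<in> Z" "(\<Union>x\<in>X. cls (f x)) = cls w" using assms(1) unfolding H_carrier by blast
  have "f x \<in> cls w" "f y \<in> cls w" using assms(2-5) cls_self w(2) by blast+
  then show ?thesis using cls_eqI[OF _ Z_carrier[OF w(1)]] by metis
qed

end

section \<open>Operations on classes, given that cohomology is a graded algebra\<close>

locale graded_cochain_system = cochain_system +
  assumes graded: "graded_algebra R H"
begin

text \<open>The product of the two classes is by definition a union of classes, and closure of
  \<open>H\<close> under multiplication says that this union is one class. All its constituents must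
  then coincide.\<close>

lemma mult_cong:
  assumes z: "z \<in> Z" "z' \<in> Z" and x: "x \<in> cls z" "x' \<in> cls z'"
  shows "cls (x \<otimes> x') = cls (z \<otimes> z')"
proof -
  interpret H: graded_algebra R H by (rule graded)
  have c: "z \<in> carrier W" "z' \<in> carrier W" "x \<in> carrier W" "x' \<in> carrier W"
    using Z_carrier z cls_subset x by blast+
  have "cls z \<otimes>\<^bsub>H\<^esub> cls z' \<in> carrier H" by (rule H.m_closed) (use z H_carrier in auto)
  \<comment> \<open>The double union becomes a single one over pairs, the form in which
    \<open>cls_eq_of_UN\<close> applies.\<close>
  then have "(\<Union>p\<in>cls z \<times> cls z'. cls (fst p \<otimes> snd p)) \<in> carrier H"
    unfolding H_mult Sigma_def by (simp only: UN_simps UN_insert UN_empty fst_conv snd_conv Un_empty_right)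
  from cls_eq_of_UN[OF this, of "(x, x')" "(z, z')"] show ?thesis
    using x cls_self c mult_closed by simp
qed

lemma smult_cong:
  assumes s: "s \<in> carrier R" and z: "z \<in> Z" and x: "x \<in> cls z"
  shows "cls (s \<odot> x) = cls (s \<odot> z)"
proof -
  interpret H: graded_algebra R H by (rule graded)
  have c: "z \<in> carrier W" "x \<in> carrier W" using Z_carrier z cls_subset x by blast+
  have "s \<odot>\<^bsub>H\<^esub> cls z \<in> carrier H" by (rule H.smult_closed[OF s]) (use z H_carrier in auto)
  from cls_eq_of_UN[OF this[unfolded H_smult], of x z] show ?thesis
    using x cls_self[OF c(1)] c smult_closed[OF s] by blast
qed

lemma H_mult_cls: "\<lbrakk>z \<in> Z; z' \<in> Z\<rbrakk> \<Longrightarrow> cls z \<otimes>\<^bsub>H\<^esub> cls z' = cls (z \<otimes> z')"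
  unfolding H_mult
  by (rule UN_UN_eq_const[OF cls_self[OF Z_carrier] cls_self[OF Z_carrier]])
    (assumption | rule mult_cong)+

lemma H_smult_cls: "\<lbrakk>s \<in> carrier R; z \<in> Z\<rbrakk> \<Longrightarrow> s \<odot>\<^bsub>H\<^esub> cls z = cls (s \<odot> z)"
  unfolding H_smult
  by (rule UN_eq_const[OF cls_self[OF Z_carrier]]) (assumption | rule smult_cong)+

end

section \<open>Injective maps of cochain systems and the induced maps on classes\<close>

locale cochain_embedding = U: cochain_system R U C d + W: cochain_system R W E e
  for R :: "('r, 'c) ring_scheme"
    and U :: "('r, 'x) graded_algebra" and C d
    and W :: "('r, 'y) graded_algebra" and E e +
  fixes P :: "'x \<Rightarrow> 'y"
  assumes P_closed: "x \<in> carrier U \<Longrightarrow> P x \<in> carrier W"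
    and P_add: "\<lbrakk>x \<in> carrier U; y \<in> carrier U\<rbrakk> \<Longrightarrow> P (x \<oplus>\<^bsub>U\<^esub> y) = P x \<oplus>\<^bsub>W\<^esub> P y"
    and P_mult: "\<lbrakk>x \<in> carrier U; y \<in> carrier U\<rbrakk> \<Longrightarrow> P (x \<otimes>\<^bsub>U\<^esub> y) = P x \<otimes>\<^bsub>W\<^esub> P y"
    and P_smult: "\<lbrakk>s \<in> carrier R; x \<in> carrier U\<rbrakk> \<Longrightarrow> P (s \<odot>\<^bsub>U\<^esub> x) = s \<odot>\<^bsub>W\<^esub> P x"
    and P_one: "P \<one>\<^bsub>U\<^esub> = \<one>\<^bsub>W\<^esub>"
    and P_inj: "inj_on P (carrier U)"
    and P_cochain: "c \<in> C \<Longrightarrow> P c \<in> E"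
    and P_d: "c \<in> C \<Longrightarrow> P (d c) = e (P c)"
    and P_grade: "c \<in> grade U n \<Longrightarrow> P c \<in> grade W n"
begin

lemma P_zero: "P \<zero>\<^bsub>U\<^esub> = \<zero>\<^bsub>W\<^esub>"
proof -
  have c: "P \<zero>\<^bsub>U\<^esub> \<in> carrier W" by (rule P_closed) simp
  have "P \<zero>\<^bsub>U\<^esub> \<oplus>\<^bsub>W\<^esub> P \<zero>\<^bsub>U\<^esub> = P \<zero>\<^bsub>U\<^esub>" using P_add[of "\<zero>\<^bsub>U\<^esub>" "\<zero>\<^bsub>U\<^esub>"] by simp
  then show ?thesis using c by (simp only: W.add.l_cancel_one)
qed

lemma P_minus:
  assumes "x \<in> carrier U" "y \<in> carrier U"
  shows "P (x \<ominus>\<^bsub>U\<^esub> y) = P x \<ominus>\<^bsub>W\<^esub> P y"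
proof -
  have m: "x \<ominus>\<^bsub>U\<^esub> y \<in> carrier U" by (rule U.minus_closed[OF assms])
  have "(x \<ominus>\<^bsub>U\<^esub> y) \<oplus>\<^bsub>U\<^esub> y = x" unfolding a_minus_def using assms by (simp add: U.a_assoc U.l_neg)
  then have "P (x \<ominus>\<^bsub>U\<^esub> y) \<oplus>\<^bsub>W\<^esub> P y = P x" using P_add[OF m assms(2)] by simp
  then show ?thesis
    unfolding a_minus_def[of W] using P_closed[OF m] P_closed[OF assms(1)] P_closed[OF assms(2)]
    by (metis W.add.inv_solve_right)
qed

text \<open>As \<open>P\<close> is injective and commutes with the differentials, it reflects
  cocycles as well as preserving them. Coboundaries are in general only preserved, so the induced
  map on classes may still fail to be injective.\<close>

lemma P_Z_iff:
  assumes "c \<in> C"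
  shows "P c \<in> W.Z \<longleftrightarrow> c \<in> U.Z"
proof -
  have "P (d c) = P \<zero>\<^bsub>U\<^esub> \<longleftrightarrow> d c = \<zero>\<^bsub>U\<^esub>"
    by (rule inj_on_eq_iff[OF P_inj U.d_closed[OF assms]]) simp
  then show ?thesis
    unfolding W.Z_def U.Z_def using assms P_cochain[OF assms] by (simp add: P_d[OF assms, symmetric] P_zero[symmetric])
qed

lemma P_Z: "z \<in> U.Z \<Longrightarrow> P z \<in> W.Z"
  using P_Z_iff unfolding U.Z_def by blast

lemma P_B: "b \<in> U.B \<Longrightarrow> P b \<in> W.B"
  unfolding U.B_def W.B_def using P_d P_cochain by auto

text \<open>Has the shape of \<open>inflation\<close>, with which it is identified in
  \<open>inflation_eq\<close>.\<close>

definition map where "map X = (\<Union>x\<in>X. W.cls (P x))"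

lemma map_cls:
  assumes z: "z \<in> carrier U"
  shows "map (U.cls z) = W.cls (P z)"
proof -
  have "W.cls (P x) = W.cls (P z)" if x: "x \<in> U.cls z" for x
  proof -
    obtain b where b: "b \<in> U.B" "x = b \<oplus>\<^bsub>U\<^esub> z" by (rule U.cls_memE[OF x])
    have "b \<in> carrier U" using b(1) U.B.a_subset by blast
    then have "P x = P b \<oplus>\<^bsub>W\<^esub> P z" unfolding b(2) by (rule P_add[OF _ z])
    then show ?thesis using W.cls_shift[OF P_B[OF b(1)] P_closed[OF z]] by simp
  qed
  then show ?thesis unfolding map_def by (rule UN_eq_const[OF U.cls_self[OF z]])
qed

end

section \<open>Cohomology of a directed union of cochain systems\<close>

locale cochain_limit = W: cochain_system R W E e
  for R :: "('r, 'c) ring_scheme" and W :: "('r, 'y) graded_algebra" and E e +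
  fixes I :: "'i set" and r :: "'i rel"
    and U :: "'i \<Rightarrow> ('r, 'x) graded_algebra" and C :: "'i \<Rightarrow> 'x set" and d :: "'i \<Rightarrow> 'x \<Rightarrow> 'x"
    and P :: "'i \<Rightarrow> 'x \<Rightarrow> 'y" and Q :: "'i \<Rightarrow> 'i \<Rightarrow> 'x \<Rightarrow> 'x"
  assumes directed: "directed_on I r"
    and P_embedding: "i \<in> I \<Longrightarrow> cochain_embedding R (U i) (C i) (d i) W E e (P i)"
    and Q_embedding: "(i, j) \<in> r \<Longrightarrow>
      cochain_embedding R (U i) (C i) (d i) (U j) (C j) (d j) (Q i j)"
    and P_Q: "\<lbrakk>(i, j) \<in> r; x \<in> carrier (U i)\<rbrakk> \<Longrightarrow> P j (Q i j x) = P i x"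
    and connected: "i \<in> I \<Longrightarrow> connected_graded_algebra R (cochain_system.H (U i) (C i) (d i))"
    and Q_map_inj: "(i, j) \<in> r \<Longrightarrow> inj_on (cochain_embedding.map (U j) (C j) (d j) (Q i j))
      (carrier (cochain_system.H (U i) (C i) (d i)))"
    and E_eq: "E = (\<Union>i\<in>I. P i ` C i)"
    and grade_eq: "grade W n = (\<Union>i\<in>I. P i ` grade (U i) n)"
begin

abbreviation clsU where "clsU i \<equiv> cochain_system.cls (U i) (C i) (d i)"
abbreviation ZU where "ZU i \<equiv> cochain_system.Z (U i) (C i) (d i)"
abbreviation HU where "HU i \<equiv> cochain_system.H (U i) (C i) (d i)"
definition lam where "lam i = cochain_embedding.map W E e (P i)"

lemma rI: "(i, j) \<in> r \<Longrightarrow> i \<in> I \<and> j \<in> I"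
  using directed unfolding directed_on_def preorder_on_def by blast

lemma graded_U: "i \<in> I \<Longrightarrow> graded_cochain_system R (U i) (C i) (d i)"
proof -
  assume i: "i \<in> I"
  interpret P: cochain_embedding R "U i" "C i" "d i" W E e "P i" by (rule P_embedding[OF i])
  show ?thesis
    using P.U.cochain_system_axioms connected[OF i]
    by (simp add: graded_cochain_system_def graded_cochain_system_axioms_def connected_graded_algebra_def)
qed

lemma lam_cls:
  assumes "i \<in> I" "x \<in> carrier (U i)"
  shows "lam i (clsU i x) = W.cls (P i x)"
  unfolding lam_def by (rule cochain_embedding.map_cls[OF P_embedding[OF assms(1)] assms(2)])

text \<open>A representative of the class of \<open>P i z\<close> differs from it by the coboundary
  of one cochain, and this cochain comes from some level \<open>k\<close>. Above both
  \<open>k\<close> and \<open>i\<close> the representative itself comes from the level. The claim is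
  made for all such levels in order to lift two representatives simultaneously.\<close>

lemma lift_cls:
  assumes i: "i \<in> I" and z: "z \<in> ZU i" and x: "x \<in> W.cls (P i z)"
  shows "\<exists>k\<in>I. \<forall>j. (k, j) \<in> r \<longrightarrow> (i, j) \<in> r \<longrightarrow> (\<exists>y\<in>clsU j (Q i j z). x = P j y)"
proof -
  obtain b where b: "b \<in> W.B" "x = b \<oplus>\<^bsub>W\<^esub> P i z" by (rule W.cls_memE[OF x])
  then obtain c where c: "c \<in> E" "b = e c" unfolding W.B_def by blast
  then obtain k c' where k: "k \<in> I" and c': "c' \<in> C k" "c = P k c'" unfolding E_eq by blast
  have "\<exists>y\<in>clsU j (Q i j z). x = P j y" if kj: "(k, j) \<in> r" and ij: "(i, j) \<in> r" for j
  proof -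
    have j: "j \<in> I" using rI[OF kj] by blast
    interpret Pj: cochain_embedding R "U j" "C j" "d j" W E e "P j" by (rule P_embedding[OF j])
    interpret Qi: cochain_embedding R "U i" "C i" "d i" "U j" "C j" "d j" "Q i j" by (rule Q_embedding[OF ij])
    interpret Qk: cochain_embedding R "U k" "C k" "d k" "U j" "C j" "d j" "Q k j" by (rule Q_embedding[OF kj])
    have zc: "z \<in> carrier (U i)" by (rule Qi.U.Z_carrier[OF z])
    have q: "Q k j c' \<in> C j" by (rule Qk.P_cochain[OF c'(1)])
    have c'U: "c' \<in> carrier (U k)" using c'(1) Qk.U.C_subset by blast
    have "P j (d j (Q k j c') \<oplus>\<^bsub>U j\<^esub> Q i j z) = P j (d j (Q k j c')) \<oplus>\<^bsub>W\<^esub> P j (Q i j z)"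
      by (rule Pj.P_add[OF Pj.U.d_closed[OF q] Qi.P_closed[OF zc]])
    also have "\<dots> = x"
      unfolding Pj.P_d[OF q] P_Q[OF kj c'U] P_Q[OF ij zc] b(2) c(2) c'(2) ..
    finally have "x = P j (d j (Q k j c') \<oplus>\<^bsub>U j\<^esub> Q i j z)" ..
    moreover have "d j (Q k j c') \<oplus>\<^bsub>U j\<^esub> Q i j z \<in> clsU j (Q i j z)"
      unfolding Pj.U.cls_def a_r_coset_def' Pj.U.B_def using q by blast
    ultimately show ?thesis by blast
  qed
  then show ?thesis using k by blast
qed

text \<open>Both representatives are lifted to a common level \<open>j\<close>, where products of
  classes are well defined since the cohomology there is a graded algebra; the result is then mapped
  back to \<open>W\<close>. This is how the multiplication of the limit becomes
  single-valued.\<close>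

lemma W_mult_cong:
  assumes i: "i \<in> I" and z: "z \<in> ZU i" "z' \<in> ZU i"
    and x: "x \<in> W.cls (P i z)" "x' \<in> W.cls (P i z')"
  shows "W.cls (x \<otimes>\<^bsub>W\<^esub> x') = W.cls (P i (z \<otimes>\<^bsub>U i\<^esub> z'))"
proof -
  obtain k where k: "k \<in> I" "\<forall>j. (k, j) \<in> r \<longrightarrow> (i, j) \<in> r \<longrightarrow> (\<exists>y\<in>clsU j (Q i j z). x = P j y)"
    using lift_cls[OF i z(1) x(1)] by (rule bexE)
  obtain k' where k': "k' \<in> I" "\<forall>j. (k', j) \<in> r \<longrightarrow> (i, j) \<in> r \<longrightarrow> (\<exists>y\<in>clsU j (Q i j z'). x' = P j y)"
    using lift_cls[OF i z(2) x(2)] by (rule bexE)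
  obtain j where j: "j \<in> I" "\<And>l. l \<in> {i, k, k'} \<Longrightarrow> (l, j) \<in> r"
    by (rule directed_finite_bound[OF directed, of "{i, k, k'}"]) (use i k k' in auto)
  have ij: "(i, j) \<in> r" using j(2) by simp
  interpret Uj: graded_cochain_system R "U j" "C j" "d j" by (rule graded_U[OF j(1)])
  interpret Pj: cochain_embedding R "U j" "C j" "d j" W E e "P j" by (rule P_embedding[OF j(1)])
  interpret Qi: cochain_embedding R "U i" "C i" "d i" "U j" "C j" "d j" "Q i j" by (rule Q_embedding[OF ij])
  obtain y where y: "y \<in> clsU j (Q i j z)" "x = P j y" using k(2) j(2) by blast
  obtain y' where y': "y' \<in> clsU j (Q i j z')" "x' = P j y'" using k'(2) j(2) by blast
  note qz = Qi.P_Z[OF z(1)] Qi.P_Z[OF z(2)]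
  note qc = Uj.Z_carrier[OF qz(1)] Uj.Z_carrier[OF qz(2)]
  note zc = Qi.U.Z_carrier[OF z(1)] Qi.U.Z_carrier[OF z(2)]
  have yc: "y \<in> carrier (U j)" "y' \<in> carrier (U j)"
    using y(1) y'(1) Uj.cls_subset[OF qc(1)] Uj.cls_subset[OF qc(2)] by blast+
  have "W.cls (x \<otimes>\<^bsub>W\<^esub> x') = lam j (clsU j (y \<otimes>\<^bsub>U j\<^esub> y'))"
    unfolding lam_cls[OF j(1) Uj.mult_closed[OF yc]] Pj.P_mult[OF yc] y(2) y'(2) ..
  also have "\<dots> = lam j (clsU j (Q i j z \<otimes>\<^bsub>U j\<^esub> Q i j z'))"
    unfolding Uj.mult_cong[OF qz y(1) y'(1)] ..
  also have "\<dots> = W.cls (P i (z \<otimes>\<^bsub>U i\<^esub> z'))"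
    unfolding lam_cls[OF j(1) Uj.mult_closed[OF qc]]
    unfolding Qi.P_mult[OF zc, symmetric] P_Q[OF ij Qi.U.mult_closed[OF zc]] ..
  finally show ?thesis .
qed

text \<open>The same descent to one level, with a single representative.\<close>

lemma W_smult_cong:
  assumes i: "i \<in> I" and s: "s \<in> carrier R" and z: "z \<in> ZU i" and x: "x \<in> W.cls (P i z)"
  shows "W.cls (s \<odot>\<^bsub>W\<^esub> x) = W.cls (P i (s \<odot>\<^bsub>U i\<^esub> z))"
proof -
  obtain k where k: "k \<in> I" "\<forall>j. (k, j) \<in> r \<longrightarrow> (i, j) \<in> r \<longrightarrow> (\<exists>y\<in>clsU j (Q i j z). x = P j y)"
    using lift_cls[OF i z x] by (rule bexE)
  obtain j where j: "j \<in> I" "\<And>l. l \<in> {i, k} \<Longrightarrow> (l, j) \<in> r"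
    by (rule directed_finite_bound[OF directed, of "{i, k}"]) (use i k in auto)
  have ij: "(i, j) \<in> r" using j(2) by simp
  interpret Uj: graded_cochain_system R "U j" "C j" "d j" by (rule graded_U[OF j(1)])
  interpret Pj: cochain_embedding R "U j" "C j" "d j" W E e "P j" by (rule P_embedding[OF j(1)])
  interpret Qi: cochain_embedding R "U i" "C i" "d i" "U j" "C j" "d j" "Q i j" by (rule Q_embedding[OF ij])
  obtain y where y: "y \<in> clsU j (Q i j z)" "x = P j y" using k(2) j(2) by blast
  note qz = Qi.P_Z[OF z]
  note qc = Uj.Z_carrier[OF qz]
  note zc = Qi.U.Z_carrier[OF z]
  have yc: "y \<in> carrier (U j)" using y(1) Uj.cls_subset[OF qc] by blast
  have "W.cls (s \<odot>\<^bsub>W\<^esub> x) = lam j (clsU j (s \<odot>\<^bsub>U j\<^esub> y))"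
    unfolding lam_cls[OF j(1) Uj.smult_closed[OF s yc]] Pj.P_smult[OF s yc] y(2) ..
  also have "\<dots> = lam j (clsU j (s \<odot>\<^bsub>U j\<^esub> Q i j z))"
    unfolding Uj.smult_cong[OF s qz y(1)] ..
  also have "\<dots> = W.cls (P i (s \<odot>\<^bsub>U i\<^esub> z))"
    unfolding lam_cls[OF j(1) Uj.smult_closed[OF s qc]]
    unfolding Qi.P_smult[OF s zc, symmetric] P_Q[OF ij Qi.U.smult_closed[OF s zc]] ..
  finally show ?thesis .
qed

text \<open>If two classes of level \<open>i\<close> become equal in the limit, their difference is
  the coboundary of a cochain from some level \<open>k\<close>. At a level \<open>j\<close> above
  both, injectivity of \<open>P j\<close> on cochains shows that it is a coboundary already there.
  So the classes agree at level \<open>j\<close>, and the injective map on cohomology from level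
  \<open>i\<close> to level \<open>j\<close> finishes.\<close>

lemma lam_inj:
  assumes i: "i \<in> I"
  shows "inj_on (lam i) (carrier (HU i))"
proof (rule inj_onI)
  interpret Ui: graded_cochain_system R "U i" "C i" "d i" by (rule graded_U[OF i])
  fix X Y assume "X \<in> carrier (HU i)" "Y \<in> carrier (HU i)" and eq: "lam i X = lam i Y"
  then obtain z z' where z: "z \<in> ZU i" "z' \<in> ZU i" and X: "X = clsU i z" and Y: "Y = clsU i z'"
    unfolding Ui.H_carrier by blast
  note zc = Ui.Z_carrier[OF z(1)] Ui.Z_carrier[OF z(2)]
  interpret Pi: cochain_embedding R "U i" "C i" "d i" W E e "P i" by (rule P_embedding[OF i])
  have "W.cls (P i z) = W.cls (P i z')" using eq unfolding X Y lam_cls[OF i zc(1)] lam_cls[OF i zc(2)] .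
  then have "P i z \<ominus>\<^bsub>W\<^esub> P i z' \<in> W.B" using W.cls_eq_iff[OF Pi.P_closed[OF zc(1)] Pi.P_closed[OF zc(2)]] by blast
  then obtain c where c: "c \<in> E" "P i z \<ominus>\<^bsub>W\<^esub> P i z' = e c" unfolding W.B_def by blast
  then obtain k c' where k: "k \<in> I" and c': "c' \<in> C k" "c = P k c'" unfolding E_eq by blast
  obtain j where j: "j \<in> I" "(i, j) \<in> r" "(k, j) \<in> r"
    using directed i k unfolding directed_on_def by blast
  interpret Pj: cochain_embedding R "U j" "C j" "d j" W E e "P j" by (rule P_embedding[OF j(1)])
  interpret Qi: cochain_embedding R "U i" "C i" "d i" "U j" "C j" "d j" "Q i j" by (rule Q_embedding[OF j(2)])
  interpret Qk: cochain_embedding R "U k" "C k" "d k" "U j" "C j" "d j" "Q k j" by (rule Q_embedding[OF j(3)])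
  have q: "Q k j c' \<in> C j" by (rule Qk.P_cochain[OF c'(1)])
  have c'U: "c' \<in> carrier (U k)" using c'(1) Qk.U.C_subset by blast
  note qc = Qi.P_closed[OF zc(1)] Qi.P_closed[OF zc(2)]
  have "P j (Q i j z \<ominus>\<^bsub>U j\<^esub> Q i j z') = P i z \<ominus>\<^bsub>W\<^esub> P i z'"
    unfolding Pj.P_minus[OF qc] P_Q[OF j(2) zc(1)] P_Q[OF j(2) zc(2)] ..
  also have "\<dots> = P j (d j (Q k j c'))" unfolding c(2) c'(2) Pj.P_d[OF q] P_Q[OF j(3) c'U] ..
  finally have "Q i j z \<ominus>\<^bsub>U j\<^esub> Q i j z' = d j (Q k j c')"
    by (rule inj_onD[OF Pj.P_inj _ Pj.U.minus_closed[OF qc] Pj.U.d_closed[OF q]])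
  then have "Q i j z \<ominus>\<^bsub>U j\<^esub> Q i j z' \<in> Pj.U.B" unfolding Pj.U.B_def using q by blast
  then have "clsU j (Q i j z) = clsU j (Q i j z')" using Pj.U.cls_eq_iff[OF qc] by blast
  then have "Qi.map X = Qi.map Y" unfolding X Y Qi.map_cls[OF zc(1)] Qi.map_cls[OF zc(2)] .
  then show "X = Y"
    by (rule inj_onD[OF Q_map_inj[OF j(2)]]) (use z X Y Ui.H_carrier in auto)
qed

lemma lam_image: "i \<in> I \<Longrightarrow> S \<subseteq> ZU i \<Longrightarrow> lam i ` clsU i ` S = W.cls ` P i ` S"
  unfolding image_image
proof (rule image_cong[OF refl])
  fix z assume i: "i \<in> I" and "S \<subseteq> ZU i" "z \<in> S"
  interpret Ui: graded_cochain_system R "U i" "C i" "d i" by (rule graded_U[OF i])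
  show "lam i (clsU i z) = W.cls (P i z)"
    by (rule lam_cls[OF i]) (use Ui.Z_carrier \<open>S \<subseteq> ZU i\<close> \<open>z \<in> S\<close> in blast)
qed

text \<open>Meant for \<open>S\<close> the set of all cochains and for \<open>S\<close> a
  homogeneous component: a cochain of some level that becomes a cocycle in \<open>W\<close> was a
  cocycle before.\<close>

lemma Z_eq: "S = (\<Union>i\<in>I. P i ` S' i) \<Longrightarrow> (\<And>i. i \<in> I \<Longrightarrow> S' i \<subseteq> C i) \<Longrightarrow>
  S \<inter> W.Z = (\<Union>i\<in>I. P i ` (S' i \<inter> ZU i))"
proof -
  assume S: "S = (\<Union>i\<in>I. P i ` S' i)" and sub: "\<And>i. i \<in> I \<Longrightarrow> S' i \<subseteq> C i"
  have "P i c \<in> W.Z \<longleftrightarrow> c \<in> ZU i" if "i \<in> I" "c \<in> S' i" for i c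
    by (rule cochain_embedding.P_Z_iff[OF P_embedding[OF that(1)]]) (use sub that in blast)
  then show ?thesis unfolding S by blast
qed

lemma directed_union: "algebra_directed_union R W.H I r HU lam"
proof (rule algebra_directed_union.intro)
  show "directed_on I r" by (rule directed)
next
  fix i assume i: "i \<in> I"
  show "connected_graded_algebra R (HU i)" by (rule connected[OF i])
  interpret U: graded_cochain_system R "U i" "C i" "d i" by (rule graded_U[OF i])
  interpret P: cochain_embedding R "U i" "C i" "d i" W E e "P i" by (rule P_embedding[OF i])
  show "inj_on (lam i) (carrier (HU i))" by (rule lam_inj[OF i])
  show "lam i \<one>\<^bsub>HU i\<^esub> = \<one>\<^bsub>W.H\<^esub>"
    unfolding U.H_one W.H_one lam_cls[OF i U.one_closed] P.P_one ..
  show "lam i \<zero>\<^bsub>HU i\<^esub> = \<zero>\<^bsub>W.H\<^esub>"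
    unfolding U.H_zero W.H_zero lam_cls[OF i U.zero_closed] P.P_zero ..
  fix X assume "X \<in> carrier (HU i)"
  then obtain z where z: "z \<in> ZU i" "X = clsU i z" unfolding U.H_carrier by blast
  note zc = U.Z_carrier[OF z(1)]
  have lX: "lam i X = W.cls (P i z)" unfolding z(2) by (rule lam_cls[OF i zc])
  show "lam i X \<in> carrier W.H" unfolding lX W.H_carrier using P.P_Z[OF z(1)] by blast
  show "lam i (s \<odot>\<^bsub>HU i\<^esub> X) = s \<odot>\<^bsub>W.H\<^esub> lam i X" if s: "s \<in> carrier R" for s
  proof -
    have "lam i (s \<odot>\<^bsub>HU i\<^esub> X) = W.cls (P i (s \<odot>\<^bsub>U i\<^esub> z))"
      unfolding z(2) U.H_smult_cls[OF s z(1)] by (rule lam_cls[OF i U.smult_closed[OF s zc]])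
    moreover have "s \<odot>\<^bsub>W.H\<^esub> lam i X = W.cls (P i (s \<odot>\<^bsub>U i\<^esub> z))"
      unfolding lX W.H_smult
      by (rule UN_eq_const[OF W.cls_self[OF P.P_closed[OF zc]]]) (rule W_smult_cong[OF i s z(1)])
    ultimately show ?thesis by simp
  qed
  fix Y assume "Y \<in> carrier (HU i)"
  then obtain z' where z': "z' \<in> ZU i" "Y = clsU i z'" unfolding U.H_carrier by blast
  note zc' = U.Z_carrier[OF z'(1)]
  have lY: "lam i Y = W.cls (P i z')" unfolding z'(2) by (rule lam_cls[OF i zc'])
  show "lam i (X \<oplus>\<^bsub>HU i\<^esub> Y) = lam i X \<oplus>\<^bsub>W.H\<^esub> lam i Y"
    unfolding lX lY W.H_add[OF P.P_closed[OF zc] P.P_closed[OF zc']] P.P_add[OF zc zc', symmetric]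
      lam_cls[OF i U.a_closed[OF zc zc'], symmetric]
    unfolding z(2) z'(2) U.H_add[OF zc zc'] ..
  have "lam i (X \<otimes>\<^bsub>HU i\<^esub> Y) = W.cls (P i (z \<otimes>\<^bsub>U i\<^esub> z'))"
    unfolding z(2) z'(2) U.H_mult_cls[OF z(1) z'(1)] by (rule lam_cls[OF i U.mult_closed[OF zc zc']])
  moreover have "lam i X \<otimes>\<^bsub>W.H\<^esub> lam i Y = W.cls (P i (z \<otimes>\<^bsub>U i\<^esub> z'))"
    unfolding lX lY W.H_mult
    by (rule UN_UN_eq_const[OF W.cls_self[OF P.P_closed[OF zc]] W.cls_self[OF P.P_closed[OF zc']]])
      (rule W_mult_cong[OF i z(1) z'(1)])
  ultimately show "lam i (X \<otimes>\<^bsub>HU i\<^esub> Y) = lam i X \<otimes>\<^bsub>W.H\<^esub> lam i Y" by simp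
next
  fix i j assume ij: "(i, j) \<in> r"
  have i: "i \<in> I" and j: "j \<in> I" using rI[OF ij] by auto
  interpret Q: cochain_embedding R "U i" "C i" "d i" "U j" "C j" "d j" "Q i j" by (rule Q_embedding[OF ij])
  \<comment> \<open>One inclusion serves both the carriers and the homogeneous components; it rests
    on \<open>P i z\<close> being \<open>P j\<close> of the transported cocycle.\<close>
  have *: "lam i ` clsU i ` S \<subseteq> lam j ` clsU j ` S'" if "S \<subseteq> ZU i" "S' \<subseteq> ZU j" "Q i j ` S \<subseteq> S'" for S S'
    unfolding lam_image[OF i that(1)] lam_image[OF j that(2)]
  proof (rule image_mono, rule image_subsetI)
    fix z assume z: "z \<in> S"
    have "P i z = P j (Q i j z)" by (rule P_Q[OF ij, symmetric]) (use Q.U.Z_carrier that(1) z in blast)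
    then show "P i z \<in> P j ` S'" using that(3) z by blast
  qed
  show "lam i ` carrier (HU i) \<subseteq> lam j ` carrier (HU j)"
    unfolding Q.U.H_carrier Q.W.H_carrier by (rule *) (use Q.P_Z in blast)+
  show "lam i ` grade (HU i) n \<subseteq> lam j ` grade (HU j) n" for n
    unfolding Q.U.H_grade Q.W.H_grade by (rule *) (use Q.P_Z Q.P_grade in blast)+
next
  \<comment> \<open>Likewise one computation, with \<open>S\<close> to be instantiated by
    \<open>E\<close> and by the homogeneous components.\<close>
  have eq: "W.cls ` (S \<inter> W.Z) = (\<Union>i\<in>I. lam i ` clsU i ` (S' i \<inter> ZU i))"
    if "S = (\<Union>i\<in>I. P i ` S' i)" "\<And>i. i \<in> I \<Longrightarrow> S' i \<subseteq> C i" for S S'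
  proof -
    have "S \<inter> W.Z = (\<Union>i\<in>I. P i ` (S' i \<inter> ZU i))" by (rule Z_eq[OF that])
    then have "W.cls ` (S \<inter> W.Z) = (\<Union>i\<in>I. W.cls ` P i ` (S' i \<inter> ZU i))"
      by (simp only: image_UN)
    also have "\<dots> = (\<Union>i\<in>I. lam i ` clsU i ` (S' i \<inter> ZU i))"
      by (rule SUP_cong[OF refl]) (rule lam_image[symmetric], auto)
    finally show ?thesis .
  qed
  have H: "carrier (HU i) = clsU i ` (C i \<inter> ZU i)" "grade (HU i) n = clsU i ` (grade (U i) n \<inter> ZU i)"
    "grade (U i) n \<subseteq> C i" if "i \<in> I" for i n
  proof -
    interpret U: graded_cochain_system R "U i" "C i" "d i" by (rule graded_U[OF that])
    have "C i \<inter> ZU i = ZU i" unfolding U.Z_def by blast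
    then show "carrier (HU i) = clsU i ` (C i \<inter> ZU i)" using U.H_carrier by simp
    show "grade (HU i) n = clsU i ` (grade (U i) n \<inter> ZU i)" by (rule U.H_grade)
    show "grade (U i) n \<subseteq> C i" by (rule U.grade_C)
  qed
  have "E \<inter> W.Z = W.Z" unfolding W.Z_def by blast
  then have "carrier W.H = (\<Union>i\<in>I. lam i ` clsU i ` (C i \<inter> ZU i))"
    using eq[OF E_eq] W.H_carrier by simp
  then show "carrier W.H = (\<Union>i\<in>I. lam i ` carrier (HU i))" using H(1) by simp
  show "grade W.H n = (\<Union>i\<in>I. lam i ` grade (HU i) n)" for n
    using eq[OF grade_eq[of n] H(3)] H(2) unfolding W.H_grade by simp
qed

end

section \<open>Continuous cochains\<close>

text \<open>A product of two discrete spaces is discrete, so every operation on it is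
  continuous.\<close>

lemma continuous_map_discrete_binary:
  assumes "continuous_map X (discrete_topology U) f" "continuous_map X (discrete_topology U) g"
    and "\<And>a b. \<lbrakk>a \<in> U; b \<in> U\<rbrakk> \<Longrightarrow> h a b \<in> U"
  shows "continuous_map X (discrete_topology U) (\<lambda>x. h (f x) (g x))"
proof -
  have "continuous_map X (prod_topology (discrete_topology U) (discrete_topology U)) (\<lambda>x. (f x, g x))"
    using assms(1,2) by (rule continuous_map_paired[THEN iffD2, OF conjI])
  moreover have "continuous_map (prod_topology (discrete_topology U) (discrete_topology U))
      (discrete_topology U) (\<lambda>p. h (fst p) (snd p))"
    using assms(3) by (auto simp: prod_topology_discrete_topology[symmetric])
  ultimately show ?thesis by (auto dest: continuous_map_compose simp: comp_def)
qed

text \<open>All sequences of functions, continuous or not and with any support, as the ambient group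
  of \<open>cochain_system\<close>: closure under the operations and the differential is a pointwise
  matter here. The homogeneous components are still those of the continuous cochains.\<close>

definition raw_cochain_algebra ::
  "('r, 'c) ring_scheme \<Rightarrow> ('a, 'b) monoid_scheme \<Rightarrow> 'a topology
    \<Rightarrow> ('r, nat \<Rightarrow> (nat \<Rightarrow> 'a) \<Rightarrow> 'r) graded_algebra" where
  "raw_cochain_algebra R G T =
     (cochain_algebra R G T)\<lparr>carrier := {c. \<forall>n. c n \<in> tuples G n \<rightarrow>\<^sub>E carrier R}\<rparr>"

section \<open>Continuous cochains as a cochain system\<close>

locale continuous_cochains = R: cring R
  for R :: "('r, 'c) ring_scheme" and G :: "('a, 'b) monoid_scheme" and T :: "'a topology" +
  assumes mult_closed: "\<lbrakk>x \<in> carrier G; y \<in> carrier G\<rbrakk> \<Longrightarrow> x \<otimes>\<^bsub>G\<^esub> y \<in> carrier G"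
    and top: "topspace T = carrier G"
begin

abbreviation W where "W \<equiv> raw_cochain_algebra R G T"
abbreviation C where "C \<equiv> carrier (cochain_algebra R G T)"

lemma W_carrier: "c \<in> carrier W \<longleftrightarrow> (\<forall>n. c n \<in> tuples G n \<rightarrow>\<^sub>E carrier R)"
  by (simp add: raw_cochain_algebra_def)

lemma W_simps:
  "\<zero>\<^bsub>W\<^esub> = zero_cochain R G"
  "c \<oplus>\<^bsub>W\<^esub> e = (\<lambda>n. \<lambda>x\<in>tuples G n. c n x \<oplus>\<^bsub>R\<^esub> e n x)"
  "c \<otimes>\<^bsub>W\<^esub> e = (\<lambda>n. \<lambda>x\<in>tuples G n. \<Oplus>\<^bsub>R\<^esub>k\<in>{..n}. cup R G k (n - k) (c k) (e (n - k)) x)"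
  "\<one>\<^bsub>W\<^esub> = (\<lambda>n. \<lambda>x\<in>tuples G n. if n = 0 then \<one>\<^bsub>R\<^esub> else \<zero>\<^bsub>R\<^esub>)"
  "s \<odot>\<^bsub>W\<^esub> c = (\<lambda>n. \<lambda>x\<in>tuples G n. s \<otimes>\<^bsub>R\<^esub> c n x)"
  "grade W n = {c \<in> C. \<forall>m. m \<noteq> n \<longrightarrow> c m = zero_cochain R G m}"
  by (simp_all add: raw_cochain_algebra_def cochain_algebra_def Let_def)

lemma C_iff: "c \<in> C \<longleftrightarrow> (\<forall>n. c n \<in> cochains R G T n) \<and> finite {n. c n \<noteq> zero_cochain R G n}"
  by (simp add: cochain_algebra_def Let_def)

lemma C_memD: "c \<in> C \<Longrightarrow> c n \<in> cochains R G T n"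
  and C_finite: "c \<in> C \<Longrightarrow> finite {n. c n \<noteq> zero_cochain R G n}"
  and C_memI: "\<lbrakk>\<And>n. c n \<in> cochains R G T n; finite {n. c n \<noteq> zero_cochain R G n}\<rbrakk> \<Longrightarrow> c \<in> C"
  unfolding C_iff by simp_all

lemma value_closed: "\<lbrakk>c \<in> carrier W; x \<in> tuples G n\<rbrakk> \<Longrightarrow> c n x \<in> carrier R"
  by (rule PiE_mem[OF spec[OF iffD1[OF W_carrier]]])

lemma W_eqI:
  assumes "c \<in> carrier W" "e \<in> carrier W" "\<And>n x. x \<in> tuples G n \<Longrightarrow> c n x = e n x"
  shows "c = e"
proof
  fix n
  show "c n = e n"
    by (rule PiE_ext[OF spec[OF assms(1)[unfolded W_carrier]] spec[OF assms(2)[unfolded W_carrier]]])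
      (rule assms(3))
qed

lemma W_closedI:
  assumes "\<And>n x. x \<in> tuples G n \<Longrightarrow> f n x \<in> carrier R"
  shows "(\<lambda>n. \<lambda>x\<in>tuples G n. f n x) \<in> carrier W"
  unfolding W_carrier by (rule allI, rule restrict_PiE_iff[THEN iffD2]) (use assms in blast)

lemma zero_cochain_eq: "zero_cochain R G = (\<lambda>n. \<lambda>x\<in>tuples G n. \<zero>\<^bsub>R\<^esub>)"
  by (simp add: zero_cochain_def fun_eq_iff)

lemma add_W_closed: "\<lbrakk>c \<in> carrier W; e \<in> carrier W\<rbrakk> \<Longrightarrow> c \<oplus>\<^bsub>W\<^esub> e \<in> carrier W"
  unfolding W_simps by (rule W_closedI) (simp add: value_closed)

lemma zero_W_closed: "\<zero>\<^bsub>W\<^esub> \<in> carrier W"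
  unfolding W_simps zero_cochain_eq by (rule W_closedI) simp

lemma neg_W:
  assumes "c \<in> carrier W"
  shows "(\<lambda>n. \<lambda>x\<in>tuples G n. \<ominus>\<^bsub>R\<^esub> c n x) \<in> carrier W"
    "(\<lambda>n. \<lambda>x\<in>tuples G n. \<ominus>\<^bsub>R\<^esub> c n x) \<oplus>\<^bsub>W\<^esub> c = \<zero>\<^bsub>W\<^esub>"
proof -
  show 1: "(\<lambda>n. \<lambda>x\<in>tuples G n. \<ominus>\<^bsub>R\<^esub> c n x) \<in> carrier W"
    by (rule W_closedI) (simp add: value_closed assms)
  show "(\<lambda>n. \<lambda>x\<in>tuples G n. \<ominus>\<^bsub>R\<^esub> c n x) \<oplus>\<^bsub>W\<^esub> c = \<zero>\<^bsub>W\<^esub>"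
    by (rule W_eqI[OF add_W_closed[OF 1 assms] zero_W_closed])
      (simp add: W_simps zero_cochain_eq R.l_neg value_closed assms del: PiE_iff)
qed

lemma abelian_group_W: "abelian_group W"
proof (rule abelian_groupI)
  fix c e f assume *: "c \<in> carrier W" "e \<in> carrier W" "f \<in> carrier W"
  show "(c \<oplus>\<^bsub>W\<^esub> e) \<oplus>\<^bsub>W\<^esub> f = c \<oplus>\<^bsub>W\<^esub> (e \<oplus>\<^bsub>W\<^esub> f)"
    by (rule W_eqI[OF add_W_closed[OF add_W_closed[OF *(1,2)] *(3)] add_W_closed[OF *(1) add_W_closed[OF *(2,3)]]])
      (use * in \<open>simp add: W_simps R.a_assoc value_closed\<close>)
next
  fix c e assume *: "c \<in> carrier W" "e \<in> carrier W"
  show "c \<oplus>\<^bsub>W\<^esub> e = e \<oplus>\<^bsub>W\<^esub> c"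
    by (rule W_eqI[OF add_W_closed[OF *] add_W_closed[OF *(2,1)]])
      (use * in \<open>simp add: W_simps R.a_comm value_closed\<close>)
next
  fix c assume *: "c \<in> carrier W"
  show "\<zero>\<^bsub>W\<^esub> \<oplus>\<^bsub>W\<^esub> c = c"
    by (rule W_eqI[OF add_W_closed[OF zero_W_closed *] *])
      (use * in \<open>simp add: W_simps zero_cochain_eq value_closed\<close>)
  show "\<exists>e\<in>carrier W. e \<oplus>\<^bsub>W\<^esub> c = \<zero>\<^bsub>W\<^esub>" using neg_W[OF *] by blast
qed (rule add_W_closed zero_W_closed | assumption)+

sublocale W: abelian_group W by (rule abelian_group_W)

lemma minus_W: "c \<in> carrier W \<Longrightarrow> \<ominus>\<^bsub>W\<^esub> c = (\<lambda>n. \<lambda>x\<in>tuples G n. \<ominus>\<^bsub>R\<^esub> c n x)"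
  by (rule W.minus_equality) (rule neg_W | assumption)+

lemma cochain_mem:
  assumes "f \<in> cochains R G T n"
  shows "f \<in> tuples G n \<rightarrow>\<^sub>E carrier R"
proof -
  have "f ` tuples G n \<subseteq> carrier R"
    using continuous_map_image_subset_topspace[of "product_topology (\<lambda>_. T) {..<n}" "discrete_topology (carrier R)" f]
      assms unfolding cochains_def by (simp add: top)
  then show ?thesis using assms unfolding cochains_def by (auto simp: PiE_def)
qed

lemma cochainI:
  assumes "continuous_map (product_topology (\<lambda>_. T) {..<n}) (discrete_topology (carrier R)) f"
  shows "(\<lambda>x\<in>tuples G n. f x) \<in> cochains R G T n"
  unfolding cochains_def
proof (intro CollectI conjI)
  show "continuous_map (product_topology (\<lambda>_. T) {..<n}) (discrete_topology (carrier R)) (\<lambda>x\<in>tuples G n. f x)"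
    by (rule continuous_map_eq[OF assms]) (simp add: top)
qed simp

lemma cochainD:
  "f \<in> cochains R G T n \<Longrightarrow> continuous_map (product_topology (\<lambda>_. T) {..<n}) (discrete_topology (carrier R)) f"
  unfolding cochains_def by blast

lemma zero_cochain_mem: "zero_cochain R G n \<in> cochains R G T n"
  unfolding zero_cochain_def by (rule cochainI) simp

lemma C_subset: "C \<subseteq> carrier W"
  by (rule subsetI, unfold W_carrier, rule allI, rule cochain_mem, rule C_memD)

lemma C_subgroup: "additive_subgroup C W"
proof (rule additive_subgroupI, rule W.add.subgroupI)
  show "C \<subseteq> carrier W" by (rule C_subset)
  have "zero_cochain R G \<in> C" unfolding C_iff using zero_cochain_mem by simp
  then show "C \<noteq> {}" by blast
next
  fix c assume c: "c \<in> C"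
  have cont: "(\<lambda>x\<in>tuples G n. \<ominus>\<^bsub>R\<^esub> c n x) \<in> cochains R G T n" for n
  proof (rule cochainI)
    have "continuous_map (product_topology (\<lambda>_. T) {..<n}) (discrete_topology (carrier R)) (c n)"
      by (rule cochainD[OF C_memD[OF c]])
    from continuous_map_discrete_binary[OF this this, of "\<lambda>a b. \<ominus>\<^bsub>R\<^esub> a"]
    show "continuous_map (product_topology (\<lambda>_. T) {..<n}) (discrete_topology (carrier R)) (\<lambda>x. \<ominus>\<^bsub>R\<^esub> c n x)"
      by simp
  qed
  have "{n. (\<lambda>x\<in>tuples G n. \<ominus>\<^bsub>R\<^esub> c n x) \<noteq> zero_cochain R G n} \<subseteq> {n. c n \<noteq> zero_cochain R G n}"
    by (intro subsetI CollectI notI) (auto simp: zero_cochain_def restrict_def fun_eq_iff split: if_splits)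
  then have "finite {n. (\<lambda>x\<in>tuples G n. \<ominus>\<^bsub>R\<^esub> c n x) \<noteq> zero_cochain R G n}"
    by (rule finite_subset) (rule C_finite[OF c])
  then show "\<ominus>\<^bsub>W\<^esub> c \<in> C" unfolding minus_W[OF subsetD[OF C_subset c]] by (rule C_memI[OF cont])
next
  fix c e assume c: "c \<in> C" and e: "e \<in> C"
  have cont: "(\<lambda>x\<in>tuples G n. c n x \<oplus>\<^bsub>R\<^esub> e n x) \<in> cochains R G T n" for n
    by (rule cochainI, rule continuous_map_discrete_binary[OF cochainD[OF C_memD[OF c]] cochainD[OF C_memD[OF e]]])
      simp
  have "{n. (\<lambda>x\<in>tuples G n. c n x \<oplus>\<^bsub>R\<^esub> e n x) \<noteq> zero_cochain R G n}
      \<subseteq> {n. c n \<noteq> zero_cochain R G n} \<union> {n. e n \<noteq> zero_cochain R G n}"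
    by (intro subsetI, rule ccontr) (auto simp: zero_cochain_def fun_eq_iff restrict_def split: if_splits)
  then have "finite {n. (\<lambda>x\<in>tuples G n. c n x \<oplus>\<^bsub>R\<^esub> e n x) \<noteq> zero_cochain R G n}"
    by (rule finite_subset) (use C_finite[OF c] C_finite[OF e] in simp)
  then show "c \<oplus>\<^bsub>W\<^esub> e \<in> C" unfolding W_simps by (rule C_memI[OF cont])
qed

text \<open>The arguments at which \<open>coboundary\<close> evaluates a cochain: the two outer
  faces of a tuple and the inner ones, which multiply neighbouring entries.\<close>

lemma face_closed:
  assumes "x \<in> tuples G (Suc n)"
  shows "(\<lambda>i\<in>{..<n}. x (Suc i)) \<in> tuples G n"
    and "k < n \<Longrightarrow> (\<lambda>i\<in>{..<n}. if i < k then x i else if i = k then x k \<otimes>\<^bsub>G\<^esub> x (Suc k) else x (Suc i)) \<in> tuples G n"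
    and "restrict x {..<n} \<in> tuples G n"
proof -
  have x: "x i \<in> carrier G" if "i < Suc n" for i using PiE_mem[OF assms(1), of i] that by simp
  show "(\<lambda>i\<in>{..<n}. x (Suc i)) \<in> tuples G n" "restrict x {..<n} \<in> tuples G n"
    using x by (auto intro!: restrict_PiE[THEN iffD2])
  show "k < n \<Longrightarrow> (\<lambda>i\<in>{..<n}. if i < k then x i else if i = k then x k \<otimes>\<^bsub>G\<^esub> x (Suc k) else x (Suc i)) \<in> tuples G n"
    using x mult_closed by auto
qed

lemma sign_closed: "(\<ominus>\<^bsub>R\<^esub> \<one>\<^bsub>R\<^esub>) [^]\<^bsub>R\<^esub> (k::nat) \<in> carrier R"
  by simp

lemma differential_closed:
  assumes c: "c \<in> carrier W"
  shows "differential R G c \<in> carrier W"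
  unfolding W_carrier
proof
  fix n
  show "differential R G c n \<in> tuples G n \<rightarrow>\<^sub>E carrier R"
  proof (cases n)
    case 0
    have "zero_cochain R G 0 \<in> tuples G 0 \<rightarrow>\<^sub>E carrier R" by (rule cochain_mem[OF zero_cochain_mem])
    then show ?thesis unfolding 0 differential_def by (simp only: nat.case)
  next
    case (Suc m)
    have "coboundary R G m (c m) x \<in> carrier R" if x: "x \<in> tuples G (Suc m)" for x
      unfolding coboundary_def restrict_apply'[OF x]
      by (intro R.a_closed R.m_closed R.finsum_closed Pi_I sign_closed value_closed[OF c] face_closed[OF x]) simp
    moreover have "coboundary R G m (c m) \<in> extensional (tuples G (Suc m))"
      unfolding coboundary_def by simp
    ultimately show ?thesis unfolding Suc differential_def by (auto simp: PiE_def)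
  qed
qed

lemma differential_add:
  assumes c: "c \<in> carrier W" and e: "e \<in> carrier W"
  shows "differential R G (c \<oplus>\<^bsub>W\<^esub> e) = differential R G c \<oplus>\<^bsub>W\<^esub> differential R G e"
proof (rule W_eqI[OF differential_closed[OF add_W_closed[OF c e]]
      add_W_closed[OF differential_closed[OF c] differential_closed[OF e]]])
  fix n x assume x: "x \<in> tuples G n"
  show "differential R G (c \<oplus>\<^bsub>W\<^esub> e) n x = (differential R G c \<oplus>\<^bsub>W\<^esub> differential R G e) n x"
  proof (cases n)
    case 0
    then show ?thesis using x unfolding W_simps differential_def zero_cochain_def by simp
  next
    case (Suc m)
    have x': "x \<in> tuples G (Suc m)" using x Suc by simp
    \<comment> \<open>\<open>s k\<close> is the sign of the inner face \<open>F k\<close>, and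
      \<open>s m\<close> that of the last face \<open>F1\<close>; the first face \<open>F0\<close>
      has sign 1. With the faces fixed, the coboundary is visibly linear in the values of the
      cochain.\<close>
    define s where "s k = (\<ominus>\<^bsub>R\<^esub> \<one>\<^bsub>R\<^esub>) [^]\<^bsub>R\<^esub> Suc k" for k
    define F where "F k = (\<lambda>i\<in>{..<m}. if i < k then x i else if i = k then x k \<otimes>\<^bsub>G\<^esub> x (Suc k) else x (Suc i))" for k
    define F0 where "F0 = (\<lambda>i\<in>{..<m}. x (Suc i))"
    define F1 where "F1 = restrict x {..<m}"
    have s: "s k \<in> carrier R" for k unfolding s_def by (rule sign_closed)
    have F: "F0 \<in> tuples G m" "F1 \<in> tuples G m" "k < m \<Longrightarrow> F k \<in> tuples G m" for k
      unfolding F_def F0_def F1_def using face_closed[OF x'] by auto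
    have val: "differential R G f (Suc m) x = f m F0 \<oplus>\<^bsub>R\<^esub> (\<Oplus>\<^bsub>R\<^esub>k\<in>{..<m}. s k \<otimes>\<^bsub>R\<^esub> f m (F k)) \<oplus>\<^bsub>R\<^esub> s m \<otimes>\<^bsub>R\<^esub> f m F1" for f
      unfolding differential_def coboundary_def s_def F_def F0_def F1_def using x' by simp
    have add: "(c \<oplus>\<^bsub>W\<^esub> e) m y = c m y \<oplus>\<^bsub>R\<^esub> e m y" if "y \<in> tuples G m" for y
      unfolding W_simps using that by simp
    define S where "S f = (\<Oplus>\<^bsub>R\<^esub>k\<in>{..<m}. s k \<otimes>\<^bsub>R\<^esub> f m (F k))" for f :: "nat \<Rightarrow> (nat \<Rightarrow> 'a) \<Rightarrow> 'r"
    have Sc: "S f \<in> carrier R" if "f \<in> carrier W" for f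
      unfolding S_def by (rule R.finsum_closed) (use s F(3) value_closed[OF that] in \<open>auto simp del: PiE_iff\<close>)
    have "S (c \<oplus>\<^bsub>W\<^esub> e) = (\<Oplus>\<^bsub>R\<^esub>k\<in>{..<m}. s k \<otimes>\<^bsub>R\<^esub> c m (F k) \<oplus>\<^bsub>R\<^esub> s k \<otimes>\<^bsub>R\<^esub> e m (F k))"
      unfolding S_def
    proof (rule R.finsum_cong'[OF refl])
      show "(\<lambda>k. s k \<otimes>\<^bsub>R\<^esub> c m (F k) \<oplus>\<^bsub>R\<^esub> s k \<otimes>\<^bsub>R\<^esub> e m (F k)) \<in> {..<m} \<rightarrow> carrier R"
        using s value_closed[OF c F(3)] value_closed[OF e F(3)] by simp
      fix k assume "k \<in> {..<m}"
      then have k: "F k \<in> tuples G m" using F(3) by simp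
      show "s k \<otimes>\<^bsub>R\<^esub> (c \<oplus>\<^bsub>W\<^esub> e) m (F k) = s k \<otimes>\<^bsub>R\<^esub> c m (F k) \<oplus>\<^bsub>R\<^esub> s k \<otimes>\<^bsub>R\<^esub> e m (F k)"
        unfolding add[OF k] by (rule R.r_distr[OF value_closed[OF c k] value_closed[OF e k] s])
    qed
    also have "\<dots> = S c \<oplus>\<^bsub>R\<^esub> S e"
      unfolding S_def by (rule R.finsum_addf) (use s value_closed[OF c F(3)] value_closed[OF e F(3)] in simp_all)
    finally have S: "S (c \<oplus>\<^bsub>W\<^esub> e) = S c \<oplus>\<^bsub>R\<^esub> S e" .
    have "differential R G (c \<oplus>\<^bsub>W\<^esub> e) (Suc m) x
        = (c m F0 \<oplus>\<^bsub>R\<^esub> e m F0) \<oplus>\<^bsub>R\<^esub> (S c \<oplus>\<^bsub>R\<^esub> S e) \<oplus>\<^bsub>R\<^esub> s m \<otimes>\<^bsub>R\<^esub> (c m F1 \<oplus>\<^bsub>R\<^esub> e m F1)"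
      unfolding val S_def[symmetric] S add[OF F(1)] add[OF F(2)] ..
    also have "\<dots> = (c m F0 \<oplus>\<^bsub>R\<^esub> S c \<oplus>\<^bsub>R\<^esub> s m \<otimes>\<^bsub>R\<^esub> c m F1) \<oplus>\<^bsub>R\<^esub> (e m F0 \<oplus>\<^bsub>R\<^esub> S e \<oplus>\<^bsub>R\<^esub> s m \<otimes>\<^bsub>R\<^esub> e m F1)"
      using value_closed[OF c F(1)] value_closed[OF c F(2)] value_closed[OF e F(1)] value_closed[OF e F(2)]
        Sc[OF c] Sc[OF e] s[of m] by (simp add: R.r_distr R.a_ac)
    also have "\<dots> = (differential R G c \<oplus>\<^bsub>W\<^esub> differential R G e) (Suc m) x"
      unfolding W_simps using x' by (simp add: val S_def)
    finally show ?thesis unfolding Suc .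
  qed
qed

lemma split_closed:
  assumes "x \<in> tuples G n" "k \<le> n"
  shows "restrict x {..<k} \<in> tuples G k" "(\<lambda>i\<in>{..<n - k}. x (k + i)) \<in> tuples G (n - k)"
proof -
  have x: "x i \<in> carrier G" if "i < n" for i using PiE_mem[OF assms(1), of i] that by simp
  show "restrict x {..<k} \<in> tuples G k" "(\<lambda>i\<in>{..<n - k}. x (k + i)) \<in> tuples G (n - k)"
    using x assms(2) by auto
qed

lemma mult_value:
  assumes c: "c \<in> carrier W" and e: "e \<in> carrier W" and x: "x \<in> tuples G n"
  shows "(c \<otimes>\<^bsub>W\<^esub> e) n x = (\<Oplus>\<^bsub>R\<^esub>k\<in>{..n}. c k (restrict x {..<k}) \<otimes>\<^bsub>R\<^esub> e (n - k) (\<lambda>i\<in>{..<n - k}. x (k + i)))"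
    and "(c \<otimes>\<^bsub>W\<^esub> e) n x \<in> carrier R"
proof -
  have cl: "c k (restrict x {..<k}) \<otimes>\<^bsub>R\<^esub> e (n - k) (\<lambda>i\<in>{..<n - k}. x (k + i)) \<in> carrier R" if "k \<in> {..n}" for k
    by (intro R.m_closed value_closed[OF c] value_closed[OF e] split_closed[OF x]) (use that in simp_all)
  have "(c \<otimes>\<^bsub>W\<^esub> e) n x = (\<Oplus>\<^bsub>R\<^esub>k\<in>{..n}. cup R G k (n - k) (c k) (e (n - k)) x)"
    unfolding W_simps using x by simp
  also have "\<dots> = (\<Oplus>\<^bsub>R\<^esub>k\<in>{..n}. c k (restrict x {..<k}) \<otimes>\<^bsub>R\<^esub> e (n - k) (\<lambda>i\<in>{..<n - k}. x (k + i)))"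
    by (rule R.finsum_cong'[OF refl]) (use cl x in \<open>auto simp: cup_def simp del: PiE_iff\<close>)
  finally show 1: "(c \<otimes>\<^bsub>W\<^esub> e) n x = (\<Oplus>\<^bsub>R\<^esub>k\<in>{..n}. c k (restrict x {..<k}) \<otimes>\<^bsub>R\<^esub> e (n - k) (\<lambda>i\<in>{..<n - k}. x (k + i)))" .
  show "(c \<otimes>\<^bsub>W\<^esub> e) n x \<in> carrier R" unfolding 1 by (rule R.finsum_closed) (use cl in blast)
qed

lemma mult_W_closed: "\<lbrakk>c \<in> carrier W; e \<in> carrier W\<rbrakk> \<Longrightarrow> c \<otimes>\<^bsub>W\<^esub> e \<in> carrier W"
  unfolding W_simps by (rule W_closedI) (use mult_value(2) in \<open>simp add: W_simps\<close>)

lemma smult_W_closed: "\<lbrakk>s \<in> carrier R; c \<in> carrier W\<rbrakk> \<Longrightarrow> s \<odot>\<^bsub>W\<^esub> c \<in> carrier W"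
  unfolding W_simps by (rule W_closedI) (simp add: value_closed)

lemma one_W_closed: "\<one>\<^bsub>W\<^esub> \<in> carrier W"
  unfolding W_simps by (rule W_closedI) simp

sublocale system: cochain_system R W C "differential R G"
proof (intro cochain_system.intro cochain_system_axioms.intro)
  fix c e assume "c \<in> C" "e \<in> C"
  then show "differential R G (c \<oplus>\<^bsub>W\<^esub> e) = differential R G c \<oplus>\<^bsub>W\<^esub> differential R G e"
    by (intro differential_add subsetD[OF C_subset])
next
  fix c assume "c \<in> C" then show "differential R G c \<in> carrier W" by (rule differential_closed[OF subsetD[OF C_subset]])
next
  show "grade W n \<subseteq> C" for n unfolding W_simps by blast
qed (rule abelian_group_W C_subgroup mult_W_closed smult_W_closed one_W_closed | assumption)+

text \<open>The raw and the continuous algebra differ only in the carrier, which passing to cocycles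
  overwrites.\<close>

lemma system_D: "system.D = cocycle_algebra R G T"
  unfolding system.D_def system.Z_def
  unfolding cocycle_algebra_def Let_def raw_cochain_algebra_def by simp

lemma system_B: "system.B = coboundaries R G T"
  unfolding system.B_def coboundaries_def ..

lemma cohomology_eq: "cohomology_algebra R G T = system.H"
  unfolding cohomology_algebra_def system.H_def system_D system_B ..

end

section \<open>Pullback along continuous surjective homomorphisms\<close>

locale cochain_pullback = G: continuous_cochains R G TG + K: continuous_cochains R K TK
  for R :: "('r, 'c) ring_scheme"
    and G :: "('a, 'b) monoid_scheme" and TG :: "'a topology"
    and K :: "('k, 'd) monoid_scheme" and TK :: "'k topology" +
  fixes \<phi> :: "'k \<Rightarrow> 'a"
  assumes hom: "\<lbrakk>x \<in> carrier K; y \<in> carrier K\<rbrakk> \<Longrightarrow> \<phi> (x \<otimes>\<^bsub>K\<^esub> y) = \<phi> x \<otimes>\<^bsub>G\<^esub> \<phi> y"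
    and surj: "\<phi> ` carrier K = carrier G"
    and cont: "continuous_map TK TG \<phi>"
begin

definition \<Phi> where "\<Phi> n x = (\<lambda>i\<in>{..<n::nat}. \<phi> (x i))"
abbreviation P where "P \<equiv> pullback_cochain K \<phi>"

lemma Phi_closed: "x \<in> tuples K n \<Longrightarrow> \<Phi> n x \<in> tuples G n"
proof -
  assume x: "x \<in> tuples K n"
  have "\<phi> (x i) \<in> carrier G" if "i < n" for i
    using PiE_mem[OF x, of i] that surj by auto
  then show ?thesis unfolding \<Phi>_def by simp
qed

lemma P_eq: "P c = (\<lambda>n. \<lambda>x\<in>tuples K n. c n (\<Phi> n x))"
  unfolding pullback_cochain_def \<Phi>_def ..

lemma P_value: "x \<in> tuples K n \<Longrightarrow> P c n x = c n (\<Phi> n x)"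
  unfolding P_eq by simp

lemma P_closed: "c \<in> carrier G.W \<Longrightarrow> P c \<in> carrier K.W"
  unfolding P_eq by (rule K.W_closedI) (rule G.value_closed[OF _ Phi_closed])

lemma Phi_surj:
  assumes "y \<in> tuples G n"
  shows "\<exists>x\<in>tuples K n. \<Phi> n x = y"
proof -
  have "\<forall>i\<in>{..<n}. \<exists>g\<in>carrier K. \<phi> g = y i" using assms surj by (metis PiE_mem imageE)
  then have "\<exists>x. \<forall>i\<in>{..<n}. x i \<in> carrier K \<and> \<phi> (x i) = y i" unfolding Bex_def by (rule bchoice)
  then obtain x where x: "\<forall>i\<in>{..<n}. x i \<in> carrier K \<and> \<phi> (x i) = y i" by (rule exE)
  have "\<Phi> n (restrict x {..<n}) = y"
  proof
    fix i show "\<Phi> n (restrict x {..<n}) i = y i"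
      unfolding \<Phi>_def using x PiE_arb[OF assms, of i] by simp
  qed
  moreover have "restrict x {..<n} \<in> tuples K n" using x by simp
  ultimately show ?thesis by blast
qed

lemma P_cochain_degree: "c n = zero_cochain R G n \<Longrightarrow> P c n = zero_cochain R K n"
  unfolding P_eq zero_cochain_def using Phi_closed[of _ n] by (intro ext) (simp add: restrict_def)

lemma Phi_continuous:
  "continuous_map (product_topology (\<lambda>_. TK) {..<n}) (product_topology (\<lambda>_. TG) {..<n}) (\<Phi> n)"
  unfolding continuous_map_componentwise
proof (intro conjI ballI)
  show "\<Phi> n ` topspace (product_topology (\<lambda>_. TK) {..<n}) \<subseteq> extensional {..<n}" unfolding \<Phi>_def by auto
  fix k assume k: "k \<in> {..<n}"
  have "continuous_map (product_topology (\<lambda>_. TK) {..<n}) TG (\<phi> \<circ> (\<lambda>x. x k))"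
    by (rule continuous_map_compose[OF _ cont], rule continuous_map_product_projection[OF k])
  then show "continuous_map (product_topology (\<lambda>_. TK) {..<n}) TG (\<lambda>x. \<Phi> n x k)"
    unfolding \<Phi>_def comp_def using k by simp
qed

lemma P_cochain:
  assumes c: "c \<in> G.C"
  shows "P c \<in> K.C"
proof (rule K.C_memI)
  fix n
  have "continuous_map (product_topology (\<lambda>_. TK) {..<n}) (discrete_topology (carrier R)) (c n \<circ> \<Phi> n)"
    by (rule continuous_map_compose[OF Phi_continuous G.cochainD[OF G.C_memD[OF c]]])
  then show "P c n \<in> cochains R K TK n" unfolding P_eq comp_def by (rule K.cochainI)
next
  have "{n. P c n \<noteq> zero_cochain R K n} \<subseteq> {n. c n \<noteq> zero_cochain R G n}"
    using P_cochain_degree by blast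
  then show "finite {n. P c n \<noteq> zero_cochain R K n}" by (rule finite_subset) (rule G.C_finite[OF c])
qed

text \<open>Applying a homomorphism entrywise commutes with all faces of a tuple; for the inner
  faces this is its multiplicativity.\<close>

lemma P_differential:
  assumes c: "c \<in> carrier G.W"
  shows "P (differential R G c) = differential R K (P c)"
proof (rule K.W_eqI[OF P_closed[OF G.differential_closed[OF c]] K.differential_closed[OF P_closed[OF c]]])
  fix n x assume x: "x \<in> tuples K n"
  show "P (differential R G c) n x = differential R K (P c) n x"
  proof (cases n)
    case 0
    then show ?thesis
      using x Phi_closed[OF x] unfolding P_value[OF x] differential_def by (simp add: zero_cochain_def)
  next
    case (Suc m)
    have x': "x \<in> tuples K (Suc m)" using x Suc by simp
    have y: "\<Phi> (Suc m) x \<in> tuples G (Suc m)" by (rule Phi_closed[OF x'])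
    have xc: "x i \<in> carrier K" if "i < Suc m" for i using PiE_mem[OF x', of i] that by simp
    have f0: "\<Phi> m (\<lambda>i\<in>{..<m}. x (Suc i)) = (\<lambda>i\<in>{..<m}. \<Phi> (Suc m) x (Suc i))"
      unfolding \<Phi>_def by (rule restrict_ext) simp
    have f1: "\<Phi> m (restrict x {..<m}) = restrict (\<Phi> (Suc m) x) {..<m}"
      unfolding \<Phi>_def by (rule ext) (simp add: restrict_def)
    have fk: "\<Phi> m (\<lambda>i\<in>{..<m}. if i < k then x i else if i = k then x k \<otimes>\<^bsub>K\<^esub> x (Suc k) else x (Suc i))
        = (\<lambda>i\<in>{..<m}. if i < k then \<Phi> (Suc m) x i else if i = k then \<Phi> (Suc m) x k \<otimes>\<^bsub>G\<^esub> \<Phi> (Suc m) x (Suc k)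
            else \<Phi> (Suc m) x (Suc i))" if "k < m" for k
      unfolding \<Phi>_def by (rule restrict_ext) (use hom[OF xc xc, of k "Suc k"] that in simp)
    have sum: "(\<Oplus>\<^bsub>R\<^esub>k\<in>{..<m}. ((\<ominus>\<^bsub>R\<^esub> \<one>\<^bsub>R\<^esub>) [^]\<^bsub>R\<^esub> Suc k) \<otimes>\<^bsub>R\<^esub>
          P c m (\<lambda>i\<in>{..<m}. if i < k then x i else if i = k then x k \<otimes>\<^bsub>K\<^esub> x (Suc k) else x (Suc i)))
      = (\<Oplus>\<^bsub>R\<^esub>k\<in>{..<m}. ((\<ominus>\<^bsub>R\<^esub> \<one>\<^bsub>R\<^esub>) [^]\<^bsub>R\<^esub> Suc k) \<otimes>\<^bsub>R\<^esub>
          c m (\<lambda>i\<in>{..<m}. if i < k then \<Phi> (Suc m) x i else if i = k then \<Phi> (Suc m) x k \<otimes>\<^bsub>G\<^esub> \<Phi> (Suc m) x (Suc k)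
            else \<Phi> (Suc m) x (Suc i)))"
    proof (rule G.R.finsum_cong'[OF refl])
      show "(\<lambda>k. ((\<ominus>\<^bsub>R\<^esub> \<one>\<^bsub>R\<^esub>) [^]\<^bsub>R\<^esub> Suc k) \<otimes>\<^bsub>R\<^esub>
          c m (\<lambda>i\<in>{..<m}. if i < k then \<Phi> (Suc m) x i else if i = k then \<Phi> (Suc m) x k \<otimes>\<^bsub>G\<^esub> \<Phi> (Suc m) x (Suc k)
            else \<Phi> (Suc m) x (Suc i))) \<in> {..<m} \<rightarrow> carrier R"
        by (intro Pi_I G.R.m_closed G.sign_closed G.value_closed[OF c] G.face_closed(2)[OF y]) simp
      fix k assume "k \<in> {..<m}"
      then have k: "k < m" by simp
      show "((\<ominus>\<^bsub>R\<^esub> \<one>\<^bsub>R\<^esub>) [^]\<^bsub>R\<^esub> Suc k) \<otimes>\<^bsub>R\<^esub>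
          P c m (\<lambda>i\<in>{..<m}. if i < k then x i else if i = k then x k \<otimes>\<^bsub>K\<^esub> x (Suc k) else x (Suc i))
        = ((\<ominus>\<^bsub>R\<^esub> \<one>\<^bsub>R\<^esub>) [^]\<^bsub>R\<^esub> Suc k) \<otimes>\<^bsub>R\<^esub>
          c m (\<lambda>i\<in>{..<m}. if i < k then \<Phi> (Suc m) x i else if i = k then \<Phi> (Suc m) x k \<otimes>\<^bsub>G\<^esub> \<Phi> (Suc m) x (Suc k)
            else \<Phi> (Suc m) x (Suc i))"
        unfolding P_value[OF K.face_closed(2)[OF x' k]] fk[OF k] ..
    qed
    have "differential R K (P c) (Suc m) x = differential R G c (Suc m) (\<Phi> (Suc m) x)"
      unfolding differential_def nat.case coboundary_def restrict_apply'[OF x'] restrict_apply'[OF y]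
        sum P_value[OF K.face_closed(1)[OF x']] P_value[OF K.face_closed(3)[OF x']] f0 f1 ..
    then show ?thesis unfolding Suc P_value[OF x'] by simp
  qed
qed

text \<open>Cutting a tuple in two commutes with applying \<open>\<phi>\<close> entrywise.\<close>

lemma P_mult:
  assumes c: "c \<in> carrier G.W" and e: "e \<in> carrier G.W"
  shows "P (c \<otimes>\<^bsub>G.W\<^esub> e) = P c \<otimes>\<^bsub>K.W\<^esub> P e"
proof (rule K.W_eqI[OF P_closed[OF G.mult_W_closed[OF c e]] K.mult_W_closed[OF P_closed[OF c] P_closed[OF e]]])
  fix n x assume x: "x \<in> tuples K n"
  note y = Phi_closed[OF x]
  have "(P c \<otimes>\<^bsub>K.W\<^esub> P e) n x
      = (\<Oplus>\<^bsub>R\<^esub>k\<in>{..n}. P c k (restrict x {..<k}) \<otimes>\<^bsub>R\<^esub> P e (n - k) (\<lambda>i\<in>{..<n - k}. x (k + i)))"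
    by (rule K.mult_value(1)[OF P_closed[OF c] P_closed[OF e] x])
  also have "\<dots> = (\<Oplus>\<^bsub>R\<^esub>k\<in>{..n}. c k (restrict (\<Phi> n x) {..<k}) \<otimes>\<^bsub>R\<^esub> e (n - k) (\<lambda>i\<in>{..<n - k}. \<Phi> n x (k + i)))"
  proof (rule G.R.finsum_cong'[OF refl])
    show "(\<lambda>k. c k (restrict (\<Phi> n x) {..<k}) \<otimes>\<^bsub>R\<^esub> e (n - k) (\<lambda>i\<in>{..<n - k}. \<Phi> n x (k + i))) \<in> {..n} \<rightarrow> carrier R"
      by (intro Pi_I G.R.m_closed G.value_closed[OF c] G.value_closed[OF e] G.split_closed[OF y]) simp_all
    fix k assume "k \<in> {..n}"
    then have k: "k \<le> n" by simp
    have 1: "\<Phi> k (restrict x {..<k}) = restrict (\<Phi> n x) {..<k}"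
      unfolding \<Phi>_def using k by (intro ext) (simp add: restrict_def)
    have 2: "\<Phi> (n - k) (\<lambda>i\<in>{..<n - k}. x (k + i)) = (\<lambda>i\<in>{..<n - k}. \<Phi> n x (k + i))"
      unfolding \<Phi>_def by (intro restrict_ext) (simp add: less_diff_conv add.commute)
    show "P c k (restrict x {..<k}) \<otimes>\<^bsub>R\<^esub> P e (n - k) (\<lambda>i\<in>{..<n - k}. x (k + i))
        = c k (restrict (\<Phi> n x) {..<k}) \<otimes>\<^bsub>R\<^esub> e (n - k) (\<lambda>i\<in>{..<n - k}. \<Phi> n x (k + i))"
      unfolding P_value[OF K.split_closed(1)[OF x k]] P_value[OF K.split_closed(2)[OF x k]] 1 2 ..
  qed
  also have "\<dots> = (c \<otimes>\<^bsub>G.W\<^esub> e) n (\<Phi> n x)" by (rule G.mult_value(1)[OF c e y, symmetric])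
  finally show "P (c \<otimes>\<^bsub>G.W\<^esub> e) n x = (P c \<otimes>\<^bsub>K.W\<^esub> P e) n x" unfolding P_value[OF x] by simp
qed

text \<open>Injectivity on cochains comes from surjectivity of \<open>\<phi>\<close>: every tuple
  over \<open>G\<close> lifts entrywise to one over \<open>K\<close>.\<close>

lemma embedding: "cochain_embedding R G.W G.C (differential R G) K.W K.C (differential R K) P"
proof (intro cochain_embedding.intro cochain_embedding_axioms.intro)
  fix c e assume c: "c \<in> carrier G.W" and e: "e \<in> carrier G.W"
  show "P (c \<oplus>\<^bsub>G.W\<^esub> e) = P c \<oplus>\<^bsub>K.W\<^esub> P e"
    by (rule K.W_eqI[OF P_closed[OF G.add_W_closed[OF c e]] K.add_W_closed[OF P_closed[OF c] P_closed[OF e]]])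
      (simp add: P_value K.W_simps G.W_simps Phi_closed)
next
  fix s c assume s: "s \<in> carrier R" and c: "c \<in> carrier G.W"
  show "P (s \<odot>\<^bsub>G.W\<^esub> c) = s \<odot>\<^bsub>K.W\<^esub> P c"
    by (rule K.W_eqI[OF P_closed[OF G.smult_W_closed[OF s c]] K.smult_W_closed[OF s P_closed[OF c]]])
      (simp add: P_value K.W_simps G.W_simps Phi_closed)
next
  show "P \<one>\<^bsub>G.W\<^esub> = \<one>\<^bsub>K.W\<^esub>"
    by (rule K.W_eqI[OF P_closed[OF G.one_W_closed] K.one_W_closed])
      (simp add: P_value K.W_simps G.W_simps Phi_closed)
next
  show "inj_on P (carrier G.W)"
  proof (rule inj_onI)
    fix c e assume c: "c \<in> carrier G.W" and e: "e \<in> carrier G.W" and eq: "P c = P e"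
    show "c = e"
    proof (rule G.W_eqI[OF c e])
      fix n y assume "y \<in> tuples G n"
      then obtain x where x: "x \<in> tuples K n" "\<Phi> n x = y" using Phi_surj by blast
      show "c n y = e n y" using P_value[OF x(1), of c] P_value[OF x(1), of e] eq x(2) by simp
    qed
  qed
next
  fix c assume "c \<in> G.C" then show "P (differential R G c) = differential R K (P c)"
    by (rule P_differential[OF subsetD[OF G.C_subset]])
next
  fix c n assume "c \<in> grade G.W n"
  then show "P c \<in> grade K.W n" unfolding G.W_simps K.W_simps using P_cochain P_cochain_degree by simp
qed (rule G.system.cochain_system_axioms K.system.cochain_system_axioms P_closed P_mult P_cochain | assumption)+

text \<open>Translates injectivity of the inflation maps into the abstract setting of
  \<open>cochain_limit\<close>.\<close>

lemma inflation_eq: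
  "inflation R K TK \<phi> = cochain_embedding.map K.W K.C (differential R K) P"
  unfolding inflation_def cochain_embedding.map_def[OF embedding] K.system.cls_D[symmetric]
    K.system_D K.system_B ..

end

section \<open>Cohomology of the projective limit\<close>

locale cochain_projective_system = compact_projective_system I r G T \<pi> + R: cring R
  for R :: "('r, 'c) ring_scheme"
    and I :: "'i set" and r :: "'i rel"
    and G :: "'i \<Rightarrow> 'a monoid" and T :: "'i \<Rightarrow> 'a topology"
    and \<pi> :: "'i \<Rightarrow> 'i \<Rightarrow> 'a \<Rightarrow> 'a"
begin

lemma G_cochains: "i \<in> I \<Longrightarrow> continuous_cochains R (G i) (T i)"
  using top_eq group.is_monoid[OF group_G]
  by (simp add: continuous_cochains_def continuous_cochains_axioms_def R.is_cring monoid.m_closed)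

lemma L_mult:
  assumes "x \<in> carrier L" "y \<in> carrier L"
  shows "i \<in> I \<Longrightarrow> (x \<otimes>\<^bsub>L\<^esub> y) i = x i \<otimes>\<^bsub>G i\<^esub> y i" and "x \<otimes>\<^bsub>L\<^esub> y \<in> carrier L"
proof -
  show 1: "(x \<otimes>\<^bsub>L\<^esub> y) i = x i \<otimes>\<^bsub>G i\<^esub> y i" if "i \<in> I" for i
    using that by (simp add: projective_limit_def product_group_def)
  have "x \<otimes>\<^bsub>L\<^esub> y \<in> extensional I" by (simp add: projective_limit_def product_group_def)
  moreover have "(x \<otimes>\<^bsub>L\<^esub> y) i \<in> carrier (G i)" if "i \<in> I" for i
    unfolding 1[OF that]
    by (rule monoid.m_closed[OF group.is_monoid[OF group_G[OF that]]]) (rule L_coordinate[OF _ that], rule assms)+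
  ultimately have "x \<otimes>\<^bsub>L\<^esub> y \<in> topspace X" unfolding topspace_X by (simp add: PiE_iff)
  moreover have "\<pi> i j ((x \<otimes>\<^bsub>L\<^esub> y) j) = (x \<otimes>\<^bsub>L\<^esub> y) i" if ij: "(i, j) \<in> r" for i j
  proof -
    have i: "i \<in> I" and j: "j \<in> I" using rI[OF ij] by auto
    have "\<pi> i j (x j \<otimes>\<^bsub>G j\<^esub> y j) = \<pi> i j (x j) \<otimes>\<^bsub>G i\<^esub> \<pi> i j (y j)"
      by (rule hom_mult[OF transition_hom[OF ij] L_coordinate[OF assms(1) j] L_coordinate[OF assms(2) j]])
    then show ?thesis unfolding 1[OF i] 1[OF j] L_compat[OF assms(1) ij] L_compat[OF assms(2) ij] .
  qed
  ultimately show "x \<otimes>\<^bsub>L\<^esub> y \<in> carrier L" unfolding L_iff by blast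
qed

sublocale L: continuous_cochains R L TL
  by unfold_locales (rule L_mult(2) topspace_TL | assumption)+

lemma projection_pullback: "i \<in> I \<Longrightarrow> cochain_pullback R (G i) (T i) L TL (\<lambda>x. x i)"
proof (intro cochain_pullback.intro cochain_pullback_axioms.intro)
  assume i: "i \<in> I"
  show "continuous_cochains R (G i) (T i)" by (rule G_cochains[OF i])
  show "continuous_map TL (T i) (\<lambda>x. x i)" by (rule projection_continuous[OF i])
  show "(\<lambda>x. x i) ` carrier L = carrier (G i)" using L_coordinate[OF _ i] projection_surj[OF i] by blast
  show "(x \<otimes>\<^bsub>L\<^esub> y) i = x i \<otimes>\<^bsub>G i\<^esub> y i" if "x \<in> carrier L" "y \<in> carrier L" for x y
    by (rule L_mult(1)[OF that i])
qed (rule L.continuous_cochains_axioms)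

lemma transition_pullback: "(i, j) \<in> r \<Longrightarrow> cochain_pullback R (G i) (T i) (G j) (T j) (\<pi> i j)"
proof (intro cochain_pullback.intro cochain_pullback_axioms.intro)
  assume ij: "(i, j) \<in> r"
  show "continuous_cochains R (G i) (T i)" "continuous_cochains R (G j) (T j)"
    using G_cochains rI[OF ij] by auto
  show "continuous_map (T j) (T i) (\<pi> i j)" by (rule transition_continuous[OF ij])
  show "\<pi> i j ` carrier (G j) = carrier (G i)" by (rule transition_surj[OF ij])
  show "\<pi> i j (x \<otimes>\<^bsub>G j\<^esub> y) = \<pi> i j x \<otimes>\<^bsub>G i\<^esub> \<pi> i j y" if "x \<in> carrier (G j)" "y \<in> carrier (G j)" for x y
    by (rule hom_mult[OF transition_hom[OF ij] that])
qed

abbreviation WG where "WG i \<equiv> raw_cochain_algebra R (G i) (T i)"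
abbreviation CG where "CG i \<equiv> carrier (cochain_algebra R (G i) (T i))"

lemma pullback_comp:
  assumes ij: "(i, j) \<in> r" and c: "c \<in> carrier (WG i)"
  shows "pullback_cochain L (\<lambda>x. x j) (pullback_cochain (G j) (\<pi> i j) c) = pullback_cochain L (\<lambda>x. x i) c"
proof -
  have i: "i \<in> I" and j: "j \<in> I" using rI[OF ij] by auto
  interpret Pi: cochain_pullback R "G i" "T i" L TL "\<lambda>x. x i" by (rule projection_pullback[OF i])
  interpret Pj: cochain_pullback R "G j" "T j" L TL "\<lambda>x. x j" by (rule projection_pullback[OF j])
  interpret Q: cochain_pullback R "G i" "T i" "G j" "T j" "\<pi> i j" by (rule transition_pullback[OF ij])
  show ?thesis
  proof (rule L.W_eqI[OF Pj.P_closed[OF Q.P_closed[OF c]] Pi.P_closed[OF c]])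
    fix n x assume x: "x \<in> tuples L n"
    have "\<pi> i j (x k j) = x k i" if "k < n" for k
      by (rule L_compat[OF _ ij]) (use PiE_mem[OF x, of k] that in simp)
    then have "Q.\<Phi> n (Pj.\<Phi> n x) = Pi.\<Phi> n x"
      unfolding Q.\<Phi>_def Pj.\<Phi>_def Pi.\<Phi>_def by (intro restrict_ext) simp
    then show "Pj.P (Q.P c) n x = Pi.P c n x"
      unfolding Pj.P_value[OF x] Pi.P_value[OF x] Q.P_value[OF Pj.Phi_closed[OF x]] by simp
  qed
qed

text \<open>A cochain has finitely many nonzero components, each of which factors through all
  sufficiently high levels, so one level works for all of them. The clause about vanishing
  components makes a homogeneous cochain descend to a homogeneous one.\<close>

lemma cochain_descends:
  assumes c: "c \<in> L.C"
  shows "\<exists>j\<in>I. \<exists>c'\<in>CG j. pullback_cochain L (\<lambda>x. x j) c' = c \<and>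
    (\<forall>n. c n = zero_cochain R L n \<longrightarrow> c' n = zero_cochain R (G j) n)"
proof -
  let ?N = "{n. c n \<noteq> zero_cochain R L n}"
  have "\<forall>n\<in>?N. \<exists>i. i \<in> I \<and> (\<forall>j. (i, j) \<in> r \<longrightarrow> (\<exists>f'\<in>extensional (tuples (G j) n).
    continuous_map (product_topology (\<lambda>_. T j) {..<n}) (discrete_topology (carrier R)) f' \<and>
    (\<forall>x\<in>tuples L n. c n x = f' (\<lambda>k\<in>{..<n}. x k j))))"
    using continuous_factor[OF L.cochainD[OF L.C_memD[OF c]]] unfolding Bex_def by blast
  then have "\<exists>i. \<forall>n\<in>?N. i n \<in> I \<and> (\<forall>j. (i n, j) \<in> r \<longrightarrow> (\<exists>f'\<in>extensional (tuples (G j) n).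
    continuous_map (product_topology (\<lambda>_. T j) {..<n}) (discrete_topology (carrier R)) f' \<and>
    (\<forall>x\<in>tuples L n. c n x = f' (\<lambda>k\<in>{..<n}. x k j))))"
    by (rule bchoice)
  then obtain i where i: "\<forall>n\<in>?N. i n \<in> I \<and> (\<forall>j. (i n, j) \<in> r \<longrightarrow> (\<exists>f'\<in>extensional (tuples (G j) n).
    continuous_map (product_topology (\<lambda>_. T j) {..<n}) (discrete_topology (carrier R)) f' \<and>
    (\<forall>x\<in>tuples L n. c n x = f' (\<lambda>k\<in>{..<n}. x k j))))"
    by (rule exE)
  obtain j where j: "j \<in> I" "\<And>k. k \<in> i ` ?N \<Longrightarrow> (k, j) \<in> r"
    by (rule directed_finite_bound[OF directed, of "i ` ?N"]) (use L.C_finite[OF c] i in auto)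
  interpret P: cochain_pullback R "G j" "T j" L TL "\<lambda>x. x j" by (rule projection_pullback[OF j(1)])
  have "\<forall>n\<in>?N. \<exists>f'. f' \<in> cochains R (G j) (T j) n \<and> (\<forall>x\<in>tuples L n. c n x = f' (P.\<Phi> n x))"
  proof
    fix n assume n: "n \<in> ?N"
    then have "(i n, j) \<in> r" using j(2) by blast
    then have "\<exists>f'\<in>extensional (tuples (G j) n).
      continuous_map (product_topology (\<lambda>_. T j) {..<n}) (discrete_topology (carrier R)) f' \<and>
      (\<forall>x\<in>tuples L n. c n x = f' (\<lambda>k\<in>{..<n}. x k j))" using bspec[OF i n] by blast
    then show "\<exists>f'. f' \<in> cochains R (G j) (T j) n \<and> (\<forall>x\<in>tuples L n. c n x = f' (P.\<Phi> n x))"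
      unfolding cochains_def P.\<Phi>_def by blast
  qed
  then have "\<exists>f'. \<forall>n\<in>?N. f' n \<in> cochains R (G j) (T j) n \<and> (\<forall>x\<in>tuples L n. c n x = f' n (P.\<Phi> n x))"
    by (rule bchoice)
  then obtain f' where f': "\<forall>n\<in>?N. f' n \<in> cochains R (G j) (T j) n \<and> (\<forall>x\<in>tuples L n. c n x = f' n (P.\<Phi> n x))"
    by (rule exE)
  \<comment> \<open>Zero outside the support of \<open>c\<close>: this yields finite support and
    preserves homogeneity.\<close>
  define c' where "c' n = (if n \<in> ?N then f' n else zero_cochain R (G j) n)" for n
  have c': "c' \<in> CG j"
  proof (rule P.G.C_memI)
    show "c' n \<in> cochains R (G j) (T j) n" for n
      unfolding c'_def using f' P.G.zero_cochain_mem by simp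
    have "{n. c' n \<noteq> zero_cochain R (G j) n} \<subseteq> ?N" unfolding c'_def by auto
    then show "finite {n. c' n \<noteq> zero_cochain R (G j) n}" by (rule finite_subset) (rule L.C_finite[OF c])
  qed
  moreover have "P.P c' = c"
  proof (rule L.W_eqI[OF P.P_closed[OF subsetD[OF P.G.C_subset c']] subsetD[OF L.C_subset c]])
    fix n x assume x: "x \<in> tuples L n"
    show "P.P c' n x = c n x"
    proof (cases "n \<in> ?N")
      case True
      then show ?thesis unfolding P.P_value[OF x] c'_def using f' x by simp
    next
      case False
      then have "c n = zero_cochain R L n" by simp
      then have "c n x = \<zero>\<^bsub>R\<^esub>" using x by (simp add: zero_cochain_def)
      moreover have "c' n (P.\<Phi> n x) = \<zero>\<^bsub>R\<^esub>"
        unfolding c'_def using False P.Phi_closed[OF x] by (simp add: zero_cochain_def)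
      ultimately show ?thesis unfolding P.P_value[OF x] by simp
    qed
  qed
  moreover have "\<forall>n. c n = zero_cochain R L n \<longrightarrow> c' n = zero_cochain R (G j) n" unfolding c'_def by simp
  ultimately show ?thesis using j(1) by blast
qed

lemma cochain_limit:
  assumes connected: "\<And>i. i \<in> I \<Longrightarrow> connected_graded_algebra R (cohomology_algebra R (G i) (T i))"
    and inflation_inj: "\<And>i j. (i, j) \<in> r \<Longrightarrow>
      inj_on (inflation R (G j) (T j) (\<pi> i j)) (carrier (cohomology_algebra R (G i) (T i)))"
  shows "cochain_limit R L.W L.C (differential R L) I r WG CG (\<lambda>i. differential R (G i))
    (\<lambda>i. pullback_cochain L (\<lambda>x. x i)) (\<lambda>i j. pullback_cochain (G j) (\<pi> i j))"
proof (intro cochain_limit.intro cochain_limit_axioms.intro)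
  show "cochain_system R L.W L.C (differential R L)" by (rule L.system.cochain_system_axioms)
  show "directed_on I r" by (rule directed)
next
  fix i assume i: "i \<in> I"
  interpret P: cochain_pullback R "G i" "T i" L TL "\<lambda>x. x i" by (rule projection_pullback[OF i])
  show "cochain_embedding R (WG i) (CG i) (differential R (G i)) L.W L.C (differential R L) P.P"
    by (rule P.embedding)
  show "connected_graded_algebra R P.G.system.H" using connected[OF i] unfolding P.G.cohomology_eq .
next
  fix i j assume ij: "(i, j) \<in> r"
  interpret Q: cochain_pullback R "G i" "T i" "G j" "T j" "\<pi> i j" by (rule transition_pullback[OF ij])
  show "cochain_embedding R (WG i) (CG i) (differential R (G i)) (WG j) (CG j) (differential R (G j)) Q.P"
    by (rule Q.embedding)
  show "inj_on (cochain_embedding.map (WG j) (CG j) (differential R (G j)) Q.P) (carrier Q.G.system.H)"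
    using inflation_inj[OF ij] unfolding Q.inflation_eq Q.G.cohomology_eq .
next
  have sub: "pullback_cochain L (\<lambda>x. x i) ` CG i \<subseteq> L.C" if i: "i \<in> I" for i
    using cochain_pullback.P_cochain[OF projection_pullback[OF i]] by blast
  show "L.C = (\<Union>i\<in>I. pullback_cochain L (\<lambda>x. x i) ` CG i)"
  proof
    show "L.C \<subseteq> (\<Union>i\<in>I. pullback_cochain L (\<lambda>x. x i) ` CG i)" using cochain_descends by blast
  qed (use sub in blast)
next
  fix n
  show "grade L.W n = (\<Union>i\<in>I. pullback_cochain L (\<lambda>x. x i) ` grade (WG i) n)"
  proof
    show "grade L.W n \<subseteq> (\<Union>i\<in>I. pullback_cochain L (\<lambda>x. x i) ` grade (WG i) n)"
    proof
      fix c assume c: "c \<in> grade L.W n"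
      then have "c \<in> L.C" unfolding L.W_simps by blast
      then obtain j c' where j: "j \<in> I" and c': "c' \<in> CG j" "pullback_cochain L (\<lambda>x. x j) c' = c"
        "\<forall>n. c n = zero_cochain R L n \<longrightarrow> c' n = zero_cochain R (G j) n"
        using cochain_descends by blast
      interpret P: cochain_pullback R "G j" "T j" L TL "\<lambda>x. x j" by (rule projection_pullback[OF j])
      have "c' \<in> grade (WG j) n" using c c'(1,3) unfolding P.G.W_simps L.W_simps by simp
      then show "c \<in> (\<Union>i\<in>I. pullback_cochain L (\<lambda>x. x i) ` grade (WG i) n)" using j c'(2) by blast
    qed
    show "(\<Union>i\<in>I. pullback_cochain L (\<lambda>x. x i) ` grade (WG i) n) \<subseteq> grade L.W n"
    proof (rule UN_least, rule image_subsetI)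
      fix i c assume i: "i \<in> I" and c: "c \<in> grade (WG i) n"
      show "pullback_cochain L (\<lambda>x. x i) c \<in> grade L.W n"
        by (rule cochain_embedding.P_grade[OF cochain_pullback.embedding[OF projection_pullback[OF i]] c])
    qed
  qed
qed (rule pullback_comp | assumption)+

theorem quadratic_cohomology:
  assumes quadratic: "\<And>i. i \<in> I \<Longrightarrow> quadratic_algebra R (cohomology_algebra R (G i) (T i))"
    and inflation_inj: "\<And>i j. (i, j) \<in> r \<Longrightarrow>
      inj_on (inflation R (G j) (T j) (\<pi> i j)) (carrier (cohomology_algebra R (G i) (T i)))"
  shows "quadratic_algebra R (cohomology_algebra R L TL)"
proof -
  have "connected_graded_algebra R (cohomology_algebra R (G i) (T i))" if "i \<in> I" for i
    using quadratic[OF that] unfolding quadratic_algebra_def by blast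
  then interpret cl: cochain_limit R L.W L.C "differential R L" I r WG CG "\<lambda>i. differential R (G i)"
    "\<lambda>i. pullback_cochain L (\<lambda>x. x i)" "\<lambda>i j. pullback_cochain (G j) (\<pi> i j)"
    using inflation_inj by (rule cochain_limit)
  have "quadratic_algebra R (cl.HU i)" if "i \<in> I" for i
    using quadratic[OF that] unfolding continuous_cochains.cohomology_eq[OF G_cochains[OF that]] .
  then show ?thesis
    unfolding L.cohomology_eq by (rule directed_union_quadratic[OF cl.directed_union])
qed

end

text \<open>The whole group is one of its closed subgroups.\<close>

lemma (in Bloch_Kato_group) quadratic_cohomology:
  "quadratic_algebra (Fp p) (cohomology_algebra (Fp p) G T)"
proof -
  have "closedin T (carrier G)" unfolding topspace_eq[symmetric] by (rule closedin_topspace)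
  moreover have "subtopology T (carrier G) = T" unfolding topspace_eq[symmetric] by (rule subtopology_topspace)
  ultimately show ?thesis using closed_subgroup_quadratic[OF subgroup_self] by simp
qed

theorem proposition5p1:
  fixes p :: nat
    and I :: "'i set" and r :: "'i rel"
    and G :: "'i \<Rightarrow> 'a monoid" and T :: "'i \<Rightarrow> 'a topology"
    and \<pi> :: "'i \<Rightarrow> 'i \<Rightarrow> 'a \<Rightarrow> 'a"
  assumes "prime p"
    and "projective_system I r G T \<pi>"
    and "\<And>i. i \<in> I \<Longrightarrow> Bloch_Kato_group p (G i) (T i)"
    and "\<And>i j. (i, j) \<in> r \<Longrightarrow> \<pi> i j ` carrier (G j) = carrier (G i)"
    and "\<And>i j. (i, j) \<in> r \<Longrightarrow>
           inj_on (inflation (Fp p) (G j) (T j) (\<pi> i j))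
             (carrier (cohomology_algebra (Fp p) (G i) (T i)))"
  shows "quadratic_algebra (Fp p)
           (cohomology_algebra (Fp p) (projective_limit I r G \<pi>)
             (projective_limit_topology I r G T \<pi>))"
proof -
  interpret projective_system I r G T \<pi> by (rule assms(2))
  have profinite: "profinite_group (G i) (T i)" if "i \<in> I" for i
    using assms(3)[OF that] by (simp add: Bloch_Kato_group_def pro_p_group_def)
  have "compact_projective_system I r G T \<pi>"
  proof (intro compact_projective_system.intro compact_projective_system_axioms.intro)
    show "compact_space (T i)" "Hausdorff_space (T i)" if "i \<in> I" for i
      using profinite_group.compact[OF profinite[OF that]] profinite_group.Hausdorff[OF profinite[OF that]] .
  qed (rule assms(2,4) | assumption)+
  moreover  have "residues (int p)" using prime_gt_1_nat[OF assms(1)] by (simp add: residues_def)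
  then have "cring (Fp p)" unfolding Fp_def by (rule residues.cring)
  ultimately interpret cochain_projective_system "Fp p" I r G T \<pi>
    by (rule cochain_projective_system.intro)
  show ?thesis
    by (rule quadratic_cohomology[OF Bloch_Kato_group.quadratic_cohomology[OF assms(3)] assms(5)])
qed

end
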